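(* Let $G$ be a group of type $\mathsf{FP}_2$ with property (T). Let $F_*\to\mathbb{Z}$ be a length two partial $\mathbb{Z}G$-resolution by finite rank free $\mathbb{Z}G$-modules with fixed bases. Then there is a constant $C$, depending on the partial resolution and the bases, such that for any finite index normal subgroup $H\unlhd G$ and every coboundary $\eta\in \hom_{\mathbb{Z}H}(F_2,\mathbb{Z})$ there is a cochain $\omega\in\hom_{\mathbb{Z}H}(F_1,\mathbb{Z})$ such that $$d\omega=\eta\quad\text{and}\quad \|\omega\|\le C\|\eta\|,$$ where $\|\cdot\|$ denotes the $\ell^1$-norms induced by the bases.
   Context: A countable discrete group $G$ has property (T) if $H^1(G;\pi)=0$ for all unitary representations $\pi$ of $G$. A partial $\mathbb{Z}G$-resolution of length $n$ is an exact sequence $F_n\to F_{n-1}\to\cdots\to F_0\to\mathbb{Z}\to 0$ of left $\mathbb{Z}G$-modules, with $\mathbb{Z}$ the trivial module (i.e. the first $n+1$ terms of a resolution; no condition is imposed on the kernel of $F_n\to F_{n-1}$). $G$ is of type $\mathsf{FP}_n$ if there is such a partial resolution with every $F_i$ finitely generated projective. For $H\unlhd G$ of finite index, each $F_i$ is also a finite rank free $\mathbb{Z}H$-module. The coboundary $d:\hom_{\mathbb{Z}H}(F_1,\mathbb{Z})\to\hom_{\mathbb{Z}H}(F_2,\mathbb{Z})$ is precomposition with $F_2\to F_1$ ($\mathbb{Z}$ being the trivial $\mathbb{Z}H$-module), and a coboundary is an element of its image. If $e_1,\dots,e_k$ is the fixed $\mathbb{Z}G$-basis of $F_i$ and $t_1,\dots,t_m$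 are representatives for the cosets $H\backslash G$, then $\{t_re_j\}$ is a $\mathbb{Z}H$-basis of $F_i$, and $\|\varphi\|=\sum_{r,j}|\varphi(t_re_j)|$ for $\varphi\in\hom_{\mathbb{Z}H}(F_i,\mathbb{Z})$; this does not depend on the choice of representatives. *)

theory Defs
  imports "HOL-Analysis.Analysis" "HOL-Algebra.Algebra" "HOL-Algebra.Algebraic_Closure_Type"
begin

section \<open>Left modules over a not necessarily commutative ring\<close>

text \<open>The library locale for modules requires a commutative ring, so it does not apply to group
  rings. The library record type is reused; its multiplicative fields \<open>mult\<close> and \<open>one\<close> play no role.\<close>

locale left_module = R?: ring R + M?: abelian_group M
  for R :: "('a, 'r) ring_scheme" (structure) and M :: "('a, 'm, 'z) module_scheme" (structure) +
  assumes smult_closed: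
      "\<lbrakk>a \<in> carrier R; x \<in> carrier M\<rbrakk> \<Longrightarrow> a \<odot>\<^bsub>M\<^esub> x \<in> carrier M"
    and smult_l_distr:
      "\<lbrakk>a \<in> carrier R; b \<in> carrier R; x \<in> carrier M\<rbrakk> \<Longrightarrow>
        (a \<oplus>\<^bsub>R\<^esub> b) \<odot>\<^bsub>M\<^esub> x = a \<odot>\<^bsub>M\<^esub> x \<oplus>\<^bsub>M\<^esub> b \<odot>\<^bsub>M\<^esub> x"
    and smult_r_distr:
      "\<lbrakk>a \<in> carrier R; x \<in> carrier M; y \<in> carrier M\<rbrakk> \<Longrightarrow>
        a \<odot>\<^bsub>M\<^esub> (x \<oplus>\<^bsub>M\<^esub> y) = a \<odot>\<^bsub>M\<^esub> x \<oplus>\<^bsub>M\<^esub> a \<odot>\<^bsub>M\<^esub> y"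
    and smult_assoc:
      "\<lbrakk>a \<in> carrier R; b \<in> carrier R; x \<in> carrier M\<rbrakk> \<Longrightarrow>
        (a \<otimes>\<^bsub>R\<^esub> b) \<odot>\<^bsub>M\<^esub> x = a \<odot>\<^bsub>M\<^esub> (b \<odot>\<^bsub>M\<^esub> x)"
    and smult_one:
      "x \<in> carrier M \<Longrightarrow> \<one>\<^bsub>R\<^esub> \<odot>\<^bsub>M\<^esub> x = x"

definition left_module_hom ::
  "('a, 'r) ring_scheme \<Rightarrow> ('a, 'm, 'x) module_scheme \<Rightarrow> ('a, 'n, 'y) module_scheme \<Rightarrow> ('m \<Rightarrow> 'n) set"
  where "left_module_hom R M N = {f \<in> carrier M \<rightarrow> carrier N.
    (\<forall>x\<in>carrier M. \<forall>y\<in>carrier M. f (x \<oplus>\<^bsub>M\<^esub> y) = f x \<oplus>\<^bsub>N\<^esub> f y) \<and>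
    (\<forall>a\<in>carrier R. \<forall>x\<in>carrier M. f (a \<odot>\<^bsub>M\<^esub> x) = a \<odot>\<^bsub>N\<^esub> f x)}"

definition finite_basis ::
  "('a, 'r) ring_scheme \<Rightarrow> ('a, 'm, 'x) module_scheme \<Rightarrow> 'm set \<Rightarrow> bool"
  where "finite_basis R M B \<longleftrightarrow> finite B \<and> B \<subseteq> carrier M \<and>
    (\<forall>x\<in>carrier M. \<exists>!c. c \<in> B \<rightarrow>\<^sub>E carrier R \<and> x = (\<Oplus>\<^bsub>M\<^esub>b\<in>B. c b \<odot>\<^bsub>M\<^esub> b))"

definition finitely_generated :: "('a, 'r) ring_scheme \<Rightarrow> ('a, 'm, 'x) module_scheme \<Rightarrow> bool"
  where "finitely_generated R M \<longleftrightarrow> (\<exists>S. finite S \<and> S \<subseteq> carrier M \<and>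
    (\<forall>x\<in>carrier M. \<exists>c\<in>S \<rightarrow> carrier R. x = (\<Oplus>\<^bsub>M\<^esub>s\<in>S. c s \<odot>\<^bsub>M\<^esub> s)))"

definition free_module :: "('a, 'r) ring_scheme \<Rightarrow> 's set \<Rightarrow> ('a, 's \<Rightarrow> 'a) module"
  where "free_module R I =
    \<lparr>carrier = {c. (\<forall>s\<in>I. c s \<in> carrier R) \<and> (\<forall>s. s \<notin> I \<longrightarrow> c s = \<zero>\<^bsub>R\<^esub>) \<and>
                   finite {s. c s \<noteq> \<zero>\<^bsub>R\<^esub>}},
     mult = undefined, one = undefined,
     ring.zero = (\<lambda>s. \<zero>\<^bsub>R\<^esub>), add = (\<lambda>c c' s. c s \<oplus>\<^bsub>R\<^esub> c' s),
     smult = (\<lambda>a c s. a \<otimes>\<^bsub>R\<^esub> c s)\<rparr>"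

text \<open>Projective means: a direct summand of a free module. Free modules on sets of elements of
  the type of \<open>M\<close> suffice, since a projective \<open>M\<close> is a summand of the free module on \<open>carrier M\<close>.\<close>

definition projective_module :: "('a, 'r) ring_scheme \<Rightarrow> ('a, 'm, 'x) module_scheme \<Rightarrow> bool"
  where "projective_module R M \<longleftrightarrow> (\<exists>I :: 'm set.
    \<exists>j\<in>left_module_hom R M (free_module R I). \<exists>p\<in>left_module_hom R (free_module R I) M.
      \<forall>x\<in>carrier M. p (j x) = x)"

section \<open>Group rings and partial resolutions\<close>

definition group_ring :: "('g, 'b) monoid_scheme \<Rightarrow> ('g \<Rightarrow> int) ring"
  where "group_ring G =
    \<lparr>carrier = {a. finite {g. a g \<noteq> 0} \<and> {g. a g \<noteq> 0} \<subseteq> carrier G},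
     mult = (\<lambda>a b g. if g \<in> carrier G
               then \<Sum>h\<in>{h. a h \<noteq> 0}. a h * b (inv\<^bsub>G\<^esub> h \<otimes>\<^bsub>G\<^esub> g) else 0),
     one = (\<lambda>g. if g = \<one>\<^bsub>G\<^esub> then 1 else 0),
     ring.zero = (\<lambda>g. 0),
     add = (\<lambda>a b g. a g + b g)\<rparr>"

definition group_ring_of :: "'g \<Rightarrow> 'g \<Rightarrow> int"
  where "group_ring_of g = (\<lambda>h. if h = g then 1 else 0)"

text \<open>The integers with trivial action: scalars act through the augmentation. For a subgroup \<open>H\<close>
  of \<open>G\<close>, elements of the group ring of \<open>G\<lparr>carrier := H\<rparr>\<close> are literally elements of
  the group ring of \<open>G\<close>, so the records below serve as modules over both rings.\<close>

definition trivial_module :: "('g \<Rightarrow> int, int) module"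
  where "trivial_module =
    \<lparr>carrier = UNIV, mult = (*), one = 1, ring.zero = 0, add = (+),
     smult = (\<lambda>a n. (\<Sum>g\<in>{g. a g \<noteq> 0}. a g) * n)\<rparr>"

text \<open>\<open>d i\<close> is the map from \<open>F i\<close> to \<open>F (i - 1)\<close>, for \<open>i\<close> from 1 to \<open>n\<close>, and \<open>e\<close> is the map from
  \<open>F 0\<close> to the integers. All \<open>F i\<close> with \<open>i > n\<close> are irrelevant.\<close>

definition partial_resolution ::
  "('g, 'b) monoid_scheme \<Rightarrow> nat \<Rightarrow> (nat \<Rightarrow> ('g \<Rightarrow> int, 'm) module) \<Rightarrow>
    (nat \<Rightarrow> 'm \<Rightarrow> 'm) \<Rightarrow> ('m \<Rightarrow> int) \<Rightarrow> bool"
  where "partial_resolution G n F d e \<longleftrightarrow>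
    (\<forall>i\<le>n. left_module (group_ring G) (F i)) \<and>
    (\<forall>i<n. d (Suc i) \<in> left_module_hom (group_ring G) (F (Suc i)) (F i)) \<and>
    e \<in> left_module_hom (group_ring G) (F 0) trivial_module \<and>
    e ` carrier (F 0) = UNIV \<and>
    (0 < n \<longrightarrow> d 1 ` carrier (F 1) = a_kernel (F 0) (trivial_module :: ('g \<Rightarrow> int, int) module) e) \<and>
    (\<forall>i. Suc i < n \<longrightarrow>
       d (Suc (Suc i)) ` carrier (F (Suc (Suc i))) = a_kernel (F (Suc i)) (F i) (d (Suc i)))"

text \<open>Every finitely generated projective module is isomorphic to a submodule of a
  finite rank free module, hence to a module with elements in \<open>nat \<Rightarrow> 'g \<Rightarrow> int\<close>; so nothing is lost by
  letting the existential quantifier range over modules with elements in this type.\<close>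

definition type_FP :: "('g, 'b) monoid_scheme \<Rightarrow> nat \<Rightarrow> bool"
  where "type_FP G n \<longleftrightarrow>
    (\<exists>(F :: nat \<Rightarrow> ('g \<Rightarrow> int, nat \<Rightarrow> 'g \<Rightarrow> int) module) d e. partial_resolution G n F d e \<and>
      (\<forall>i\<le>n. finitely_generated (group_ring G) (F i) \<and> projective_module (group_ring G) (F i)))"

section \<open>Cochains and norms\<close>

definition cochains ::
  "('g, 'b) monoid_scheme \<Rightarrow> 'g set \<Rightarrow> ('g \<Rightarrow> int, 'm) module \<Rightarrow> ('m \<Rightarrow> int) set"
  where "cochains G H M =
    left_module_hom (group_ring (G\<lparr>carrier := H\<rparr>)) M trivial_module \<inter> extensional (carrier M)"

definition coboundary_map ::
  "(nat \<Rightarrow> ('g \<Rightarrow> int, 'm) module) \<Rightarrow> (nat \<Rightarrow> 'm \<Rightarrow> 'm) \<Rightarrow> nat \<Rightarrow> ('m \<Rightarrow> int) \<Rightarrow> 'm \<Rightarrow> int"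
  where "coboundary_map F d i \<phi> = compose (carrier (F (Suc i))) \<phi> (d (Suc i))"

text \<open>\<open>B\<close> is a basis of \<open>M\<close> over the group ring of \<open>G\<close>. Representatives are picked by choice, which
  is harmless by the independence lemma \<open>l1_norm_transversal\<close> below.\<close>

definition l1_norm ::
  "('g, 'b) monoid_scheme \<Rightarrow> 'g set \<Rightarrow> ('g \<Rightarrow> int, 'm) module \<Rightarrow> 'm set \<Rightarrow> ('m \<Rightarrow> int) \<Rightarrow> real"
  where "l1_norm G H M B \<phi> =
    (\<Sum>K\<in>rcosets\<^bsub>G\<^esub> H. \<Sum>b\<in>B. real_of_int \<bar>\<phi> (group_ring_of (SOME t. t \<in> K) \<odot>\<^bsub>M\<^esub> b)\<bar>)"

section \<open>Unitary representations and property (T)\<close>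

record 'h cinner_space = "(complex, 'h) module" +
  cinner :: "'h \<Rightarrow> 'h \<Rightarrow> complex"

text \<open>The library locale of metric spaces demands symmetry and nonnegativity also for points
  outside the carrier, whence the dummy value 0.\<close>

definition cinner_dist :: "'h cinner_space \<Rightarrow> 'h \<Rightarrow> 'h \<Rightarrow> real"
  where "cinner_dist V x y = (if x \<in> carrier V \<and> y \<in> carrier V
    then sqrt (Re (cinner V (x \<ominus>\<^bsub>V\<^esub> y) (x \<ominus>\<^bsub>V\<^esub> y))) else 0)"

locale chilbert_space = Module.module "ring_of_type_algebra :: complex ring" V
  for V :: "'h cinner_space" (structure) +
  assumes cinner_commute:
      "\<lbrakk>x \<in> carrier V; y \<in> carrier V\<rbrakk> \<Longrightarrow> cinner V x y = cnj (cinner V y x)"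
    and cinner_add_left:
      "\<lbrakk>x \<in> carrier V; y \<in> carrier V; z \<in> carrier V\<rbrakk> \<Longrightarrow>
        cinner V (x \<oplus>\<^bsub>V\<^esub> y) z = cinner V x z + cinner V y z"
    and cinner_smult_left:
      "\<lbrakk>x \<in> carrier V; y \<in> carrier V\<rbrakk> \<Longrightarrow> cinner V (a \<odot>\<^bsub>V\<^esub> x) y = a * cinner V x y"
    and cinner_pos:
      "\<lbrakk>x \<in> carrier V; x \<noteq> \<zero>\<^bsub>V\<^esub>\<rbrakk> \<Longrightarrow> 0 < Re (cinner V x x)"
    and complete: "Metric_space.mcomplete (carrier V) (cinner_dist V)"

locale unitary_rep = Group.group G + chilbert_space V
  for G :: "('g, 'b) monoid_scheme" (structure) and V :: "'h cinner_space" (structure) +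
  fixes \<pi> :: "'g \<Rightarrow> 'h \<Rightarrow> 'h"
  assumes rep_bij: "g \<in> carrier G \<Longrightarrow> bij_betw (\<pi> g) (carrier V) (carrier V)"
    and rep_add: "\<lbrakk>g \<in> carrier G; x \<in> carrier V; y \<in> carrier V\<rbrakk> \<Longrightarrow>
      \<pi> g (x \<oplus>\<^bsub>V\<^esub> y) = \<pi> g x \<oplus>\<^bsub>V\<^esub> \<pi> g y"
    and rep_smult: "\<lbrakk>g \<in> carrier G; x \<in> carrier V\<rbrakk> \<Longrightarrow> \<pi> g (a \<odot>\<^bsub>V\<^esub> x) = a \<odot>\<^bsub>V\<^esub> \<pi> g x"
    and rep_cinner: "\<lbrakk>g \<in> carrier G; x \<in> carrier V; y \<in> carrier V\<rbrakk> \<Longrightarrow>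
      cinner V (\<pi> g x) (\<pi> g y) = cinner V x y"
    and rep_mult: "\<lbrakk>g \<in> carrier G; h \<in> carrier G; x \<in> carrier V\<rbrakk> \<Longrightarrow>
      \<pi> (g \<otimes>\<^bsub>G\<^esub> h) x = \<pi> g (\<pi> h x)"

definition one_cocycles ::
  "('g, 'b) monoid_scheme \<Rightarrow> 'h cinner_space \<Rightarrow> ('g \<Rightarrow> 'h \<Rightarrow> 'h) \<Rightarrow> ('g \<Rightarrow> 'h) set"
  where "one_cocycles G V \<pi> = {c \<in> carrier G \<rightarrow>\<^sub>E carrier V.
    \<forall>g\<in>carrier G. \<forall>h\<in>carrier G. c (g \<otimes>\<^bsub>G\<^esub> h) = c g \<oplus>\<^bsub>V\<^esub> \<pi> g (c h)}"

definition one_coboundaries ::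
  "('g, 'b) monoid_scheme \<Rightarrow> 'h cinner_space \<Rightarrow> ('g \<Rightarrow> 'h \<Rightarrow> 'h) \<Rightarrow> ('g \<Rightarrow> 'h) set"
  where "one_coboundaries G V \<pi> = {\<lambda>g\<in>carrier G. \<pi> g v \<ominus>\<^bsub>V\<^esub> v | v. v \<in> carrier V}"

definition H1_vanishes ::
  "('g, 'b) monoid_scheme \<Rightarrow> 'h cinner_space \<Rightarrow> ('g \<Rightarrow> 'h \<Rightarrow> 'h) \<Rightarrow> bool"
  where "H1_vanishes G V \<pi> \<longleftrightarrow> one_cocycles G V \<pi> = one_coboundaries G V \<pi>"

text \<open>The quantifier ranges over all Hilbert spaces whose underlying set consists of elements of
  \<open>nat \<Rightarrow> complex\<close>, with arbitrary operations. Up to isomorphism these include all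
  separable Hilbert spaces. As \<open>G\<close> is countable, the values of a cocycle lie in a separable closed
  subrepresentation, and a cocycle that is a coboundary there is one in the whole space; so this is
  equivalent to quantifying over all unitary representations.\<close>

definition property_T :: "('g, 'b) monoid_scheme \<Rightarrow> bool"
  where "property_T G \<longleftrightarrow> Group.group G \<and> countable (carrier G) \<and>
    (\<forall>(V :: (nat \<Rightarrow> complex) cinner_space) \<pi>. unitary_rep G V \<pi> \<longrightarrow> H1_vanishes G V \<pi>)"

section \<open>Well-definedness\<close>

lemma (in Group.group) group_ring_mult_eq:
  assumes "finite S" "{h. a h \<noteq> 0} \<subseteq> S" "g \<in> carrier G"
  shows "(a \<otimes>\<^bsub>group_ring G\<^esub> b) g = (\<Sum>h\<in>S. a h * b (inv h \<otimes> g))"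
proof -
  have "(\<Sum>h\<in>{h. a h \<noteq> 0}. a h * b (inv h \<otimes> g)) = (\<Sum>h\<in>S. a h * b (inv h \<otimes> g))"
    using assms by (intro sum.mono_neutral_left) auto
  then show ?thesis using assms by (simp add: group_ring_def)
qed

lemma (in Group.group) group_ring_mult_supp:
  assumes a: "a \<in> carrier (group_ring G)" and b: "b \<in> carrier (group_ring G)"
  defines "P \<equiv> (\<lambda>(h, k). h \<otimes> k) ` ({h. a h \<noteq> 0} \<times> {k. b k \<noteq> 0})"
  shows "finite P" "P \<subseteq> carrier G" "{g. (a \<otimes>\<^bsub>group_ring G\<^esub> b) g \<noteq> 0} \<subseteq> P"
proof -
  show "finite P" using a b by (auto simp: P_def group_ring_def)
  show "P \<subseteq> carrier G" using a b by (auto simp: P_def group_ring_def)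
  show "{g. (a \<otimes>\<^bsub>group_ring G\<^esub> b) g \<noteq> 0} \<subseteq> P"
  proof
    fix g assume "g \<in> {g. (a \<otimes>\<^bsub>group_ring G\<^esub> b) g \<noteq> 0}"
    then have nz: "(a \<otimes>\<^bsub>group_ring G\<^esub> b) g \<noteq> 0" by simp
    then have g: "g \<in> carrier G" by (auto simp: group_ring_def split: if_splits)
    from nz g have "(\<Sum>h\<in>{h. a h \<noteq> 0}. a h * b (inv h \<otimes> g)) \<noteq> 0"
      by (simp add: group_ring_def)
    then obtain h where h: "a h \<noteq> 0" "b (inv h \<otimes> g) \<noteq> 0"
      by (rule sum.not_neutral_contains_not_neutral) auto
    have hG: "h \<in> carrier G" using h a by (auto simp: group_ring_def)
    have eq: "h \<otimes> (inv h \<otimes> g) = g" using hG g by (simp add: m_assoc[symmetric])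
    have "(\<lambda>(h, k). h \<otimes> k) (h, inv h \<otimes> g) \<in> P"
      unfolding P_def by (rule imageI) (use h in simp)
    then show "g \<in> P" by (simp add: eq)
  qed
qed

lemma (in Group.group) group_ring_mult_closed:
  assumes "a \<in> carrier (group_ring G)" "b \<in> carrier (group_ring G)"
  shows "a \<otimes>\<^bsub>group_ring G\<^esub> b \<in> carrier (group_ring G)"
proof -
  let ?c = "a \<otimes>\<^bsub>group_ring G\<^esub> b"
  note supp = group_ring_mult_supp[OF assms]
  have "finite {g. ?c g \<noteq> 0}" "{g. ?c g \<noteq> 0} \<subseteq> carrier G"
    by (rule finite_subset[OF supp(3) supp(1)], rule subset_trans[OF supp(3) supp(2)])
  then show ?thesis by (simp add: group_ring_def)
qed

lemma (in Group.group) group_ring_add_closed: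
  assumes "a \<in> carrier (group_ring G)" "b \<in> carrier (group_ring G)"
  shows "a \<oplus>\<^bsub>group_ring G\<^esub> b \<in> carrier (group_ring G)"
proof -
  have "{g. a g + b g \<noteq> 0} \<subseteq> {g. a g \<noteq> 0} \<union> {g. b g \<noteq> 0}" by auto
  then show ?thesis using assms unfolding group_ring_def
    by (auto intro: finite_subset[of _ "{g. a g \<noteq> 0} \<union> {g. b g \<noteq> 0}"])
qed

lemma (in Group.group) group_ring_assoc:
  assumes a: "a \<in> carrier (group_ring G)" and b: "b \<in> carrier (group_ring G)"
    and c: "c \<in> carrier (group_ring G)"
  shows "(a \<otimes>\<^bsub>group_ring G\<^esub> b) \<otimes>\<^bsub>group_ring G\<^esub> c = a \<otimes>\<^bsub>group_ring G\<^esub> (b \<otimes>\<^bsub>group_ring G\<^esub> c)"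
proof
  fix g
  define A where "A = {h. a h \<noteq> 0}"
  define B where "B = {h. b h \<noteq> 0}"
  define P where "P = (\<lambda>(h, k). h \<otimes> k) ` (A \<times> B)"
  note P = group_ring_mult_supp[OF a b, folded A_def B_def, folded P_def]
  have A: "finite A" "A \<subseteq> carrier G" using a by (auto simp: A_def group_ring_def)
  have B: "finite B" "B \<subseteq> carrier G" using b by (auto simp: B_def group_ring_def)
  show "((a \<otimes>\<^bsub>group_ring G\<^esub> b) \<otimes>\<^bsub>group_ring G\<^esub> c) g =
    (a \<otimes>\<^bsub>group_ring G\<^esub> (b \<otimes>\<^bsub>group_ring G\<^esub> c)) g"
  proof (cases "g \<in> carrier G")
    case False
    then show ?thesis by (simp add: group_ring_def)
  next
    case g: True
    have inner: "(\<Sum>k\<in>P. b (inv h \<otimes> k) * c (inv k \<otimes> g)) =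
      (b \<otimes>\<^bsub>group_ring G\<^esub> c) (inv h \<otimes> g)" if h: "h \<in> A" for h
    proof -
      have hG: "h \<in> carrier G" using h A by auto
      have inj: "inj_on ((\<otimes>) h) B" using hG B by (intro inj_onI) (metis l_cancel subsetD)
      have sub: "(\<otimes>) h ` B \<subseteq> P" using h by (auto simp: P_def)
      have "(\<Sum>k\<in>P. b (inv h \<otimes> k) * c (inv k \<otimes> g)) =
          (\<Sum>k\<in>(\<otimes>) h ` B. b (inv h \<otimes> k) * c (inv k \<otimes> g))"
      proof (rule sum.mono_neutral_right[OF P(1) sub], rule ballI)
        fix k assume k: "k \<in> P - (\<otimes>) h ` B"
        then have kG: "k \<in> carrier G" using P(2) by auto
        have "k = h \<otimes> (inv h \<otimes> k)" using hG kG by (simp add: m_assoc[symmetric])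
        then have "inv h \<otimes> k \<notin> B" using k by (metis DiffE imageI)
        then show "b (inv h \<otimes> k) * c (inv k \<otimes> g) = 0" by (simp add: B_def)
      qed
      also have "\<dots> = (\<Sum>l\<in>B. b (inv h \<otimes> (h \<otimes> l)) * c (inv (h \<otimes> l) \<otimes> g))"
        using inj by (simp add: sum.reindex)
      also have "\<dots> = (\<Sum>l\<in>B. b l * c (inv l \<otimes> (inv h \<otimes> g)))"
      proof (rule sum.cong[OF refl])
        fix l assume "l \<in> B"
        then have lG: "l \<in> carrier G" using B by auto
        show "b (inv h \<otimes> (h \<otimes> l)) * c (inv (h \<otimes> l) \<otimes> g) = b l * c (inv l \<otimes> (inv h \<otimes> g))"
          using hG lG g by (simp add: m_assoc[symmetric] inv_mult_group)
      qed
      also have "\<dots> = (b \<otimes>\<^bsub>group_ring G\<^esub> c) (inv h \<otimes> g)"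
        using B hG g by (intro group_ring_mult_eq[symmetric]) (auto simp: B_def)
      finally show ?thesis .
    qed
    have "((a \<otimes>\<^bsub>group_ring G\<^esub> b) \<otimes>\<^bsub>group_ring G\<^esub> c) g =
        (\<Sum>k\<in>P. (a \<otimes>\<^bsub>group_ring G\<^esub> b) k * c (inv k \<otimes> g))"
      using P g by (intro group_ring_mult_eq) auto
    also have "\<dots> = (\<Sum>k\<in>P. (\<Sum>h\<in>A. a h * b (inv h \<otimes> k)) * c (inv k \<otimes> g))"
    proof (rule sum.cong[OF refl])
      fix k assume "k \<in> P"
      then have "k \<in> carrier G" using P(2) by auto
      then have "(a \<otimes>\<^bsub>group_ring G\<^esub> b) k = (\<Sum>h\<in>A. a h * b (inv h \<otimes> k))"
        using A by (intro group_ring_mult_eq) (auto simp: A_def)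
      then show "(a \<otimes>\<^bsub>group_ring G\<^esub> b) k * c (inv k \<otimes> g) =
          (\<Sum>h\<in>A. a h * b (inv h \<otimes> k)) * c (inv k \<otimes> g)" by simp
    qed
    also have "\<dots> = (\<Sum>h\<in>A. a h * (\<Sum>k\<in>P. b (inv h \<otimes> k) * c (inv k \<otimes> g)))"
      unfolding sum_distrib_right sum_distrib_left mult.assoc by (rule sum.swap)
    also have "\<dots> = (\<Sum>h\<in>A. a h * (b \<otimes>\<^bsub>group_ring G\<^esub> c) (inv h \<otimes> g))"
      by (intro sum.cong refl) (simp add: inner)
    also have "\<dots> = (a \<otimes>\<^bsub>group_ring G\<^esub> (b \<otimes>\<^bsub>group_ring G\<^esub> c)) g"
      using A g by (intro group_ring_mult_eq[symmetric]) (auto simp: A_def)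
    finally show ?thesis .
  qed
qed

lemma (in Group.group) group_ring_is_ring: "ring (group_ring G)"
proof (rule ringI)
  show "abelian_group (group_ring G)"
  proof (rule abelian_groupI)
    fix a assume a: "a \<in> carrier (group_ring G)"
    show "\<exists>b\<in>carrier (group_ring G). b \<oplus>\<^bsub>group_ring G\<^esub> a = \<zero>\<^bsub>group_ring G\<^esub>"
      using a by (intro bexI[of _ "\<lambda>g. - a g"]) (auto simp: group_ring_def)
  qed (use group_ring_add_closed in \<open>auto simp: group_ring_def\<close>)
  show "Group.monoid (group_ring G)"
  proof (rule monoidI)
    show one: "\<one>\<^bsub>group_ring G\<^esub> \<in> carrier (group_ring G)"
      by (auto simp: group_ring_def)
    fix a assume a: "a \<in> carrier (group_ring G)"
    show "\<one>\<^bsub>group_ring G\<^esub> \<otimes>\<^bsub>group_ring G\<^esub> a = a"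
    proof
      fix g
      show "(\<one>\<^bsub>group_ring G\<^esub> \<otimes>\<^bsub>group_ring G\<^esub> a) g = a g"
      proof (cases "g \<in> carrier G")
        case True
        then have "(\<one>\<^bsub>group_ring G\<^esub> \<otimes>\<^bsub>group_ring G\<^esub> a) g =
            (\<Sum>h\<in>{\<one>}. \<one>\<^bsub>group_ring G\<^esub> h * a (inv h \<otimes> g))"
          by (intro group_ring_mult_eq) (auto simp: group_ring_def)
        then show ?thesis using True by (simp add: group_ring_def)
      qed (use a in \<open>auto simp: group_ring_def\<close>)
    qed
    show "a \<otimes>\<^bsub>group_ring G\<^esub> \<one>\<^bsub>group_ring G\<^esub> = a"
    proof
      fix g
      show "(a \<otimes>\<^bsub>group_ring G\<^esub> \<one>\<^bsub>group_ring G\<^esub>) g = a g"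
      proof (cases "g \<in> carrier G")
        case True
        have fin: "finite {h. a h \<noteq> 0}" using a by (simp add: group_ring_def)
        have "(a \<otimes>\<^bsub>group_ring G\<^esub> \<one>\<^bsub>group_ring G\<^esub>) g =
            (\<Sum>h\<in>insert g {h. a h \<noteq> 0}. a h * \<one>\<^bsub>group_ring G\<^esub> (inv h \<otimes> g))"
          using True fin by (intro group_ring_mult_eq) auto
        also have "\<dots> = (\<Sum>h\<in>insert g {h. a h \<noteq> 0}. if h = g then a h else 0)"
        proof (rule sum.cong[OF refl])
          fix h assume "h \<in> insert g {h. a h \<noteq> 0}"
          then have hG: "h \<in> carrier G" using True a by (auto simp: group_ring_def)
          have "inv h \<otimes> g = \<one> \<longleftrightarrow> h = g"
            using hG True by (metis inv_equality inv_inv l_inv inv_closed)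
          then show "a h * \<one>\<^bsub>group_ring G\<^esub> (inv h \<otimes> g) = (if h = g then a h else 0)"
            by (simp add: group_ring_def)
        qed
        also have "\<dots> = a g" using fin by (simp add: sum.delta)
        finally show ?thesis .
      qed (use a in \<open>auto simp: group_ring_def\<close>)
    qed
  qed (use group_ring_mult_closed group_ring_assoc in auto)
next
  fix a b c
  assume abc: "a \<in> carrier (group_ring G)" "b \<in> carrier (group_ring G)" "c \<in> carrier (group_ring G)"
  let ?S = "{h. a h \<noteq> 0} \<union> {h. b h \<noteq> 0}"
  have S: "finite ?S" using abc by (simp add: group_ring_def)
  show "(a \<oplus>\<^bsub>group_ring G\<^esub> b) \<otimes>\<^bsub>group_ring G\<^esub> c =
    a \<otimes>\<^bsub>group_ring G\<^esub> c \<oplus>\<^bsub>group_ring G\<^esub> b \<otimes>\<^bsub>group_ring G\<^esub> c"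
  proof
    fix g
    show "((a \<oplus>\<^bsub>group_ring G\<^esub> b) \<otimes>\<^bsub>group_ring G\<^esub> c) g =
      (a \<otimes>\<^bsub>group_ring G\<^esub> c \<oplus>\<^bsub>group_ring G\<^esub> b \<otimes>\<^bsub>group_ring G\<^esub> c) g"
    proof (cases "g \<in> carrier G")
      case True
      have "((a \<oplus>\<^bsub>group_ring G\<^esub> b) \<otimes>\<^bsub>group_ring G\<^esub> c) g =
          (\<Sum>h\<in>?S. (a \<oplus>\<^bsub>group_ring G\<^esub> b) h * c (inv h \<otimes> g))"
        using S True by (intro group_ring_mult_eq) (auto simp: group_ring_def)
      also have "\<dots> = (\<Sum>h\<in>?S. a h * c (inv h \<otimes> g)) + (\<Sum>h\<in>?S. b h * c (inv h \<otimes> g))"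
        by (simp add: group_ring_def algebra_simps sum.distrib)
      also have "(\<Sum>h\<in>?S. a h * c (inv h \<otimes> g)) = (a \<otimes>\<^bsub>group_ring G\<^esub> c) g"
        using S True by (intro group_ring_mult_eq[symmetric]) auto
      also have "(\<Sum>h\<in>?S. b h * c (inv h \<otimes> g)) = (b \<otimes>\<^bsub>group_ring G\<^esub> c) g"
        using S True by (intro group_ring_mult_eq[symmetric]) auto
      finally show ?thesis by (simp add: group_ring_def)
    qed (simp add: group_ring_def)
  qed
  show "c \<otimes>\<^bsub>group_ring G\<^esub> (a \<oplus>\<^bsub>group_ring G\<^esub> b) =
    c \<otimes>\<^bsub>group_ring G\<^esub> a \<oplus>\<^bsub>group_ring G\<^esub> c \<otimes>\<^bsub>group_ring G\<^esub> b"
    by (rule ext) (simp add: group_ring_def algebra_simps sum.distrib)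
qed

lemma (in Group.group) group_ring_of_closed:
  "g \<in> carrier G \<Longrightarrow> group_ring_of g \<in> carrier (group_ring G)"
  by (auto simp: group_ring_of_def group_ring_def)

lemma (in Group.group) group_ring_of_mult:
  assumes "g \<in> carrier G" "h \<in> carrier G"
  shows "group_ring_of (g \<otimes> h) = group_ring_of g \<otimes>\<^bsub>group_ring G\<^esub> group_ring_of h"
proof
  fix k
  show "group_ring_of (g \<otimes> h) k = (group_ring_of g \<otimes>\<^bsub>group_ring G\<^esub> group_ring_of h) k"
  proof (cases "k \<in> carrier G")
    case True
    have "(group_ring_of g \<otimes>\<^bsub>group_ring G\<^esub> group_ring_of h) k =
        (\<Sum>l\<in>{g}. group_ring_of g l * group_ring_of h (inv l \<otimes> k))"
      using True by (intro group_ring_mult_eq) (auto simp: group_ring_of_def)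
    also have "\<dots> = (if inv g \<otimes> k = h then 1 else 0)" by (simp add: group_ring_of_def)
    also have "inv g \<otimes> k = h \<longleftrightarrow> k = g \<otimes> h" using assms True by (auto simp: m_assoc[symmetric])
    finally show ?thesis by (simp add: group_ring_of_def)
  qed (use assms in \<open>auto simp: group_ring_of_def group_ring_def\<close>)
qed

lemma sum_support_extend:
  fixes a :: "'g \<Rightarrow> int"
  assumes "finite S" "{g. a g \<noteq> 0} \<subseteq> S"
  shows "(\<Sum>g\<in>{g. a g \<noteq> 0}. a g) = (\<Sum>g\<in>S. a g)"
  using assms by (intro sum.mono_neutral_left) auto

lemma (in Group.group) augmentation_mult:
  assumes a: "a \<in> carrier (group_ring G)" and b: "b \<in> carrier (group_ring G)"
  defines "ab \<equiv> a \<otimes>\<^bsub>group_ring G\<^esub> b"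
  shows "(\<Sum>g\<in>{g. ab g \<noteq> 0}. ab g) = (\<Sum>g\<in>{g. a g \<noteq> 0}. a g) * (\<Sum>g\<in>{g. b g \<noteq> 0}. b g)"
proof -
  define A where "A = {h. a h \<noteq> 0}"
  define B where "B = {h. b h \<noteq> 0}"
  define P where "P = (\<lambda>(h, k). h \<otimes> k) ` (A \<times> B)"
  note P = group_ring_mult_supp[OF a b, folded A_def B_def, folded P_def]
  have A: "finite A" "A \<subseteq> carrier G" using a by (auto simp: A_def group_ring_def)
  have B: "finite B" "B \<subseteq> carrier G" using b by (auto simp: B_def group_ring_def)
  have inner: "(\<Sum>k\<in>P. b (inv h \<otimes> k)) = (\<Sum>l\<in>B. b l)" if h: "h \<in> A" for h
  proof -
    have hG: "h \<in> carrier G" using h A by auto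
    have inj: "inj_on ((\<otimes>) h) B" using hG B by (intro inj_onI) (metis l_cancel subsetD)
    have sub: "(\<otimes>) h ` B \<subseteq> P" using h by (auto simp: P_def)
    have "(\<Sum>k\<in>P. b (inv h \<otimes> k)) = (\<Sum>k\<in>(\<otimes>) h ` B. b (inv h \<otimes> k))"
    proof (rule sum.mono_neutral_right[OF P(1) sub], rule ballI)
      fix k assume k: "k \<in> P - (\<otimes>) h ` B"
      then have kG: "k \<in> carrier G" using P(2) by auto
      have "k = h \<otimes> (inv h \<otimes> k)" using hG kG by (simp add: m_assoc[symmetric])
      then have "inv h \<otimes> k \<notin> B" using k by (metis DiffE imageI)
      then show "b (inv h \<otimes> k) = 0" by (simp add: B_def)
    qed
    also have "\<dots> = (\<Sum>l\<in>B. b (inv h \<otimes> (h \<otimes> l)))"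
      using inj by (simp add: sum.reindex)
    also have "\<dots> = (\<Sum>l\<in>B. b l)"
      using hG B by (intro sum.cong refl) (auto simp: m_assoc[symmetric] subset_iff)
    finally show ?thesis .
  qed
  have "(\<Sum>g\<in>{g. ab g \<noteq> 0}. ab g) = (\<Sum>k\<in>P. ab k)"
    using P by (intro sum_support_extend) (auto simp: ab_def)
  also have "\<dots> = (\<Sum>k\<in>P. \<Sum>h\<in>A. a h * b (inv h \<otimes> k))"
    unfolding ab_def using P A
    by (intro sum.cong refl group_ring_mult_eq) (auto simp: A_def)
  also have "\<dots> = (\<Sum>h\<in>A. a h * (\<Sum>k\<in>P. b (inv h \<otimes> k)))"
    unfolding sum_distrib_left by (rule sum.swap)
  also have "\<dots> = (\<Sum>h\<in>A. a h) * (\<Sum>l\<in>B. b l)"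
    by (simp add: inner sum_distrib_right)
  finally show ?thesis by (simp add: A_def B_def)
qed

lemma (in Group.group) trivial_module_is_left_module: "left_module (group_ring G) trivial_module"
proof -
  interpret ring "group_ring G" by (rule group_ring_is_ring)
  show ?thesis
  proof (intro left_module.intro left_module_axioms.intro)
    show "ring (group_ring G)" by (rule group_ring_is_ring)
    show "abelian_group trivial_module"
      by (rule abelian_groupI) (auto simp: trivial_module_def intro: exI[of _ "- x" for x])
  next
    fix a b :: "'a \<Rightarrow> int" and x :: int
    assume ab: "a \<in> carrier (group_ring G)" "b \<in> carrier (group_ring G)"
    let ?S = "{h. a h \<noteq> 0} \<union> {h. b h \<noteq> 0}"
    have S: "finite ?S" using ab by (simp add: group_ring_def)
    have "(\<Sum>g\<in>{g. (a \<oplus>\<^bsub>group_ring G\<^esub> b) g \<noteq> 0}. (a \<oplus>\<^bsub>group_ring G\<^esub> b) g) =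
        (\<Sum>g\<in>?S. (a \<oplus>\<^bsub>group_ring G\<^esub> b) g)"
      using S by (intro sum_support_extend) (auto simp: group_ring_def)
    also have "\<dots> = (\<Sum>g\<in>?S. a g) + (\<Sum>g\<in>?S. b g)"
      by (simp add: group_ring_def sum.distrib)
    also have "(\<Sum>g\<in>?S. a g) = (\<Sum>g\<in>{g. a g \<noteq> 0}. a g)"
      using S by (intro sum_support_extend[symmetric]) auto
    also have "(\<Sum>g\<in>?S. b g) = (\<Sum>g\<in>{g. b g \<noteq> 0}. b g)"
      using S by (intro sum_support_extend[symmetric]) auto
    finally show "(a \<oplus>\<^bsub>group_ring G\<^esub> b) \<odot>\<^bsub>trivial_module\<^esub> x =
        a \<odot>\<^bsub>trivial_module\<^esub> x \<oplus>\<^bsub>trivial_module\<^esub> b \<odot>\<^bsub>trivial_module\<^esub> x"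
      by (simp add: trivial_module_def algebra_simps)
    show "(a \<otimes>\<^bsub>group_ring G\<^esub> b) \<odot>\<^bsub>trivial_module\<^esub> x =
        a \<odot>\<^bsub>trivial_module\<^esub> (b \<odot>\<^bsub>trivial_module\<^esub> x)"
      using augmentation_mult[OF ab] by (simp add: trivial_module_def mult.assoc)
  qed (auto simp: trivial_module_def group_ring_def algebra_simps)
qed

lemma free_module_is_left_module:
  fixes R :: "('a, 'r) ring_scheme" and I :: "'s set"
  assumes "ring R" shows "left_module R (free_module R I)"
proof -
  interpret R: ring R by fact
  have fin: "finite {s. f s \<noteq> \<zero>\<^bsub>R\<^esub>}"
    if "finite {s. c s \<noteq> \<zero>\<^bsub>R\<^esub>}" "finite {s. c' s \<noteq> \<zero>\<^bsub>R\<^esub>}"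
      "\<And>s. c s = \<zero>\<^bsub>R\<^esub> \<Longrightarrow> c' s = \<zero>\<^bsub>R\<^esub> \<Longrightarrow> f s = \<zero>\<^bsub>R\<^esub>" for f c c' :: "'s \<Rightarrow> 'a"
  proof (rule finite_subset)
    show "{s. f s \<noteq> \<zero>\<^bsub>R\<^esub>} \<subseteq> {s. c s \<noteq> \<zero>\<^bsub>R\<^esub>} \<union> {s. c' s \<noteq> \<zero>\<^bsub>R\<^esub>}"
      using that(3) by blast
    show "finite ({s. c s \<noteq> \<zero>\<^bsub>R\<^esub>} \<union> {s. c' s \<noteq> \<zero>\<^bsub>R\<^esub>})"
      using that(1,2) by simp
  qed
  have cl: "c s \<in> carrier R" if "c \<in> carrier (free_module R I)" for c s
    using that by (cases "s \<in> I") (auto simp: free_module_def)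
  show ?thesis
  proof (intro left_module.intro left_module_axioms.intro)
    show "abelian_group (free_module R I)"
    proof (rule abelian_groupI)
      fix c c' assume c: "c \<in> carrier (free_module R I)" "c' \<in> carrier (free_module R I)"
      then show "c \<oplus>\<^bsub>free_module R I\<^esub> c' \<in> carrier (free_module R I)"
        by (auto simp: free_module_def intro!: fin[of c c'])
      show "c \<oplus>\<^bsub>free_module R I\<^esub> c' = c' \<oplus>\<^bsub>free_module R I\<^esub> c"
        using c[THEN cl] by (auto simp: free_module_def R.a_comm)
    next
      fix c assume c: "c \<in> carrier (free_module R I)"
      show "\<zero>\<^bsub>free_module R I\<^esub> \<oplus>\<^bsub>free_module R I\<^esub> c = c"
        using c[THEN cl] by (auto simp: free_module_def)
      show "\<exists>y\<in>carrier (free_module R I). y \<oplus>\<^bsub>free_module R I\<^esub> c = \<zero>\<^bsub>free_module R I\<^esub>"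
        using c c[THEN cl]
        by (intro bexI[of _ "\<lambda>s. \<ominus>\<^bsub>R\<^esub> c s"])
           (auto simp: free_module_def R.l_neg intro!: fin[of c c])
    next
      fix c c' c''
      assume c: "c \<in> carrier (free_module R I)" "c' \<in> carrier (free_module R I)"
        "c'' \<in> carrier (free_module R I)"
      then show "c \<oplus>\<^bsub>free_module R I\<^esub> c' \<oplus>\<^bsub>free_module R I\<^esub> c'' =
          c \<oplus>\<^bsub>free_module R I\<^esub> (c' \<oplus>\<^bsub>free_module R I\<^esub> c'')"
        using c[THEN cl] by (auto simp: free_module_def R.a_assoc)
    qed (auto simp: free_module_def)
  next
    fix a c assume ac: "a \<in> carrier R" "c \<in> carrier (free_module R I)"
    then show "a \<odot>\<^bsub>free_module R I\<^esub> c \<in> carrier (free_module R I)"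
      by (auto simp: free_module_def intro!: fin[of c c])
  next
    fix c assume c: "c \<in> carrier (free_module R I)"
    show "\<one>\<^bsub>R\<^esub> \<odot>\<^bsub>free_module R I\<^esub> c = c"
      using c[THEN cl] by (auto simp: free_module_def)
  next
    fix a b c assume abc: "a \<in> carrier R" "b \<in> carrier R" "c \<in> carrier (free_module R I)"
    show "(a \<oplus>\<^bsub>R\<^esub> b) \<odot>\<^bsub>free_module R I\<^esub> c =
        a \<odot>\<^bsub>free_module R I\<^esub> c \<oplus>\<^bsub>free_module R I\<^esub> b \<odot>\<^bsub>free_module R I\<^esub> c"
      using abc(1,2) abc(3)[THEN cl] by (auto simp: free_module_def R.l_distr)
    show "(a \<otimes>\<^bsub>R\<^esub> b) \<odot>\<^bsub>free_module R I\<^esub> c =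
        a \<odot>\<^bsub>free_module R I\<^esub> (b \<odot>\<^bsub>free_module R I\<^esub> c)"
      using abc(1,2) abc(3)[THEN cl] by (auto simp: free_module_def R.m_assoc)
  next
    fix a c c' assume acc: "a \<in> carrier R" "c \<in> carrier (free_module R I)" "c' \<in> carrier (free_module R I)"
    show "a \<odot>\<^bsub>free_module R I\<^esub> (c \<oplus>\<^bsub>free_module R I\<^esub> c') =
        a \<odot>\<^bsub>free_module R I\<^esub> c \<oplus>\<^bsub>free_module R I\<^esub> a \<odot>\<^bsub>free_module R I\<^esub> c'"
      using acc(1) acc(2,3)[THEN cl] by (auto simp: free_module_def R.r_distr)
  qed fact
qed

context chilbert_space
begin

lemma cinner_smult_right:
  assumes "x \<in> carrier V" "y \<in> carrier V"
  shows "cinner V x (a \<odot>\<^bsub>V\<^esub> y) = cnj a * cinner V x y"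
proof -
  have "a \<odot>\<^bsub>V\<^esub> y \<in> carrier V"
    using assms by (intro smult_closed) (auto simp: ring_of_type_algebra_def)
  then show ?thesis
    using assms by (simp add: cinner_commute[of x] cinner_smult_left)
qed

lemma cinner_add_right:
  assumes "x \<in> carrier V" "y \<in> carrier V" "z \<in> carrier V"
  shows "cinner V x (y \<oplus>\<^bsub>V\<^esub> z) = cinner V x y + cinner V x z"
  using assms by (simp add: cinner_commute[of x] cinner_add_left)

lemma cinner_zero: "x \<in> carrier V \<Longrightarrow> cinner V \<zero>\<^bsub>V\<^esub> x = 0"
  using cinner_add_left[of "\<zero>\<^bsub>V\<^esub>" "\<zero>\<^bsub>V\<^esub>" x] by simp

lemma cinner_nonneg: "x \<in> carrier V \<Longrightarrow> 0 \<le> Re (cinner V x x)"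
  using cinner_pos[of x] cinner_zero[of x] by (cases "x = \<zero>\<^bsub>V\<^esub>") auto

lemma cinner_self_real: "x \<in> carrier V \<Longrightarrow> cinner V x x = of_real (Re (cinner V x x))"
  using cinner_commute[of x x] by (metis Reals_cnj_iff of_real_Re)

lemma Cauchy_Schwarz_Re:
  assumes x: "x \<in> carrier V" and y: "y \<in> carrier V"
  shows "Re (cinner V x y) \<le> sqrt (Re (cinner V x x)) * sqrt (Re (cinner V y y))"
proof (cases "y = \<zero>\<^bsub>V\<^esub>")
  case True
  then show ?thesis using x y cinner_zero[of x] cinner_zero[of y] cinner_commute[of x y] by simp
next
  case False
  define p q r where "p = Re (cinner V x x)" and "q = Re (cinner V y y)" and "r = Re (cinner V x y)"
  have q: "q > 0" using cinner_pos[OF y False] by (simp add: q_def)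
  have r': "Re (cinner V y x) = r" using cinner_commute[OF y x] by (simp add: r_def)
  define a :: complex where "a = of_real (- r / q)"
  have a: "a \<odot>\<^bsub>V\<^esub> y \<in> carrier V"
    using y by (intro smult_closed) (auto simp: ring_of_type_algebra_def)
  have "cinner V (x \<oplus>\<^bsub>V\<^esub> a \<odot>\<^bsub>V\<^esub> y) (x \<oplus>\<^bsub>V\<^esub> a \<odot>\<^bsub>V\<^esub> y) =
      cinner V x x + a * cinner V x y + (a * cinner V y x + a * (a * cinner V y y))"
    using x y a
    by (simp add: cinner_add_left cinner_add_right cinner_smult_left cinner_smult_right a_def algebra_simps)
  also have "Re \<dots> = p + (- r / q) * r + ((- r / q) * r + (- r / q) * ((- r / q) * q))"
    unfolding a_def using r' by (simp add: p_def q_def r_def)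
  also have "\<dots> = p - r\<^sup>2 / q" using q by (simp add: field_simps power2_eq_square)
  finally have "0 \<le> p - r\<^sup>2 / q" using cinner_nonneg[of "x \<oplus>\<^bsub>V\<^esub> a \<odot>\<^bsub>V\<^esub> y"] x a by simp
  then have "r\<^sup>2 \<le> p * q" using q by (simp add: field_simps)
  then have "r \<le> sqrt (p * q)" by (simp add: real_le_rsqrt)
  then show ?thesis by (simp add: real_sqrt_mult p_def q_def r_def)
qed

lemma cinner_dist_Metric_space: "Metric_space (carrier V) (cinner_dist V)"
proof
  fix x y z
  show "0 \<le> cinner_dist V x y"
    by (auto simp: cinner_dist_def intro!: cinner_nonneg)
  show "cinner_dist V x y = cinner_dist V y x"
  proof (cases "x \<in> carrier V \<and> y \<in> carrier V")
    case True
    define u where "u = x \<ominus>\<^bsub>V\<^esub> y"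
    have u: "u \<in> carrier V" using True by (simp add: u_def)
    have c: "\<ominus>\<^bsub>V\<^esub> u \<in> carrier V" using u by simp
    have 0: "cinner V (\<ominus>\<^bsub>V\<^esub> u) v = - cinner V u v" if "v \<in> carrier V" for v
      using cinner_add_left[OF c u that] cinner_zero[OF that] u
      by (simp add: M.l_neg eq_neg_iff_add_eq_0)
    have "cinner V (\<ominus>\<^bsub>V\<^esub> u) (\<ominus>\<^bsub>V\<^esub> u) = cinner V u u"
      using 0[OF c] 0[OF u] cinner_commute[OF u c] cinner_commute[OF u u] by simp
    moreover have "y \<ominus>\<^bsub>V\<^esub> x = \<ominus>\<^bsub>V\<^esub> u"
      using True by (simp add: u_def a_minus_def M.minus_add M.a_comm)
    ultimately show ?thesis using True by (simp add: cinner_dist_def u_def)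
  qed (auto simp: cinner_dist_def)
  show "(cinner_dist V x y = 0) = (x = y)" if "x \<in> carrier V" "y \<in> carrier V"
  proof
    assume "x = y"
    then show "cinner_dist V x y = 0"
      using that by (simp add: cinner_dist_def a_minus_def M.r_neg cinner_zero)
  next
    assume "cinner_dist V x y = 0"
    then have "x \<ominus>\<^bsub>V\<^esub> y = \<zero>\<^bsub>V\<^esub>"
      using that cinner_pos[of "x \<ominus>\<^bsub>V\<^esub> y"] by (force simp: cinner_dist_def)
    then show "x = y"
      using that M.minus_equality[of x "\<ominus>\<^bsub>V\<^esub> y"] by (simp add: a_minus_def)
  qed
  show "cinner_dist V x z \<le> cinner_dist V x y + cinner_dist V y z"
    if xyz: "x \<in> carrier V" "y \<in> carrier V" "z \<in> carrier V"
  proof -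
    define u v where "u = x \<ominus>\<^bsub>V\<^esub> y" and "v = y \<ominus>\<^bsub>V\<^esub> z"
    have uv: "u \<in> carrier V" "v \<in> carrier V" using xyz by (simp_all add: u_def v_def)
    define p q where "p = Re (cinner V u u)" and "q = Re (cinner V v v)"
    have pq: "0 \<le> p" "0 \<le> q" using uv by (simp_all add: p_def q_def cinner_nonneg)
    have "u \<oplus>\<^bsub>V\<^esub> v = x \<oplus>\<^bsub>V\<^esub> (\<ominus>\<^bsub>V\<^esub> y \<oplus>\<^bsub>V\<^esub> y) \<oplus>\<^bsub>V\<^esub> \<ominus>\<^bsub>V\<^esub> z"
      using xyz by (simp only: u_def v_def a_minus_def M.a_assoc M.a_closed M.a_inv_closed)
    then have sum: "x \<ominus>\<^bsub>V\<^esub> z = u \<oplus>\<^bsub>V\<^esub> v"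
      using xyz by (simp add: M.l_neg a_minus_def)
    have "Re (cinner V (u \<oplus>\<^bsub>V\<^esub> v) (u \<oplus>\<^bsub>V\<^esub> v)) = p + 2 * Re (cinner V u v) + q"
      using uv cinner_commute[OF uv(2,1)]
      by (simp add: cinner_add_left cinner_add_right p_def q_def)
    also have "\<dots> \<le> p + 2 * (sqrt p * sqrt q) + q"
      using Cauchy_Schwarz_Re[OF uv] by (simp add: p_def q_def)
    also have "\<dots> = (sqrt p + sqrt q)\<^sup>2" using pq by (simp add: power2_sum)
    finally have "sqrt (Re (cinner V (u \<oplus>\<^bsub>V\<^esub> v) (u \<oplus>\<^bsub>V\<^esub> v))) \<le> sqrt p + sqrt q"
      using pq by (intro real_le_lsqrt) auto
    then show ?thesis using xyz by (simp add: cinner_dist_def sum p_def q_def u_def v_def)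
  qed
qed

end

lemma (in Group.group) l1_norm_transversal:
  assumes H: "subgroup H G" and M: "left_module (group_ring G) M" and B: "B \<subseteq> carrier M"
    and \<phi>: "\<phi> \<in> cochains G H M"
    and t: "\<And>K. K \<in> rcosets H \<Longrightarrow> t K \<in> K"
  shows "l1_norm G H M B \<phi> =
    (\<Sum>K\<in>rcosets H. \<Sum>b\<in>B. real_of_int \<bar>\<phi> (group_ring_of (t K) \<odot>\<^bsub>M\<^esub> b)\<bar>)"
proof -
  interpret M: left_module "group_ring G" M by fact
  have "\<phi> (group_ring_of x \<odot>\<^bsub>M\<^esub> b) = \<phi> (group_ring_of y \<odot>\<^bsub>M\<^esub> b)"
    if K: "K \<in> rcosets H" and x: "x \<in> K" and y: "y \<in> K" and b: "b \<in> B" for K x y b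
  proof -
    obtain g where g: "g \<in> carrier G" "K = H #> g" using K by (auto simp: RCOSETS_def)
    have yG: "y \<in> carrier G" using y g H subgroup.subset[OF H] by (auto simp: r_coset_def)
    have "K = H #> y" using repr_independence[OF _ g(1) H] y g by simp
    then obtain h where h: "h \<in> H" "x = h \<otimes> y" using x by (auto simp: r_coset_def)
    have hG: "h \<in> carrier G" using h subgroup.subset[OF H] by auto
    have hR: "group_ring_of h \<in> carrier (group_ring (G\<lparr>carrier := H\<rparr>))"
      using h by (auto simp: group_ring_of_def group_ring_def)
    have yb: "group_ring_of y \<odot>\<^bsub>M\<^esub> b \<in> carrier M"
      using b B yG by (auto intro!: M.smult_closed group_ring_of_closed)
    have "group_ring_of x \<odot>\<^bsub>M\<^esub> b = group_ring_of h \<odot>\<^bsub>M\<^esub> (group_ring_of y \<odot>\<^bsub>M\<^esub> b)"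
      using h(2) hG yG b B by (auto simp: group_ring_of_mult M.smult_assoc group_ring_of_closed)
    also have "\<phi> \<dots> = group_ring_of h \<odot>\<^bsub>trivial_module\<^esub> \<phi> (group_ring_of y \<odot>\<^bsub>M\<^esub> b)"
      using \<phi> hR yb by (auto simp: cochains_def left_module_hom_def)
    also have "\<dots> = \<phi> (group_ring_of y \<odot>\<^bsub>M\<^esub> b)"
      by (simp add: trivial_module_def group_ring_of_def)
    finally show ?thesis .
  qed
  moreover have "(SOME x. x \<in> K) \<in> K" if "K \<in> rcosets H" for K
    using t[OF that] by (rule someI)
  ultimately show ?thesis
    unfolding l1_norm_def using t by (intro sum.cong refl) metis
qed

end

theory Submission
  imports Defs "HOL-Complex_Analysis.Great_Picard"
begin

text \<open>A cochain in \<open>hom\<^sub>H(F\<^sub>i, \<int>)\<close> is the same thing as a \<open>G\<close>-equivariant homomorphism from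
\<open>F\<^sub>i\<close> to the integer-valued functions on the finite set \<open>H\G\<close>, so the theorem is an isoperimetric
inequality for these permutation modules with a constant that must not depend on \<open>H\<close>. Suppose that
there is no such constant. Then for every \<open>n\<close> there are a subgroup \<open>H\<^sub>n\<close> and a cochain \<open>\<omega>\<^sub>n\<close> with
\<open>\<parallel>\<omega>\<^sub>n\<parallel> > (n + 1) \<parallel>d\<omega>\<^sub>n\<parallel>\<close>. Norms are integers, so \<open>\<omega>\<^sub>n\<close> can be taken of least norm among the
cochains with the same coboundary. The contradiction is a cochain of smaller norm that differs from
\<open>\<omega>\<^sub>n\<close> by the coboundary of a cochain on \<open>F\<^sub>0\<close>.

Fix \<open>x\<^sub>0\<close> in \<open>F\<^sub>0\<close> with augmentation 1 and, for each \<open>g\<close>, an element \<open>y\<^sub>g\<close> of \<open>F\<^sub>1\<close> with boundary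
\<open>g x\<^sub>0 - x\<^sub>0\<close>. Evaluating \<open>\<omega>\<^sub>n\<close> at the translates of \<open>y\<^sub>g\<close> gives a function \<open>c\<^sub>n(g)\<close> on \<open>H\<^sub>n\G\<close>. By exactness
\<open>y\<^sub>g\<^sub>h - y\<^sub>g - g y\<^sub>h\<close> is the image of an element of \<open>F\<^sub>2\<close>; hence \<open>c\<^sub>n\<close> satisfies the cocycle identity
up to an error of size \<open>O(\<parallel>d\<omega>\<^sub>n\<parallel>)\<close>, which is \<open>o(\<parallel>\<omega>\<^sub>n\<parallel>)\<close>. If an integer-valued \<open>f\<close> on \<open>H\<^sub>n\G\<close> has
\<open>g f - f\<close> close to \<open>c\<^sub>n(g)\<close> for the finitely many \<open>g\<close> that occur in the matrix of \<open>F\<^sub>1 \<rightarrow> F\<^sub>0\<close>, then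
\<open>f\<close> extends to a cochain on \<open>F\<^sub>0\<close> whose coboundary is close to \<open>\<omega>\<^sub>n\<close> (lemma \<open>primitive_correction\<close>).

Property (T) produces \<open>f\<close> (lemma \<open>property_T_almost_cocycle\<close>). For integers, \<open>\<bar>a - b\<bar>\<close> is the
squared \<open>L\<^sup>2\<close> distance of the indicator functions of the half-lines \<open>[a, \<infinity>)\<close> and \<open>[b, \<infinity>)\<close>. So
\<open>\<psi>\<^sub>n(g, h) = \<parallel>c\<^sub>n(g) - c\<^sub>n(h)\<parallel>\<^sub>1 / \<parallel>\<omega>\<^sub>n\<parallel>\<close> is a kernel of conditionally negative type on \<open>G\<close>, and the
pointwise limit \<open>\<psi>\<close> of a subsequence is in addition left invariant. Such a kernel is the squared
distance along an orbit of an affine isometric action on a Hilbert space, and by property (T) this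
action has a fixed point (lemma \<open>property_T_approximate_fixed_point\<close>). The fixed point is approximated
by an affine combination of finitely many orbit points. For large \<open>n\<close>, the same combination of the
half-line functions for \<open>c\<^sub>n\<close> is a function \<open>\<xi>\<close> on \<open>H\<^sub>n\G \<times> \<int>\<close> which \<open>G\<close> moves little in \<open>L\<^sup>2\<close>.

Cutting \<open>\<xi>\<close> at a level between \<open>1/3\<close> and \<open>2/3\<close> turns it into a subset of \<open>H\<^sub>n\G \<times> \<int>\<close> each of whose
fibres differs from a half-line in finitely many points, and counting points in the fibres gives \<open>f\<close>
(lemma \<open>integral_rounding\<close>). An average over the levels bounds the \<open>L\<^sup>1\<close> error of \<open>f\<close> by the \<open>L\<^sup>2\<close>
displacement of \<open>\<xi>\<close> and the number of points at which \<open>\<xi>\<close> is far from 0 and 1. That number is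
controlled by the distance between the fixed point and the base point of the orbit, which is a
constant of the limit action.\<close>

section \<open>Positive semidefinite kernels and their Cholesky decomposition\<close>

definition positive_semidefinite :: "(nat \<Rightarrow> nat \<Rightarrow> real) \<Rightarrow> bool"
  where "positive_semidefinite K \<longleftrightarrow> (\<forall>i j. K i j = K j i) \<and>
    (\<forall>n a. 0 \<le> (\<Sum>i<n. \<Sum>j<n. a i * a j * K i j))"

text \<open>The quadratic form of \<open>K\<close> at \<open>a + s e\<^sub>m\<close>. Minimizing over \<open>s\<close> yields all consequences of
semidefiniteness that are needed below.\<close>

lemma positive_semidefinite_shift:
  assumes K: "positive_semidefinite K"
  shows "0 \<le> (\<Sum>i<n. \<Sum>j<n. a i * a j * K i j) + 2 * s * (\<Sum>i<n. a i * K i m) + s\<^sup>2 * K m m"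
proof -
  define p where "p = max n (Suc m)"
  define c where "c i = (if i < n then a i else 0)" for i
  define \<delta> where "\<delta> i = (if i = m then s else 0)" for i
  have np: "{..<n} \<subseteq> {..<p}" and mp: "m \<in> {..<p}" by (auto simp: p_def)
  have sym: "K i j = K j i" for i j using K by (simp add: positive_semidefinite_def)
  have ext: "(\<Sum>i<p. c i * f i) = (\<Sum>i<n. a i * f i)" for f
    by (rule sum.mono_neutral_cong_right) (use np in \<open>auto simp: c_def\<close>)
  have pt: "(\<Sum>i<p. \<delta> i * f i) = s * f m" for f
    using mp by (simp add: \<delta>_def if_distrib [of "\<lambda>x. x * _"] cong: if_cong)
  have "0 \<le> (\<Sum>i<p. \<Sum>j<p. (c i + \<delta> i) * (c j + \<delta> j) * K i j)"
    using K by (auto simp: positive_semidefinite_def)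
  also have "\<dots> = (\<Sum>i<p. c i * (\<Sum>j<p. c j * K i j)) + (\<Sum>i<p. c i * (\<Sum>j<p. \<delta> j * K i j))
      + (\<Sum>i<p. \<delta> i * (\<Sum>j<p. c j * K i j)) + (\<Sum>i<p. \<delta> i * (\<Sum>j<p. \<delta> j * K i j))"
    unfolding sum_distrib_left sum.distrib[symmetric]
    by (intro sum.cong refl) (simp add: algebra_simps)
  also have "\<dots> = (\<Sum>i<n. a i * (\<Sum>j<n. a j * K i j)) + (\<Sum>i<n. a i * (s * K i m))
      + s * (\<Sum>j<n. a j * K m j) + s * (s * K m m)"
    by (simp only: ext pt)
  also have "\<dots> = (\<Sum>i<n. \<Sum>j<n. a i * a j * K i j) + 2 * s * (\<Sum>i<n. a i * K i m) + s\<^sup>2 * K m m"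
  proof -
    have "(\<Sum>j<n. a j * K m j) = (\<Sum>i<n. a i * K i m)"
      by (intro sum.cong refl) (simp only: sym[of m])
    moreover have "(\<Sum>i<n. a i * (\<Sum>j<n. a j * K i j)) = (\<Sum>i<n. \<Sum>j<n. a i * a j * K i j)"
      by (simp only: sum_distrib_left mult.assoc)
    moreover have "(\<Sum>i<n. a i * (s * K i m)) = s * (\<Sum>i<n. a i * K i m)"
      by (simp only: sum_distrib_left mult.left_commute)
    ultimately show ?thesis by (simp add: power2_eq_square)
  qed
  finally show ?thesis .
qed

lemma positive_semidefinite_diag:
  assumes "positive_semidefinite K" shows "0 \<le> K m m"
  using positive_semidefinite_shift[OF assms, where n = 0 and s = 1 and m = m] by simp

lemma positive_semidefinite_diag_zero:
  assumes K: "positive_semidefinite K" and m: "K m m = 0" shows "K i m = 0"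
proof (rule ccontr)
  assume nz: "K i m \<noteq> 0"
  define a where "a j = (if j = i then 1 else 0 :: real)" for j
  have "(\<Sum>j<Suc i. a j * f j) = f i" for f by (simp add: a_def if_distrib [of "\<lambda>x. x * _"] cong: if_cong)
  then have lin: "(\<Sum>j<Suc i. a j * K j m) = K i m"
    and quad: "(\<Sum>j<Suc i. \<Sum>k<Suc i. a j * a k * K j k) = K i i"
    by (simp_all add: mult.assoc flip: sum_distrib_left)
  have "0 \<le> K i i + 2 * s * K i m" for s
    using positive_semidefinite_shift[OF K, where n = "Suc i" and a = a and s = s and m = m] m unfolding lin quad by simp
  \<comment> \<open>A nonconstant affine function of \<open>s\<close> is somewhere negative; this \<open>s\<close> gives the value -1.\<close>
  from this[of "- (K i i + 1) / (2 * K i m)"] show False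
    using nz by (simp del: minus_add_distrib)
qed

text \<open>If \<open>K m m = 0\<close>, the quotient is 0 by convention and \<open>K\<close> is left unchanged. This is the correct value,
because row \<open>m\<close> of a semidefinite kernel then vanishes.\<close>

definition schur_complement :: "nat \<Rightarrow> (nat \<Rightarrow> nat \<Rightarrow> real) \<Rightarrow> nat \<Rightarrow> nat \<Rightarrow> real"
  where "schur_complement m K i j = K i j - K i m * K j m / K m m"

lemma positive_semidefinite_schur_complement:
  assumes K: "positive_semidefinite K"
  shows "positive_semidefinite (schur_complement m K)"
  unfolding positive_semidefinite_def
proof (intro conjI allI)
  show "schur_complement m K i j = schur_complement m K j i" for i j
    using K by (simp add: schur_complement_def positive_semidefinite_def mult.commute)
  fix n and a :: "nat \<Rightarrow> real"
  define Q where "Q = (\<Sum>i<n. \<Sum>j<n. a i * a j * K i j)"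
  define S where "S = (\<Sum>i<n. a i * K i m)"
  have "(\<Sum>i<n. \<Sum>j<n. a i * a j * schur_complement m K i j) = Q - S * S / K m m"
    by (simp add: schur_complement_def Q_def S_def sum_product sum_divide_distrib
        sum_subtractf algebra_simps)
  also have "\<dots> \<ge> 0"
  proof (cases "K m m = 0")
    case True
    then show ?thesis using K by (simp add: Q_def positive_semidefinite_def)
  next
    case False
    then have "0 < K m m" using positive_semidefinite_diag[OF K, of m] by simp
    then show ?thesis
      \<comment> \<open>The minimum of the quadratic polynomial in \<open>s\<close>.\<close>
      using positive_semidefinite_shift[OF K, where n = n and a = a and s = "- S / K m m" and m = m]
      unfolding Q_def[symmetric] S_def[symmetric] by (simp add: power2_eq_square)
  qed
  finally show "0 \<le> (\<Sum>i<n. \<Sum>j<n. a i * a j * schur_complement m K i j)" .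
qed

text \<open>Eliminate the indices \<open>0, 1, 2, \<dots>\<close> one after the other by Schur complements; the normalized columns
split off in this way are the coordinates of vectors \<open>\<beta> i\<close> with Gram matrix \<open>K\<close>. The echelon form
with set of pivots \<open>I\<close> makes the closed span of these vectors all of \<open>\<ell>\<^sup>2(I)\<close>, so that the Hilbert
space of \<open>K\<close> needs no abstract completion.\<close>

lemma Cholesky_decomposition:
  assumes K: "positive_semidefinite K"
  obtains \<beta> :: "nat \<Rightarrow> nat \<Rightarrow> real" and I :: "nat set"
  where "\<And>i m. i < m \<Longrightarrow> \<beta> i m = 0"
    and "\<And>i m. m \<notin> I \<Longrightarrow> \<beta> i m = 0"
    and "\<And>i. i \<in> I \<Longrightarrow> \<beta> i i \<noteq> 0"
    and "\<And>i j. K i j = (\<Sum>m\<le>i. \<beta> i m * \<beta> j m)"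
proof -
  define L where "L = rec_nat K schur_complement"
  have L: "L 0 = K" "L (Suc m) = schur_complement m (L m)" for m by (simp_all add: L_def)
  have psd: "positive_semidefinite (L m)" for m
    by (induction m) (simp_all add: L K positive_semidefinite_schur_complement)
  have sym: "L m i j = L m j i" for m i j
    using psd[of m] by (simp add: positive_semidefinite_def)
  have vanish: "i < m \<Longrightarrow> L m i j = 0" for i j m
  proof (induction m arbitrary: j)
    case (Suc m)
    show ?case
    proof (cases "i = m")
      case True
      show ?thesis
      proof (cases "L m m m = 0")
        case True
        then show ?thesis
          using positive_semidefinite_diag_zero[OF psd True, of j] \<open>i = m\<close>
          by (simp add: L schur_complement_def sym[of m m j])
      next
        case False
        then show ?thesis using \<open>i = m\<close> by (simp add: L schur_complement_def sym[of m m j])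
      qed
    next
      case False
      then show ?thesis using Suc by (simp add: L schur_complement_def)
    qed
  qed simp
  define \<beta> where "\<beta> i m = L m i m / sqrt (L m m m)" for i m
  have prod: "\<beta> i m * \<beta> j m = L m i m * L m j m / L m m m" for i j m
    using positive_semidefinite_diag[OF psd, of m m] by (simp add: \<beta>_def)
  have partial: "L p i j = K i j - (\<Sum>m<p. \<beta> i m * \<beta> j m)" for p i j
    by (induction p) (simp_all add: L schur_complement_def prod)
  show ?thesis
  proof
    show "i < m \<Longrightarrow> \<beta> i m = 0" for i m by (simp add: \<beta>_def vanish)
    show "m \<notin> {m. L m m m \<noteq> 0} \<Longrightarrow> \<beta> i m = 0" for i m by (simp add: \<beta>_def)
    show "i \<in> {m. L m m m \<noteq> 0} \<Longrightarrow> \<beta> i i \<noteq> 0" for i by (simp add: \<beta>_def)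
    show "K i j = (\<Sum>m\<le>i. \<beta> i m * \<beta> j m)" for i j
      using partial[of "Suc i" i j] vanish[of i "Suc i" j] by (simp add: lessThan_Suc_atMost)
  qed
qed

text \<open>Rows of the inverse of the triangular matrix, by forward substitution: they express the standard basis
vectors \<open>e\<^sub>i\<close> with \<open>i \<in> I\<close> by the vectors \<open>\<beta> m\<close> with \<open>m \<le> i\<close>.\<close>

lemma triangular_inverse_row:
  fixes \<beta> :: "nat \<Rightarrow> nat \<Rightarrow> real"
  assumes lower: "\<And>i m. i < m \<Longrightarrow> \<beta> i m = 0"
    and I: "\<And>i m. m \<notin> I \<Longrightarrow> \<beta> i m = 0" and diag: "\<And>i. i \<in> I \<Longrightarrow> \<beta> i i \<noteq> 0"
  shows "i \<in> I \<Longrightarrow> \<exists>t. (\<forall>m>i. t m = 0) \<and> (\<forall>j. (\<Sum>m\<le>i. t m * \<beta> m j) = of_bool (j = i))"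
proof (induction i rule: less_induct)
  case (less i)
  have "\<exists>t. \<forall>l<i. l \<in> I \<longrightarrow> (\<forall>m>l. t l m = 0) \<and> (\<forall>j. (\<Sum>m\<le>l. t l m * \<beta> m j) = of_bool (j = l))"
    using less.IH by metis
  then obtain t where t0: "\<And>l m. l < i \<Longrightarrow> l \<in> I \<Longrightarrow> l < m \<Longrightarrow> t l m = 0"
    and t: "\<And>l j. l < i \<Longrightarrow> l \<in> I \<Longrightarrow> (\<Sum>m\<le>l. t l m * \<beta> m j) = of_bool (j = l)" by blast
  define s where "s m = (if m \<le> i then (of_bool (m = i) - (\<Sum>l<i. \<beta> i l * t l m)) / \<beta> i i else 0)" for m
  have "(\<Sum>m\<le>i. s m * \<beta> m j) = of_bool (j = i)" for j
  proof -
    have row: "\<beta> i l * (\<Sum>m\<le>i. t l m * \<beta> m j) = \<beta> i l * of_bool (j = l)" if "l < i" for l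
    proof (cases "l \<in> I")
      case True
      have "(\<Sum>m\<le>i. t l m * \<beta> m j) = (\<Sum>m\<le>l. t l m * \<beta> m j)"
        using that t0[OF that True] by (intro sum.mono_neutral_right) auto
      then show ?thesis using t[OF that True] by simp
    qed (simp add: I)
    have "(\<Sum>m\<le>i. s m * \<beta> m j) =
        (\<Sum>m\<le>i. of_bool (m = i) * \<beta> m j - (\<Sum>l<i. \<beta> i l * (t l m * \<beta> m j))) / \<beta> i i"
      unfolding sum_divide_distrib
      by (intro sum.cong refl) (simp add: s_def left_diff_distrib sum_distrib_right mult.assoc)
    also have "\<dots> = (\<beta> i j - (\<Sum>l<i. \<Sum>m\<le>i. \<beta> i l * (t l m * \<beta> m j))) / \<beta> i i"
      unfolding sum_subtractf
      by (subst sum.swap) (simp add: of_bool_def if_distrib[of "\<lambda>x. x * _"] cong: if_cong)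
    also have "(\<Sum>l<i. \<Sum>m\<le>i. \<beta> i l * (t l m * \<beta> m j)) = (\<Sum>l<i. \<beta> i l * of_bool (j = l))"
      unfolding sum_distrib_left[symmetric] by (intro sum.cong refl row) simp
    also have "\<dots> = (if j < i then \<beta> i j else 0)"
      by (simp add: of_bool_def if_distrib[of "(*) _"] cong: if_cong)
    also have "(\<beta> i j - \<dots>) / \<beta> i i = of_bool (j = i)"
      using lower[of i j] diag[OF less.prems] by auto
    finally show ?thesis .
  qed
  then show ?case by (intro exI[of _ s]) (auto simp: s_def)
qed

section \<open>Integer distances, half-lines and rounding\<close>

definition half_line :: "int \<Rightarrow> int \<Rightarrow> real"
  where "half_line z k = of_bool (z \<le> k)"

text \<open>The two functions differ exactly at the integers between \<open>a\<close> and \<open>b\<close>. A finite window \<open>{-M..<M}\<close> replaces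
the set of all integers throughout, so that every sum is finite.\<close>

lemma sum_half_line_diff_sq:
  assumes "\<bar>a\<bar> \<le> M" "\<bar>b\<bar> \<le> M"
  shows "(\<Sum>k\<in>{-M..<M}. (half_line a k - half_line b k)\<^sup>2) = real_of_int \<bar>a - b\<bar>"
proof -
  have "(\<Sum>k\<in>{-M..<M}. (half_line a k - half_line b k)\<^sup>2) =
      (\<Sum>k\<in>{-M..<M}. of_bool (k \<in> {min a b..<max a b}))"
    by (intro sum.cong refl) (auto simp: half_line_def)
  also have "\<dots> = (\<Sum>k\<in>{min a b..<max a b}. 1)"
    by (rule sum.mono_neutral_cong_right) (use assms in auto)
  also have "\<dots> = real_of_int \<bar>a - b\<bar>" by simp
  finally show ?thesis .
qed

text \<open>Polarization expresses inner products of differences by squared distances, which are absolute values here.\<close>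

lemma sum_half_line_diff_prod:
  assumes "\<bar>a\<bar> \<le> M" "\<bar>b\<bar> \<le> M" "\<bar>c\<bar> \<le> M" "\<bar>d\<bar> \<le> M"
  shows "(\<Sum>k\<in>{-M..<M}. (half_line a k - half_line b k) * (half_line c k - half_line d k)) =
    (\<bar>a - d\<bar> + \<bar>b - c\<bar> - \<bar>a - c\<bar> - \<bar>b - d\<bar>) / 2"
proof -
  have eq: "(p - q) * (r - s) = ((p - s)\<^sup>2 + (q - r)\<^sup>2 - (p - r)\<^sup>2 - (q - s)\<^sup>2) / 2" for p q r s :: real
    by (simp add: power2_eq_square algebra_simps)
  have "(\<Sum>k\<in>{-M..<M}. (half_line a k - half_line b k) * (half_line c k - half_line d k)) =
    (\<Sum>k\<in>{-M..<M}. ((half_line a k - half_line d k)\<^sup>2 + (half_line b k - half_line c k)\<^sup>2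
      - (half_line a k - half_line c k)\<^sup>2 - (half_line b k - half_line d k)\<^sup>2)) / 2"
    unfolding sum_divide_distrib by (intro sum.cong refl eq)
  also have "\<dots> = (\<bar>a - d\<bar> + \<bar>b - c\<bar> - \<bar>a - c\<bar> - \<bar>b - d\<bar>) / 2"
    using assms by (simp add: sum.distrib sum_subtractf sum_half_line_diff_sq)
  finally show ?thesis by simp
qed

lemma sum_half_line_combination_sq:
  fixes w :: "nat \<Rightarrow> real" and a b :: "nat \<Rightarrow> int"
  assumes "\<And>i. i < n \<Longrightarrow> \<bar>a i\<bar> \<le> M" "\<And>i. i < n \<Longrightarrow> \<bar>b i\<bar> \<le> M"
  shows "(\<Sum>k\<in>{-M..<M}. (\<Sum>i<n. w i * (half_line (a i) k - half_line (b i) k))\<^sup>2) =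
    (\<Sum>i<n. \<Sum>j<n. w i * w j *
      ((\<bar>a i - b j\<bar> + \<bar>b i - a j\<bar> - \<bar>a i - a j\<bar> - \<bar>b i - b j\<bar>) / 2))"
proof -
  let ?u = "\<lambda>i k. half_line (a i) k - half_line (b i) k"
  have "(\<Sum>k\<in>{-M..<M}. (\<Sum>i<n. w i * ?u i k)\<^sup>2) =
      (\<Sum>k\<in>{-M..<M}. \<Sum>i<n. \<Sum>j<n. w i * w j * (?u i k * ?u j k))"
    by (simp add: power2_eq_square sum_product mult_ac)
  also have "\<dots> = (\<Sum>i<n. \<Sum>j<n. \<Sum>k\<in>{-M..<M}. w i * w j * (?u i k * ?u j k))"
    by (subst sum.swap, rule sum.cong[OF refl], rule sum.swap)
  also have "\<dots> = (\<Sum>i<n. \<Sum>j<n. w i * w j * (\<Sum>k\<in>{-M..<M}. ?u i k * ?u j k))"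
    by (simp add: sum_distrib_left)
  also have "\<dots> = (\<Sum>i<n. \<Sum>j<n. w i * w j *
      ((\<bar>a i - b j\<bar> + \<bar>b i - a j\<bar> - \<bar>a i - a j\<bar> - \<bar>b i - b j\<bar>) / 2))"
    using assms by (intro sum.cong refl) (simp add: sum_half_line_diff_prod)
  finally show ?thesis .
qed

text \<open>Levels outside \<open>[1/3, 2/3]\<close> are not used, so only the part of the graph between them counts.\<close>

definition middle :: "real \<Rightarrow> real"
  where "middle s = (if s < 1/3 then 1/3 else if 2/3 < s then 2/3 else s)"

text \<open>The passage from \<open>L\<^sup>2\<close> to \<open>L\<^sup>1\<close>. A change in the middle range either happens near a point where one
of the values is at distance at least \<open>1/3\<close> from its reference value 0 or 1, or it is itself a jump
of size at least \<open>1/3\<close>. In the first case \<open>2 \<bar>a - b\<bar> \<le> l + (a - b)\<^sup>2 / l\<close>, and the summand \<open>l\<close> is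
absorbed because one of the two deviations has square at least \<open>1/9\<close>; in the second case
\<open>(a - b)\<^sup>2 / (2 * l)\<close> suffices.\<close>

lemma middle_diff_le:
  assumes "p = 0 \<or> p = 1" "q = 0 \<or> q = 1" and l: "0 < l" "l \<le> 1/6"
  shows "\<bar>middle a - middle b\<bar> \<le> 9/2 * l * ((a - p)\<^sup>2 + (b - q)\<^sup>2) + (a - b)\<^sup>2 / (2 * l)"
proof (cases "\<bar>a - p\<bar> \<ge> 1/3 \<or> \<bar>b - q\<bar> \<ge> 1/3")
  case True
  have "(1/3)\<^sup>2 \<le> x\<^sup>2" if "\<bar>x\<bar> \<ge> 1/3" for x :: real
    using that power_mono[of "1/3" "\<bar>x\<bar>" 2] by simp
  from this[of "a - p"] this[of "b - q"] True
  have "1/9 \<le> (a - p)\<^sup>2 \<or> 1/9 \<le> (b - q)\<^sup>2" by (auto simp: power2_eq_square)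
  then have "1/9 \<le> (a - p)\<^sup>2 + (b - q)\<^sup>2"
    using zero_le_power2[of "a - p"] zero_le_power2[of "b - q"] by linarith
  then have 1: "l / 2 \<le> 9/2 * l * ((a - p)\<^sup>2 + (b - q)\<^sup>2)"
    using mult_left_mono[of "1/9" "(a - p)\<^sup>2 + (b - q)\<^sup>2" "9/2 * l"] l by simp
  have "0 \<le> (\<bar>a - b\<bar> - l)\<^sup>2 / (2 * l)" using l by simp
  also have "\<dots> = (a - b)\<^sup>2 / (2 * l) + l / 2 - \<bar>a - b\<bar>"
    using l by (simp add: power2_diff field_simps) (simp add: power2_eq_square)
  finally have 2: "\<bar>a - b\<bar> \<le> (a - b)\<^sup>2 / (2 * l) + l / 2" by simp
  have "\<bar>middle a - middle b\<bar> \<le> \<bar>a - b\<bar>" by (auto simp: middle_def)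
  then show ?thesis using 1 2 by linarith
next
  case False
  have nn: "0 \<le> 9/2 * l * ((a - p)\<^sup>2 + (b - q)\<^sup>2)" "0 \<le> (a - b)\<^sup>2 / (2 * l)" using l by simp_all
  show ?thesis
  proof (cases "p = q")
    case True
    then have "middle a = middle b" using False assms by (auto simp: middle_def abs_if split: if_splits)
    then show ?thesis using nn by simp
  next
    case False': False
    then have "1/3 \<le> \<bar>a - b\<bar>" using False assms by (auto simp: abs_if split: if_splits)
    then have "(1/3)\<^sup>2 \<le> (a - b)\<^sup>2" using power_mono[of "1/3" "\<bar>a - b\<bar>" 2] by simp
    then have "1/3 \<le> 3 * (a - b)\<^sup>2" by (simp add: power2_eq_square)
    also have "\<dots> \<le> (a - b)\<^sup>2 / (2 * l)"
    proof -
      have "3 * (2 * l) * (a - b)\<^sup>2 \<le> 1 * (a - b)\<^sup>2" using l by (intro mult_right_mono) auto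
      then show ?thesis using l by (simp add: field_simps)
    qed
    finally have "1/3 \<le> (a - b)\<^sup>2 / (2 * l)" .
    moreover have "\<bar>middle a - middle b\<bar> \<le> 1/3" by (auto simp: middle_def abs_if)
    ultimately show ?thesis using nn by linarith
  qed
qed

text \<open>The levels \<open>t\<close> that separate \<open>a\<close> from \<open>b\<close> form an interval, and \<open>\<bar>middle a - middle b\<bar>\<close> is its length
inside \<open>[1/3, 2/3]\<close>.\<close>

lemma integral_level_sets:
  "((\<lambda>t. of_bool ((t < a) \<noteq> (t < b))) has_integral \<bar>middle a - middle b\<bar>) {1/3..2/3::real}"
proof -
  have le: "middle (min a b) \<le> middle (max a b)" by (auto simp: middle_def)
  define J where "J = {middle (min a b)..<middle (max a b)}"
  have "((\<lambda>t. 1) has_integral (middle (max a b) - middle (min a b))) {middle (min a b)..middle (max a b)}"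
    using has_integral_const_real[of "1::real" "middle (min a b)" "middle (max a b)"] le by simp
  then have "((\<lambda>t. if t \<in> {middle (min a b)..middle (max a b)} then 1 else 0) has_integral
      (middle (max a b) - middle (min a b))) {1/3..2/3}"
    using has_integral_restrict_closed_subinterval[of "\<lambda>t. 1::real" _ "middle (min a b)" "middle (max a b)" "1/3" "2/3"]
    by (auto simp: middle_def split: if_splits)
  then have "((\<lambda>t. of_bool (t \<in> J)) has_integral (middle (max a b) - middle (min a b))) {1/3..2/3}"
    by (rule has_integral_spike_finite[of "{middle (max a b)}", rotated 2]) (auto simp: J_def)
  moreover have "middle (max a b) - middle (min a b) = \<bar>middle a - middle b\<bar>"
    by (auto simp: middle_def abs_if min_def max_def)
  ultimately have "((\<lambda>t. of_bool (t \<in> J)) has_integral \<bar>middle a - middle b\<bar>) {1/3..2/3}" by simp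
  then show ?thesis
    by (rule has_integral_spike_finite[of "{2/3}", rotated 2]) (auto simp: J_def middle_def)
qed

text \<open>The count on the left has integral \<open>\<Sum>\<bar>middle (a p) - middle (b p)\<bar>\<close> over an interval of length
\<open>1/3\<close>, so it cannot exceed 3 times that value at every level.\<close>

lemma good_level:
  fixes a b :: "'p \<Rightarrow> real"
  assumes P: "finite P"
  obtains t where "1/3 \<le> t" "t \<le> 2/3"
    "(\<Sum>p\<in>P. of_bool ((t < a p) \<noteq> (t < b p))) \<le> 3 * (\<Sum>p\<in>P. \<bar>middle (a p) - middle (b p)\<bar>)"
proof (rule ccontr)
  assume not: "\<not> thesis"
  define I where "I = (\<Sum>p\<in>P. \<bar>middle (a p) - middle (b p)\<bar>)"
  define T where "T t = (\<Sum>p\<in>P. of_bool ((t < a p) \<noteq> (t < b p)) :: real)" for t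
  have not: "\<not> (1/3 \<le> t \<and> t \<le> 2/3 \<and> T t \<le> 3 * I)" for t
    using not that[of t] unfolding T_def I_def by blast
  have T: "3 * I < T t" if "t \<in> {1/3..2/3}" for t
    using not[of t] that by simp
  have int: "(T has_integral I) {1/3..2/3}"
    unfolding T_def I_def by (intro has_integral_sum P integral_level_sets)
  \<comment> \<open>The count is an integer, so exceeding \<open>3 * I\<close> at every level means exceeding it by a fixed amount.\<close>
  define m where "m = real_of_int (\<lfloor>3 * I\<rfloor> + 1)"
  have "m \<le> T t" if "t \<in> {1/3..2/3}" for t
  proof -
    define z :: int where "z = (\<Sum>p\<in>P. of_bool ((t < a p) \<noteq> (t < b p)))"
    have Tz: "T t = real_of_int z" unfolding T_def z_def by (simp only: of_int_sum of_int_of_bool)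
    then have "\<lfloor>3 * I\<rfloor> < z" using T[OF that] by (simp add: floor_less_iff)
    then show ?thesis unfolding m_def Tz of_int_le_iff by linarith
  qed
  then have "m * (1/3) \<le> I"
    using has_integral_le[OF has_integral_const_real[of m "1/3" "2/3"] int] by simp
  moreover have "3 * I < m" unfolding m_def by linarith
  ultimately show False by simp
qed

lemma sum_eventually_true:
  fixes P :: "int \<Rightarrow> bool"
  assumes lo: "\<And>k. k < -M0 \<Longrightarrow> \<not> P k" and hi: "\<And>k. k \<ge> M0 \<Longrightarrow> P k"
    and ab: "a \<le> -M0" "M0 \<le> b" and M0: "0 \<le> M0"
  shows "(\<Sum>k\<in>{a..<b}. of_bool (P k)) = (\<Sum>k\<in>{-M0..<M0}. of_bool (P k)) + (b - M0)"
proof -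
  define f :: "int \<Rightarrow> int" where "f = (\<lambda>k. of_bool (P k))"
  have split: "sum f {x..<z} = sum f {x..<y} + sum f {y..<z}" if "x \<le> y" "y \<le> z" for x y z
  proof -
    have "{x..<y} \<inter> {y..<z} = {}" by auto
    then have "sum f ({x..<y} \<union> {y..<z}) = sum f {x..<y} + sum f {y..<z}"
      by (intro sum.union_disjoint) auto
    then show ?thesis by (simp only: ivl_disj_un_two(3)[OF that])
  qed
  have "sum f {a..<b} = sum f {a..<-M0} + sum f {-M0..<M0} + sum f {M0..<b}"
  proof -
    have "a \<le> M0" "- M0 \<le> M0" using ab M0 by linarith+
    then show ?thesis
      by (simp only: split[OF \<open>a \<le> M0\<close> ab(2)] split[OF ab(1) \<open>- M0 \<le> M0\<close>])
  qed
  also have "sum f {a..<-M0} = 0" using lo by (intro sum.neutral) (auto simp: f_def)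
  also have "sum f {M0..<b} = (\<Sum>k\<in>{M0..<b}. 1)"
    using hi by (intro sum.cong) (auto simp: f_def)
  finally have "sum f {a..<b} = sum f {-M0..<M0} + (b - M0)" using ab by simp
  then show ?thesis by (simp only: f_def)
qed

text \<open>For a set of integers that agrees with a half-line up to finitely many points, translation by \<open>m\<close>
changes the number of points in a large window by \<open>m\<close>. This is why counting points in the fibres
converts the twisted action on \<open>Y \<times> \<int>\<close> into the addition of integers.\<close>

lemma sum_shift_eventually_true:
  fixes P :: "int \<Rightarrow> bool"
  assumes lo: "\<And>k. k < -M0 \<Longrightarrow> \<not> P k" and hi: "\<And>k. k \<ge> M0 \<Longrightarrow> P k"
    and M0: "0 \<le> M0" and m: "\<bar>m\<bar> \<le> M - M0"
  shows "(\<Sum>k\<in>{-M..<M}. of_bool (P (k - m))) = (\<Sum>k\<in>{-M..<M}. of_bool (P k)) - m"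
proof -
  have "(\<Sum>k\<in>{-M..<M}. of_bool (P (k - m)) :: int) = (\<Sum>k\<in>{-M-m..<M-m}. of_bool (P k))"
    by (rule sum.reindex_bij_witness[of _ "\<lambda>k. k + m" "\<lambda>k. k - m"]) auto
  also have "\<dots> = (\<Sum>k\<in>{-M0..<M0}. of_bool (P k)) + (M - m - M0)"
  proof -
    have "- M - m \<le> - M0" "M0 \<le> M - m" using m by linarith+
    from sum_eventually_true[OF lo hi this M0] show ?thesis .
  qed
  also have "(\<Sum>k\<in>{-M0..<M0}. of_bool (P k) :: int) = (\<Sum>k\<in>{-M..<M}. of_bool (P k)) - (M - M0)"
  proof -
    have "- M \<le> - M0" "M0 \<le> M" using m by linarith+
    from sum_eventually_true[OF lo hi this M0] show ?thesis by simp
  qed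
  finally show ?thesis by simp
qed

lemma half_line_shift: "half_line (a + z) k = half_line z (k - a)"
  by (simp add: half_line_def algebra_simps)

lemma half_line_cases: "half_line z k = 0 \<or> half_line z k = 1"
  by (simp add: half_line_def)

text \<open>Half-lines embed the integers into a Hilbert space with \<open>\<bar>a - b\<bar>\<close> as the squared distance, and
squared distances are of conditionally negative type.\<close>

lemma int_distance_negative_type:
  fixes t :: "nat \<Rightarrow> real" and z :: "nat \<Rightarrow> int"
  assumes t: "(\<Sum>m<n. t m) = 0"
  shows "(\<Sum>m<n. \<Sum>k<n. t m * t k * \<bar>z m - z k\<bar>) \<le> 0"
proof -
  define M where "M = (\<Sum>m<n. \<bar>z m\<bar>)"
  have M: "\<bar>z m\<bar> \<le> M" if "m < n" for m
    unfolding M_def using that by (intro member_le_sum) auto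
  have "0 \<le> M" unfolding M_def by (rule sum_nonneg) simp
  have "0 \<le> (\<Sum>k\<in>{-M..<M}. (\<Sum>i<n. t i * (half_line (z i) k - half_line 0 k))\<^sup>2)"
    by (rule sum_nonneg) simp
  also have "\<dots> = (\<Sum>i<n. \<Sum>j<n. t i * t j *
      ((\<bar>z i - 0\<bar> + \<bar>0 - z j\<bar> - \<bar>z i - z j\<bar> - \<bar>0 - 0 :: int\<bar>) / 2))"
    using M \<open>0 \<le> M\<close> by (intro sum_half_line_combination_sq) simp_all
  also have "\<dots> = ((\<Sum>i<n. \<Sum>j<n. t j * (t i * \<bar>z i\<bar>)) + (\<Sum>i<n. \<Sum>j<n. t i * (t j * \<bar>z j\<bar>))
      - (\<Sum>i<n. \<Sum>j<n. t i * t j * \<bar>z i - z j\<bar>)) / 2"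
    unfolding sum_subtractf[symmetric] sum.distrib[symmetric] sum_divide_distrib
    by (intro sum.cong refl) (simp add: algebra_simps)
  also have "(\<Sum>i<n. \<Sum>j<n. t j * (t i * \<bar>z i\<bar>)) = 0"
    unfolding sum_distrib_right[symmetric] t by simp
  also have "(\<Sum>i<n. \<Sum>j<n. t i * (t j * \<bar>z j\<bar>)) = 0"
    unfolding sum_distrib_left[symmetric] sum_distrib_right[symmetric] t by simp
  finally show ?thesis by simp
qed

text \<open>The group element \<open>s\<close> acts on \<open>Y \<times> \<int>\<close> by \<open>act s\<close> on \<open>Y\<close> and the translation \<open>a s\<close> on the fibres. The
function \<open>\<xi> x k = (\<Sum>m<n. w m * half_line (z m x) k)\<close> is an affine combination of indicator functions
of half-lines; \<open>U\<close> is its squared \<open>L\<^sup>2\<close> distance to the half-lines at \<open>z0\<close>, and \<open>E s\<close> is its squared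
\<open>L\<^sup>2\<close> displacement under \<open>s\<close>. The integer \<open>f x\<close> counts the points of the fibre over \<open>x\<close>, within a
large window, at which \<open>\<xi>\<close> exceeds a good level, and a point contributes to the error of \<open>f\<close> only if the level separates
the two values of \<open>\<xi>\<close> at this point and at its image.\<close>

lemma integral_rounding:
  fixes Y :: "'x set" and S :: "'s set" and act :: "'s \<Rightarrow> 'x \<Rightarrow> 'x"
    and a :: "'s \<Rightarrow> 'x \<Rightarrow> int" and z :: "nat \<Rightarrow> 'x \<Rightarrow> int" and z0 :: "'x \<Rightarrow> int"
    and w :: "nat \<Rightarrow> real"
  assumes Y: "finite Y" and S: "finite S"
    and act: "\<And>s. s \<in> S \<Longrightarrow> bij_betw (act s) Y Y"
    and w: "(\<Sum>m<n. w m) = 1" and l: "0 < l" "l \<le> 1/6"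
  defines "U \<equiv> (\<Sum>x\<in>Y. \<Sum>m<n. \<Sum>k<n. w m * w k *
    ((\<bar>z m x - z0 x\<bar> + \<bar>z0 x - z k x\<bar> - \<bar>z m x - z k x\<bar>) / 2))"
    and "E \<equiv> \<lambda>s. (\<Sum>x\<in>Y. \<Sum>m<n. \<Sum>k<n. w m * w k *
    ((\<bar>z m x - (a s x + z k (act s x))\<bar> + \<bar>a s x + z m (act s x) - z k x\<bar>
      - \<bar>z m x - z k x\<bar> - \<bar>z m (act s x) - z k (act s x)\<bar>) / 2))"
  shows "\<exists>f :: 'x \<Rightarrow> int. (\<Sum>s\<in>S. \<Sum>x\<in>Y. real_of_int \<bar>a s x - (f (act s x) - f x)\<bar>)
    \<le> 3 * (\<Sum>s\<in>S. 9 * l * U + E s / (2 * l))"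
proof -
  \<comment> \<open>All half-lines in question start in \<open>{-M0..M0}\<close>, and their translates start in \<open>{-M..M}\<close>.\<close>
  define M0 where "M0 = (\<Sum>x\<in>Y. \<bar>z0 x\<bar> + (\<Sum>m<n. \<bar>z m x\<bar>))"
  define M where "M = M0 + (\<Sum>s\<in>S. \<Sum>x\<in>Y. \<bar>a s x\<bar>)"
  have M0: "\<bar>z0 x\<bar> + (\<Sum>m<n. \<bar>z m x\<bar>) \<le> M0" if "x \<in> Y" for x
    unfolding M0_def using Y that
    by (intro member_le_sum[of x Y "\<lambda>x. \<bar>z0 x\<bar> + (\<Sum>m<n. \<bar>z m x\<bar>)"]) (auto intro!: add_nonneg_nonneg sum_nonneg)
  have zM0: "\<bar>z m x\<bar> \<le> M0" if "m < n" "x \<in> Y" for m x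
  proof -
    have "\<bar>z m x\<bar> \<le> (\<Sum>m<n. \<bar>z m x\<bar>)" using that by (intro member_le_sum) auto
    then show ?thesis using M0[OF that(2)] by linarith
  qed
  have z0M0: "\<bar>z0 x\<bar> \<le> M0" if "x \<in> Y" for x
  proof -
    have "0 \<le> (\<Sum>m<n. \<bar>z m x\<bar>)" by (rule sum_nonneg) simp
    then show ?thesis using M0[OF that] by linarith
  qed
  have M0_nonneg: "0 \<le> M0" unfolding M0_def by (intro sum_nonneg add_nonneg_nonneg) auto
  have aM: "\<bar>a s x\<bar> \<le> M - M0" if "s \<in> S" "x \<in> Y" for s x
  proof -
    have "\<bar>a s x\<bar> \<le> (\<Sum>x\<in>Y. \<bar>a s x\<bar>)" using that Y by (intro member_le_sum) auto
    also have "\<dots> \<le> (\<Sum>s\<in>S. \<Sum>x\<in>Y. \<bar>a s x\<bar>)"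
      using that S by (intro member_le_sum[of s S "\<lambda>s. \<Sum>x\<in>Y. \<bar>a s x\<bar>"]) (auto intro: sum_nonneg)
    finally show ?thesis by (simp add: M_def)
  qed
  have M0M: "M0 \<le> M" unfolding M_def by (simp add: sum_nonneg)
  have actX: "act s x \<in> Y" if "s \<in> S" "x \<in> Y" for s x
    using act[OF that(1)] that(2) by (rule bij_betwE[THEN bspec])
  define \<xi> where "\<xi> x k = (\<Sum>m<n. w m * half_line (z m x) k)" for x k
  define \<xi>' where "\<xi>' s x k = (\<Sum>m<n. w m * half_line (a s x + z m (act s x)) k)" for s x k
  have \<xi>'_shift: "\<xi>' s x k = \<xi> (act s x) (k - a s x)" for s x k
    by (simp add: \<xi>_def \<xi>'_def half_line_shift)
  let ?J = "{-M..<M}"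
  have base: "(\<Sum>m<n. w m * half_line (y m) k) - half_line y0 k =
      (\<Sum>m<n. w m * (half_line (y m) k - half_line y0 k))" for y :: "nat \<Rightarrow> int" and y0 k
    by (simp only: right_diff_distrib sum_subtractf sum_distrib_right[symmetric] w mult_1_left)
  have U1: "(\<Sum>x\<in>Y. \<Sum>k\<in>?J. (\<xi> x k - half_line (z0 x) k)\<^sup>2) = U"
    unfolding U_def \<xi>_def base
  proof (rule sum.cong[OF refl])
    fix x assume x: "x \<in> Y"
    have "(\<Sum>k\<in>?J. (\<Sum>m<n. w m * (half_line (z m x) k - half_line (z0 x) k))\<^sup>2) =
      (\<Sum>i<n. \<Sum>j<n. w i * w j *
      ((\<bar>z i x - z0 x\<bar> + \<bar>z0 x - z j x\<bar> - \<bar>z i x - z j x\<bar> - \<bar>z0 x - z0 x\<bar>) / 2))"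
      using zM0[OF _ x] z0M0[OF x] M0M
      by (intro sum_half_line_combination_sq[of n "\<lambda>m. z m x" M "\<lambda>m. z0 x" w]) (meson order_trans)+
    then show "(\<Sum>k\<in>?J. (\<Sum>m<n. w m * (half_line (z m x) k - half_line (z0 x) k))\<^sup>2) =
      (\<Sum>i<n. \<Sum>j<n. w i * w j * ((\<bar>z i x - z0 x\<bar> + \<bar>z0 x - z j x\<bar> - \<bar>z i x - z j x\<bar>) / 2))"
      by simp
  qed
  have shifted_bound: "\<bar>a s x + y\<bar> \<le> M" if "s \<in> S" "x \<in> Y" "\<bar>y\<bar> \<le> M0" for s x y
    using aM[OF that(1,2)] that(3) by linarith
  have U2: "(\<Sum>x\<in>Y. \<Sum>k\<in>?J. (\<xi>' s x k - half_line (a s x + z0 (act s x)) k)\<^sup>2) = U" if s: "s \<in> S" for s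
  proof -
    have "(\<Sum>x\<in>Y. \<Sum>k\<in>?J. (\<xi>' s x k - half_line (a s x + z0 (act s x)) k)\<^sup>2) =
      (\<Sum>x\<in>Y. \<Sum>m<n. \<Sum>k<n. w m * w k * ((\<bar>z m (act s x) - z0 (act s x)\<bar>
        + \<bar>z0 (act s x) - z k (act s x)\<bar> - \<bar>z m (act s x) - z k (act s x)\<bar>) / 2))"
      unfolding \<xi>'_def base
    proof (rule sum.cong[OF refl])
      fix x assume x: "x \<in> Y"
      let ?y = "act s x"
      have "(\<Sum>k\<in>?J. (\<Sum>m<n. w m * (half_line (a s x + z m ?y) k - half_line (a s x + z0 ?y) k))\<^sup>2) =
        (\<Sum>i<n. \<Sum>j<n. w i * w j *
        ((\<bar>(a s x + z i ?y) - (a s x + z0 ?y)\<bar> + \<bar>(a s x + z0 ?y) - (a s x + z j ?y)\<bar>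
          - \<bar>(a s x + z i ?y) - (a s x + z j ?y)\<bar> - \<bar>(a s x + z0 ?y) - (a s x + z0 ?y)\<bar>) / 2))"
        by (rule sum_half_line_combination_sq[of n "\<lambda>m. a s x + z m ?y" M "\<lambda>m. a s x + z0 ?y" w])
           (rule shifted_bound[OF s x], rule zM0 z0M0, (assumption | rule actX[OF s x])+)+
      then show "(\<Sum>k\<in>?J. (\<Sum>m<n. w m * (half_line (a s x + z m ?y) k - half_line (a s x + z0 ?y) k))\<^sup>2) =
        (\<Sum>m<n. \<Sum>k<n. w m * w k * ((\<bar>z m ?y - z0 ?y\<bar>
        + \<bar>z0 ?y - z k ?y\<bar> - \<bar>z m ?y - z k ?y\<bar>) / 2))" by simp
    qed
    also have "\<dots> = U"
      unfolding U_def by (rule sum.reindex_bij_betw[OF act[OF s]])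
    finally show ?thesis .
  qed
  have E1: "(\<Sum>x\<in>Y. \<Sum>k\<in>?J. (\<xi> x k - \<xi>' s x k)\<^sup>2) = E s" if s: "s \<in> S" for s
    unfolding E_def \<xi>_def \<xi>'_def sum_subtractf[symmetric] right_diff_distrib[symmetric]
  proof (rule sum.cong[OF refl])
    fix x assume x: "x \<in> Y"
    let ?y = "act s x"
    have "(\<Sum>k\<in>?J. (\<Sum>m<n. w m * (half_line (z m x) k - half_line (a s x + z m ?y) k))\<^sup>2) =
      (\<Sum>i<n. \<Sum>j<n. w i * w j *
      ((\<bar>z i x - (a s x + z j ?y)\<bar> + \<bar>(a s x + z i ?y) - z j x\<bar>
        - \<bar>z i x - z j x\<bar> - \<bar>(a s x + z i ?y) - (a s x + z j ?y)\<bar>) / 2))"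
    proof (rule sum_half_line_combination_sq[of n "\<lambda>m. z m x" M "\<lambda>m. a s x + z m ?y" w])
      show "\<bar>z i x\<bar> \<le> M" if "i < n" for i using zM0[OF that x] M0M by linarith
      show "\<bar>a s x + z i ?y\<bar> \<le> M" if "i < n" for i
        by (rule shifted_bound[OF s x zM0[OF that actX[OF s x]]])
    qed
    then show "(\<Sum>k\<in>?J. (\<Sum>m<n. w m * (half_line (z m x) k - half_line (a s x + z m ?y) k))\<^sup>2) =
      (\<Sum>i<n. \<Sum>j<n. w i * w j *
      ((\<bar>z i x - (a s x + z j ?y)\<bar> + \<bar>a s x + z i ?y - z j x\<bar>
        - \<bar>z i x - z j x\<bar> - \<bar>z i ?y - z j ?y\<bar>) / 2))" by simp
  qed
  let ?P = "S \<times> Y \<times> ?J"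
  have "finite ?P" using S Y by simp
  then obtain t where t: "1/3 \<le> t" "t \<le> 2/3" and
    count: "(\<Sum>p\<in>?P. of_bool ((t < (\<lambda>(s, x, k). \<xi> x k) p) \<noteq> (t < (\<lambda>(s, x, k). \<xi>' s x k) p))) \<le>
      3 * (\<Sum>p\<in>?P. \<bar>middle ((\<lambda>(s, x, k). \<xi> x k) p) - middle ((\<lambda>(s, x, k). \<xi>' s x k) p)\<bar>)"
    by (rule good_level)
  have cart: "(\<Sum>p\<in>?P. F p) = (\<Sum>s\<in>S. \<Sum>x\<in>Y. \<Sum>k\<in>?J. F (s, x, k))" for F :: "'s \<times> 'x \<times> int \<Rightarrow> real"
    by (simp add: sum.cartesian_product)
  have "(\<Sum>x\<in>Y. \<Sum>k\<in>?J. \<bar>middle (\<xi> x k) - middle (\<xi>' s x k)\<bar>) \<le> 9 * l * U + E s / (2 * l)"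
    if s: "s \<in> S" for s
  proof -
    have "(\<Sum>x\<in>Y. \<Sum>k\<in>?J. \<bar>middle (\<xi> x k) - middle (\<xi>' s x k)\<bar>) \<le>
      (\<Sum>x\<in>Y. \<Sum>k\<in>?J. 9/2 * l * ((\<xi> x k - half_line (z0 x) k)\<^sup>2
        + (\<xi>' s x k - half_line (a s x + z0 (act s x)) k)\<^sup>2) + (\<xi> x k - \<xi>' s x k)\<^sup>2 / (2 * l))"
      by (intro sum_mono middle_diff_le half_line_cases l)
    also have "\<dots> = 9/2 * l * ((\<Sum>x\<in>Y. \<Sum>k\<in>?J. (\<xi> x k - half_line (z0 x) k)\<^sup>2)
        + (\<Sum>x\<in>Y. \<Sum>k\<in>?J. (\<xi>' s x k - half_line (a s x + z0 (act s x)) k)\<^sup>2))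
        + (\<Sum>x\<in>Y. \<Sum>k\<in>?J. (\<xi> x k - \<xi>' s x k)\<^sup>2) / (2 * l)"
      by (simp only: sum.distrib sum_distrib_left sum_divide_distrib distrib_left)
    also have "\<dots> = 9 * l * U + E s / (2 * l)" by (simp add: U1 U2[OF s] E1[OF s])
    finally show ?thesis .
  qed
  then have total: "(\<Sum>s\<in>S. \<Sum>x\<in>Y. \<Sum>k\<in>?J. of_bool ((t < \<xi> x k) \<noteq> (t < \<xi>' s x k)) :: real) \<le>
      3 * (\<Sum>s\<in>S. 9 * l * U + E s / (2 * l))"
    using count unfolding cart prod.case
    by (intro order_trans[OF count[unfolded cart prod.case]] mult_left_mono sum_mono) auto
  define f :: "'x \<Rightarrow> int" where "f x = (\<Sum>k\<in>?J. of_bool (t < \<xi> x k))" for x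
  have "real_of_int \<bar>a s x - (f (act s x) - f x)\<bar> \<le> (\<Sum>k\<in>?J. of_bool ((t < \<xi> x k) \<noteq> (t < \<xi>' s x k)))"
    if s: "s \<in> S" and x: "x \<in> Y" for s x
  proof -
    let ?y = "act s x"
    have y: "?y \<in> Y" by (rule actX[OF s x])
    have "\<xi> ?y k = 0" if "k < - M0" for k
      unfolding \<xi>_def
    proof (rule sum.neutral, rule ballI)
      fix m assume "m \<in> {..<n}"
      then have "\<bar>z m ?y\<bar> \<le> M0" using zM0[OF _ y] by simp
      then have "\<not> z m ?y \<le> k" using that by linarith
      then show "w m * half_line (z m ?y) k = 0" by (simp add: half_line_def)
    qed
    then have lo: "\<not> t < \<xi> ?y k" if "k < - M0" for k using that t by simp
    have "\<xi> ?y k = 1" if "k \<ge> M0" for k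
    proof -
      have "\<xi> ?y k = (\<Sum>m<n. w m)"
        unfolding \<xi>_def
      proof (rule sum.cong[OF refl])
        fix m assume "m \<in> {..<n}"
        then have "\<bar>z m ?y\<bar> \<le> M0" using zM0[OF _ y] by simp
        then have "z m ?y \<le> k" using that by linarith
        then show "w m * half_line (z m ?y) k = w m" by (simp add: half_line_def)
      qed
      then show ?thesis using w by simp
    qed
    then have hi: "t < \<xi> ?y k" if "k \<ge> M0" for k using that t by simp
    have "(\<Sum>k\<in>?J. of_bool (t < \<xi>' s x k)) = f ?y - a s x"
      unfolding \<xi>'_shift f_def
      by (rule sum_shift_eventually_true[OF lo hi M0_nonneg aM[OF s x]])
    then have "a s x - (f ?y - f x) = (\<Sum>k\<in>?J. of_bool (t < \<xi> x k) - of_bool (t < \<xi>' s x k))"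
      by (simp add: f_def sum_subtractf del: sum_of_bool_eq)
    then have "real_of_int \<bar>a s x - (f ?y - f x)\<bar> =
        \<bar>\<Sum>k\<in>?J. of_bool (t < \<xi> x k) - of_bool (t < \<xi>' s x k)\<bar>"
      by (simp only: of_int_abs of_int_sum of_int_diff of_int_of_bool)
    also have "\<dots> \<le> (\<Sum>k\<in>?J. \<bar>of_bool (t < \<xi> x k) - of_bool (t < \<xi>' s x k)\<bar>)" by (rule sum_abs)
    also have "\<dots> = (\<Sum>k\<in>?J. of_bool ((t < \<xi> x k) \<noteq> (t < \<xi>' s x k)))"
      by (rule sum.cong) auto
    finally show ?thesis .
  qed
  then have "(\<Sum>s\<in>S. \<Sum>x\<in>Y. real_of_int \<bar>a s x - (f (act s x) - f x)\<bar>) \<le>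
      (\<Sum>s\<in>S. \<Sum>x\<in>Y. \<Sum>k\<in>?J. of_bool ((t < \<xi> x k) \<noteq> (t < \<xi>' s x k)))"
    by (intro sum_mono)
  with total show ?thesis by (intro exI[of _ f]) linarith
qed

section \<open>Square-summable sequences\<close>

text \<open>The inner product of square-summable sequences. It is also used for an arbitrary first argument when the
second has finite support; the actions constructed below are then defined on all sequences.\<close>

definition ip :: "(nat \<Rightarrow> real) \<Rightarrow> (nat \<Rightarrow> real) \<Rightarrow> real"
  where "ip v w = suminf (\<lambda>i. v i * w i)"

definition l2 :: "(nat \<Rightarrow> real) set"
  where "l2 = {v. summable (\<lambda>i. (v i)\<^sup>2)}"

definition finsupp :: "(nat \<Rightarrow> real) set"
  where "finsupp = {v. \<exists>n. \<forall>i\<ge>n. v i = 0}"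

lemma l2_summable_mult:
  assumes "v \<in> l2" "w \<in> l2" shows "summable (\<lambda>i. v i * w i)"
proof (rule summable_comparison_test')
  show "summable (\<lambda>i. (v i)\<^sup>2 + (w i)\<^sup>2)" using assms by (auto simp: l2_def intro: summable_add)
  show "norm (v i * w i) \<le> (v i)\<^sup>2 + (w i)\<^sup>2" for i
  proof -
    have "2 * (\<bar>v i\<bar> * \<bar>w i\<bar>) \<le> (v i)\<^sup>2 + (w i)\<^sup>2"
      using sum_squares_bound[of "\<bar>v i\<bar>" "\<bar>w i\<bar>"] by (simp add: mult_ac)
    moreover have "0 \<le> \<bar>v i\<bar> * \<bar>w i\<bar>" by simp
    ultimately show ?thesis unfolding real_norm_def abs_mult by linarith
  qed
qed

lemma l2_add:
  assumes "v \<in> l2" "w \<in> l2" shows "(\<lambda>i. v i + w i) \<in> l2"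
proof -
  have "summable (\<lambda>i. (v i)\<^sup>2 + (w i)\<^sup>2 + 2 * (v i * w i))"
    using assms l2_summable_mult[OF assms] by (auto simp: l2_def intro!: summable_add summable_mult)
  then show ?thesis by (simp add: l2_def power2_sum mult.assoc)
qed

lemma l2_scale: "v \<in> l2 \<Longrightarrow> (\<lambda>i. a * v i) \<in> l2"
  by (auto simp: l2_def power_mult_distrib)

lemma l2_zero: "(\<lambda>i. 0) \<in> l2"
  by (simp add: l2_def)

lemma l2_diff:
  assumes "v \<in> l2" "w \<in> l2" shows "(\<lambda>i. v i - w i) \<in> l2"
  using l2_add[OF assms(1) l2_scale[OF assms(2), of "-1"]] by simp

lemma finsupp_l2: "v \<in> finsupp \<Longrightarrow> v \<in> l2"
proof -
  assume "v \<in> finsupp"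
  then obtain n where "\<forall>i\<ge>n. v i = 0" by (auto simp: finsupp_def)
  then show ?thesis unfolding l2_def by (auto intro!: summable_finite[of "{..<n}"] simp: not_less[symmetric])
qed

lemma finsupp_summable_mult:
  assumes "w \<in> finsupp" shows "summable (\<lambda>i. v i * w i)"
proof -
  obtain n where "\<forall>i\<ge>n. w i = 0" using assms by (auto simp: finsupp_def)
  then show ?thesis by (intro summable_finite[of "{..<n}"]) auto
qed

lemma finsupp_add:
  assumes "v \<in> finsupp" "w \<in> finsupp" shows "(\<lambda>i. v i + w i) \<in> finsupp"
proof -
  obtain m n where "\<forall>i\<ge>m. v i = 0" "\<forall>i\<ge>n. w i = 0" using assms by (auto simp: finsupp_def)
  then have "\<forall>i\<ge>max m n. v i + w i = 0" by auto
  then show ?thesis unfolding finsupp_def by blast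
qed

lemma finsupp_scale: "v \<in> finsupp \<Longrightarrow> (\<lambda>i. a * v i) \<in> finsupp"
  by (auto simp: finsupp_def)

lemma finsupp_diff:
  assumes "v \<in> finsupp" "w \<in> finsupp" shows "(\<lambda>i. v i - w i) \<in> finsupp"
  using finsupp_add[OF assms(1) finsupp_scale[OF assms(2), of "-1"]] by simp

lemma finsupp_sum:
  assumes "\<And>m. m \<in> A \<Longrightarrow> x m \<in> finsupp" shows "(\<lambda>i. \<Sum>m\<in>A. x m i) \<in> finsupp"
  using assms
proof (induction A rule: infinite_finite_induct)
  case (insert m A)
  then show ?case using finsupp_add[of "x m" "\<lambda>i. \<Sum>m\<in>A. x m i"] by simp
qed (auto simp: finsupp_def)

lemma ip_commute: "ip v w = ip w v"
  by (simp add: ip_def mult.commute)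

lemma ip_eq_sum:
  assumes "\<And>i. i \<ge> n \<Longrightarrow> w i = 0"
  shows "ip v w = (\<Sum>i<n. v i * w i)"
  unfolding ip_def using assms by (intro suminf_finite) auto

lemma ip_sum_right:
  assumes "\<And>m. m \<in> A \<Longrightarrow> summable (\<lambda>i. v i * x m i)"
  shows "ip v (\<lambda>i. \<Sum>m\<in>A. a m * x m i) = (\<Sum>m\<in>A. a m * ip v (x m))"
proof -
  have "ip v (\<lambda>i. \<Sum>m\<in>A. a m * x m i) = suminf (\<lambda>i. \<Sum>m\<in>A. a m * (v i * x m i))"
    by (simp add: ip_def sum_distrib_left mult.left_commute)
  also have "\<dots> = (\<Sum>m\<in>A. suminf (\<lambda>i. a m * (v i * x m i)))"
    using assms by (intro suminf_sum summable_mult)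
  also have "\<dots> = (\<Sum>m\<in>A. a m * ip v (x m))"
    unfolding ip_def using assms by (intro sum.cong refl suminf_mult)
  finally show ?thesis .
qed

lemma ip_diff_right:
  assumes "summable (\<lambda>i. v i * x i)" "summable (\<lambda>i. v i * y i)"
  shows "ip v (\<lambda>i. x i - y i) = ip v x - ip v y"
  using suminf_diff[OF assms] by (simp add: ip_def right_diff_distrib)

lemma ip_add_right:
  assumes "summable (\<lambda>i. v i * x i)" "summable (\<lambda>i. v i * y i)"
  shows "ip v (\<lambda>i. x i + y i) = ip v x + ip v y"
  using suminf_add[OF assms] by (simp add: ip_def distrib_left)

lemma ip_scale_right:
  assumes "summable (\<lambda>i. v i * x i)"
  shows "ip v (\<lambda>i. a * x i) = a * ip v x"
  using suminf_mult[OF assms, of a] by (simp add: ip_def mult.left_commute)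

lemma ip_add_self:
  assumes "v \<in> l2" "w \<in> l2"
  shows "ip (\<lambda>i. v i + w i) (\<lambda>i. v i + w i) = ip v v + 2 * ip v w + ip w w"
proof -
  let ?u = "\<lambda>i. v i + w i"
  have "ip ?u ?u = ip ?u v + ip ?u w"
    using assms by (intro ip_add_right l2_summable_mult l2_add)
  also have "ip ?u v = ip v v + ip v w"
    unfolding ip_commute[of ?u v] using assms by (intro ip_add_right l2_summable_mult)
  also have "ip ?u w = ip w v + ip w w"
    unfolding ip_commute[of ?u w] using assms by (intro ip_add_right l2_summable_mult)
  finally show ?thesis by (simp add: ip_commute[of w v])
qed

lemma ip_diff_self:
  assumes "v \<in> l2" "w \<in> l2"
  shows "ip (\<lambda>i. v i - w i) (\<lambda>i. v i - w i) = ip v v - 2 * ip v w + ip w w"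
proof -
  let ?u = "\<lambda>i. v i - w i"
  have "ip ?u ?u = ip ?u v - ip ?u w"
    using assms by (intro ip_diff_right l2_summable_mult l2_diff)
  also have "ip ?u v = ip v v - ip v w"
    unfolding ip_commute[of ?u v] using assms by (intro ip_diff_right l2_summable_mult)
  also have "ip ?u w = ip w v - ip w w"
    unfolding ip_commute[of ?u w] using assms by (intro ip_diff_right l2_summable_mult)
  finally show ?thesis by (simp add: ip_commute[of w v])
qed

lemma ip_self_nonneg: "v \<in> l2 \<Longrightarrow> 0 \<le> ip v v"
  unfolding ip_def by (intro suminf_nonneg) (auto simp: l2_def power2_eq_square)

lemma sum_sq_le_ip:
  assumes "v \<in> l2" shows "(\<Sum>i<n. (v i)\<^sup>2) \<le> ip v v"
  using assms unfolding ip_def l2_def power2_eq_square[symmetric]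
  by (intro sum_le_suminf) auto

lemma sq_le_ip:
  assumes "v \<in> l2" shows "(v i)\<^sup>2 \<le> ip v v"
proof -
  have "(v i)\<^sup>2 \<le> (\<Sum>j<Suc i. (v j)\<^sup>2)" by (rule member_le_sum) auto
  then show ?thesis using sum_sq_le_ip[OF assms, of "Suc i"] by linarith
qed

lemma ip_self_zero: "v \<in> l2 \<Longrightarrow> ip v v = 0 \<Longrightarrow> v i = 0"
  using sq_le_ip[of v i] by simp

lemma l2_bounded:
  assumes "\<And>n. (\<Sum>i<n. (v i)\<^sup>2) \<le> B"
  shows "v \<in> l2" "ip v v \<le> B"
proof -
  show s: "v \<in> l2"
    unfolding l2_def using assms[of "Suc _"]
    by (auto intro!: bounded_imp_summable[of _ B] simp only: lessThan_Suc_atMost zero_le_power2)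
  then show "ip v v \<le> B"
    unfolding ip_def l2_def power2_eq_square[symmetric]
    using assms by (intro suminf_le_const) auto
qed

text \<open>The limit is taken coordinate by coordinate. Bounds for the sums over finite initial segments survive the
limit, and they give both square-summability of \<open>y\<close> and convergence in norm.\<close>

lemma l2_complete:
  fixes x :: "nat \<Rightarrow> nat \<Rightarrow> real"
  assumes x: "\<And>n. x n \<in> l2"
    and Cauchy: "\<And>\<epsilon>. 0 < \<epsilon> \<Longrightarrow> \<exists>N. \<forall>m\<ge>N. \<forall>n\<ge>N. ip (\<lambda>i. x n i - x m i) (\<lambda>i. x n i - x m i) \<le> \<epsilon>"
  obtains y where "y \<in> l2" "\<And>i. (\<lambda>n. x n i) \<longlonglongrightarrow> y i"
    "(\<lambda>n. ip (\<lambda>i. x n i - y i) (\<lambda>i. x n i - y i)) \<longlonglongrightarrow> 0"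
proof -
  have "Cauchy (\<lambda>n. x n i)" for i
  proof (rule metric_CauchyI)
    fix e :: real assume e: "0 < e"
    obtain N where N: "\<forall>m\<ge>N. \<forall>n\<ge>N. ip (\<lambda>i. x n i - x m i) (\<lambda>i. x n i - x m i) \<le> (e/2)\<^sup>2"
      using Cauchy[of "(e/2)\<^sup>2"] e by auto
    have "dist (x m i) (x n i) < e" if "m \<ge> N" "n \<ge> N" for m n
    proof -
      have "(x m i - x n i)\<^sup>2 \<le> (e/2)\<^sup>2"
        using N that sq_le_ip[OF l2_diff[OF x x], of m i n] by (meson order_trans)
      then have "\<bar>x m i - x n i\<bar> \<le> e/2" using e by (intro power2_le_imp_le[of "\<bar>_\<bar>"]) auto
      then show ?thesis using e by (simp add: dist_real_def)
    qed
    then show "\<exists>M. \<forall>m\<ge>M. \<forall>n\<ge>M. dist (x m i) (x n i) < e" by blast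
  qed
  then have "\<forall>i. \<exists>l. (\<lambda>n. x n i) \<longlonglongrightarrow> l" by (simp add: Cauchy_convergent_iff convergent_def)
  then obtain y where y: "\<And>i. (\<lambda>n. x n i) \<longlonglongrightarrow> y i" by metis
  have near: "(\<Sum>i<k. (x n i - y i)\<^sup>2) \<le> \<epsilon>"
    if N: "\<forall>m\<ge>N. \<forall>n\<ge>N. ip (\<lambda>i. x n i - x m i) (\<lambda>i. x n i - x m i) \<le> \<epsilon>" and n: "n \<ge> N" for \<epsilon> N n k
  proof (rule LIMSEQ_le_const2)
    show "(\<lambda>m. \<Sum>i<k. (x n i - x m i)\<^sup>2) \<longlonglongrightarrow> (\<Sum>i<k. (x n i - y i)\<^sup>2)"
      by (intro tendsto_intros y)
    show "\<exists>M. \<forall>m\<ge>M. (\<Sum>i<k. (x n i - x m i)\<^sup>2) \<le> \<epsilon>"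
      using N n sum_sq_le_ip[OF l2_diff[OF x x]] by (meson order_trans)
  qed
  have yl2: "y \<in> l2"
  proof -
    obtain N where "\<forall>m\<ge>N. \<forall>n\<ge>N. ip (\<lambda>i. x n i - x m i) (\<lambda>i. x n i - x m i) \<le> 1"
      using Cauchy[of 1] by auto
    then have "(\<lambda>i. x N i - y i) \<in> l2" by (intro l2_bounded(1)[of _ 1] near) auto
    from l2_diff[OF x this, of N] show ?thesis by simp
  qed
  have "(\<lambda>n. ip (\<lambda>i. x n i - y i) (\<lambda>i. x n i - y i)) \<longlonglongrightarrow> 0"
  proof (rule LIMSEQ_I)
    fix r :: real assume r: "0 < r"
    obtain N where N: "\<forall>m\<ge>N. \<forall>n\<ge>N. ip (\<lambda>i. x n i - x m i) (\<lambda>i. x n i - x m i) \<le> r/2"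
      using Cauchy[of "r/2"] r by auto
    have "norm (ip (\<lambda>i. x n i - y i) (\<lambda>i. x n i - y i) - 0) < r" if "n \<ge> N" for n
    proof -
      have "ip (\<lambda>i. x n i - y i) (\<lambda>i. x n i - y i) \<le> r/2"
        using N that by (intro l2_bounded(2) near)
      then show ?thesis using ip_self_nonneg[OF l2_diff[OF x yl2], of n] r by simp
    qed
    then show "\<exists>no. \<forall>n\<ge>no. norm (ip (\<lambda>i. x n i - y i) (\<lambda>i. x n i - y i) - 0) < r" by blast
  qed
  with yl2 y show ?thesis by (rule that)
qed

lemma truncation_tendsto:
  assumes "v \<in> l2"
  shows "(\<lambda>n. ip (\<lambda>i. v i - (if i < n then v i else 0)) (\<lambda>i. v i - (if i < n then v i else 0))) \<longlonglongrightarrow> 0"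
proof -
  have "ip (\<lambda>i. v i - (if i < n then v i else 0)) (\<lambda>i. v i - (if i < n then v i else 0)) =
      ip v v - (\<Sum>i<n. v i * v i)" for n
  proof -
    let ?t = "\<lambda>i. if i < n then v i else 0"
    have t: "?t \<in> finsupp" unfolding finsupp_def by (auto intro!: exI[of _ n])
    have "ip u ?t = (\<Sum>i<n. u i * v i)" for u
      by (subst ip_eq_sum[where n = n]) (auto intro: sum.cong)
    then show ?thesis using assms t by (subst ip_diff_self) (auto simp: finsupp_l2)
  qed
  moreover have "(\<lambda>n. ip v v - (\<Sum>i<n. v i * v i)) \<longlonglongrightarrow> ip v v - ip v v"
    using l2_summable_mult[OF assms assms] unfolding ip_def
    by (intro tendsto_diff tendsto_const summable_LIMSEQ)
  ultimately show ?thesis by simp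
qed

section \<open>The isometric action attached to an invariant kernel\<close>

text \<open>The data obtained from a left invariant kernel \<open>\<psi>\<close> of conditionally negative type on a countable group
enumerated by \<open>\<gamma>\<close>. The vectors \<open>b g\<close> are the orbit \<open>o\<^sub>g - o\<^sub>\<one>\<close> of an affine isometric action seen from
its base point, and \<open>\<psi> g h\<close> is the squared distance of \<open>o\<^sub>g\<close> and \<open>o\<^sub>h\<close>. The set \<open>I\<close> and the triangular
matrix \<open>T\<close> come from the Cholesky decomposition.\<close>

locale kernel_vectors = Group.group G for G :: "('g, 'b) monoid_scheme" (structure) +
  fixes \<psi> :: "'g \<Rightarrow> 'g \<Rightarrow> real" and \<gamma> :: "nat \<Rightarrow> 'g" and b :: "'g \<Rightarrow> nat \<Rightarrow> real"
    and I :: "nat set" and T :: "nat \<Rightarrow> nat \<Rightarrow> real"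
  assumes psi_sym: "\<psi> g h = \<psi> h g"
    and psi_diag: "g \<in> carrier G \<Longrightarrow> \<psi> g g = 0"
    and psi_left: "\<lbrakk>k \<in> carrier G; g \<in> carrier G; h \<in> carrier G\<rbrakk> \<Longrightarrow> \<psi> (k \<otimes> g) (k \<otimes> h) = \<psi> g h"
    and gamma: "range \<gamma> = carrier G"
    and b_finsupp: "g \<in> carrier G \<Longrightarrow> b g \<in> finsupp"
    and b_supp: "\<lbrakk>g \<in> carrier G; i \<notin> I\<rbrakk> \<Longrightarrow> b g i = 0"
    and ip_b: "\<lbrakk>g \<in> carrier G; h \<in> carrier G\<rbrakk> \<Longrightarrow> ip (b g) (b h) = (\<psi> g \<one> + \<psi> \<one> h - \<psi> g h) / 2"
    and T_triangular: "i < m \<Longrightarrow> T i m = 0"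
    and T_inverse: "i \<in> I \<Longrightarrow> (\<Sum>m\<le>i. T i m * b (\<gamma> m) j) = of_bool (j = i)"
begin

lemma gamma_closed [simp]: "\<gamma> m \<in> carrier G"
  using gamma by blast

lemma summable_b: "g \<in> carrier G \<Longrightarrow> summable (\<lambda>i. v i * b g i)"
  by (rule finsupp_summable_mult[OF b_finsupp])

lemma ip_b_diff:
  assumes "g \<in> carrier G" "g' \<in> carrier G" "h \<in> carrier G" "h' \<in> carrier G"
  shows "ip (\<lambda>i. b g i - b g' i) (\<lambda>i. b h i - b h' i) = (\<psi> g h' + \<psi> g' h - \<psi> g h - \<psi> g' h') / 2"
proof -
  have 1: "ip v (\<lambda>i. b h i - b h' i) = ip v (b h) - ip v (b h')" for v
    using assms by (intro ip_diff_right summable_b)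
  have 2: "ip (\<lambda>i. b g i - b g' i) w = ip (b g) w - ip (b g') w" if "w \<in> finsupp" for w
    unfolding ip_commute[of _ w] using assms by (intro ip_diff_right summable_b)
  show ?thesis
    using assms by (simp add: 1 2 b_finsupp ip_b field_simps)
qed

lemma ip_combination:
  fixes n :: nat
  assumes "\<And>m. m < n \<Longrightarrow> u m \<in> finsupp"
  shows "ip (\<lambda>i. \<Sum>m<n. a m * u m i) (\<lambda>i. \<Sum>m<n. a m * u m i) =
    (\<Sum>m<n. \<Sum>k<n. a m * a k * ip (u m) (u k))"
proof -
  let ?s = "\<lambda>i. \<Sum>m<n. a m * u m i"
  have "ip ?s ?s = (\<Sum>k<n. a k * ip ?s (u k))"
    using assms by (intro ip_sum_right finsupp_summable_mult) auto
  also have "\<dots> = (\<Sum>k<n. a k * (\<Sum>m<n. a m * ip (u k) (u m)))"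
    unfolding ip_commute[of ?s] using assms
    by (intro sum.cong refl arg_cong[where f = "(*) _"] ip_sum_right finsupp_summable_mult) auto
  also have "\<dots> = (\<Sum>m<n. \<Sum>k<n. a m * a k * ip (u m) (u k))"
    by (simp add: sum_distrib_left mult.assoc)
  finally show ?thesis .
qed

lemma b_one: "b \<one> i = 0"
proof -
  have "ip (b \<one>) (b \<one>) = 0" by (simp add: ip_b psi_diag)
  then show ?thesis using ip_self_zero[OF finsupp_l2[OF b_finsupp]] by simp
qed

text \<open>The vectors \<open>b (g \<otimes> x) - b g\<close> and \<open>b x\<close> have the same Gram matrix, because \<open>\<psi>\<close> is left invariant. This is
the isometry of the linear action before the action itself is available.\<close>

lemma ip_shifted_combination:
  fixes n :: nat
  assumes g: "g \<in> carrier G" and x: "\<And>m. m < n \<Longrightarrow> x m \<in> carrier G"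
  shows "ip (\<lambda>i. \<Sum>m<n. a m * (b (g \<otimes> x m) i - b g i)) (\<lambda>i. \<Sum>m<n. a m * (b (g \<otimes> x m) i - b g i)) =
    ip (\<lambda>i. \<Sum>m<n. a m * b (x m) i) (\<lambda>i. \<Sum>m<n. a m * b (x m) i)"
proof -
  have "ip (\<lambda>i. b (g \<otimes> x m) i - b g i) (\<lambda>i. b (g \<otimes> x k) i - b g i) = ip (b (x m)) (b (x k))"
    if "m < n" "k < n" for m k
    using g x[OF that(1)] x[OF that(2)] psi_left[of g "x m" \<one>] psi_left[of g \<one> "x k"]
    by (simp add: ip_b_diff ip_b psi_left psi_diag)
  then show ?thesis
    using g x by (subst (1 2) ip_combination) (auto intro!: finsupp_diff b_finsupp)
qed

text \<open>Linear relations between the vectors \<open>b x\<close> persist for the vectors \<open>b (g \<otimes> x) - b g\<close>, since the norm of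
the defect is the same. Hence \<open>b x \<mapsto> b (g \<otimes> x) - b g\<close> has a linear extension.\<close>

lemma shifted_relation:
  fixes n :: nat
  assumes g: "g \<in> carrier G" and x: "\<And>m. m < n \<Longrightarrow> x m \<in> carrier G" and h: "h \<in> carrier G"
    and rel: "\<And>i. b h i = (\<Sum>m<n. a m * b (x m) i)"
  shows "b (g \<otimes> h) i - b g i = (\<Sum>m<n. a m * (b (g \<otimes> x m) i - b g i))"
proof -
  \<comment> \<open>Move \<open>b h\<close> to the other side of the relation, as a term with coefficient -1.\<close>
  define y where "y m = (if m < n then x m else h)" for m
  define c where "c m = (if m < n then a m else - 1)" for m
  have split: "(\<Sum>m<Suc n. c m * f (y m)) = (\<Sum>m<n. a m * f (x m)) - f h" for f
  proof -
    have "(\<Sum>m<n. c m * f (y m)) = (\<Sum>m<n. a m * f (x m))"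
      by (rule sum.cong) (simp_all add: c_def y_def)
    then show ?thesis by (simp add: c_def y_def)
  qed
  have y: "y m \<in> carrier G" if "m < Suc n" for m
    unfolding y_def by (rule if_split[THEN iffD2]) (blast intro: x h)
  let ?s = "\<lambda>i. \<Sum>m<Suc n. c m * (b (g \<otimes> y m) i - b g i)"
  have "ip ?s ?s = ip (\<lambda>i. \<Sum>m<Suc n. c m * b (y m) i) (\<lambda>i. \<Sum>m<Suc n. c m * b (y m) i)"
    by (intro ip_shifted_combination g y)
  also have "\<dots> = ip (\<lambda>i. 0) (\<lambda>i. 0)"
    unfolding split[of "\<lambda>z. b z _"] rel by (simp only: diff_self)
  finally have "ip ?s ?s = 0" by (simp add: ip_def)
  moreover have "?s \<in> finsupp"
    by (intro finsupp_sum finsupp_scale finsupp_diff b_finsupp m_closed g y) simp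
  ultimately have "?s i = 0" using ip_self_zero[of ?s i, OF finsupp_l2] by blast
  then show ?thesis unfolding split[of "\<lambda>z. b (g \<otimes> z) i - b g i"] by simp
qed

lemma finsupp_span:
  assumes v: "\<And>i. i \<ge> n \<Longrightarrow> v i = 0" "\<And>i. i \<notin> I \<Longrightarrow> v i = 0"
  obtains c where "\<And>j. v j = (\<Sum>m<n. c m * b (\<gamma> m) j)"
proof
  fix j
  have row: "v i * (\<Sum>m<n. T i m * b (\<gamma> m) j) = v i * of_bool (j = i)" if "i < n" for i
  proof (cases "i \<in> I")
    case True
    have "(\<Sum>m<n. T i m * b (\<gamma> m) j) = (\<Sum>m\<le>i. T i m * b (\<gamma> m) j)"
      using that T_triangular by (intro sum.mono_neutral_right) auto
    then show ?thesis using T_inverse[OF True] by simp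
  qed (simp add: v)
  have "v j = (\<Sum>i<n. v i * of_bool (j = i))"
    using v(1)[of j] by (simp add: of_bool_def if_distrib[of "(*) _"] cong: if_cong)
  also have "\<dots> = (\<Sum>i<n. \<Sum>m<n. v i * T i m * b (\<gamma> m) j)"
    using row by (simp add: sum_distrib_left mult.assoc)
  also have "\<dots> = (\<Sum>m<n. (\<Sum>i<n. v i * T i m) * b (\<gamma> m) j)"
    unfolding sum_distrib_right by (rule sum.swap)
  finally show "v j = (\<Sum>m<n. (\<Sum>i<n. v i * T i m) * b (\<gamma> m) j)" .
qed

text \<open>The linear part of the action. It is defined through its adjoint: the inner product of the image of \<open>v\<close>
with \<open>b h\<close> must be the inner product of \<open>v\<close> with \<open>b (inv g \<otimes> h) - b (inv g)\<close>, and the rows of \<open>T\<close>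
recover coordinates from such inner products. Every coordinate of the image depends on finitely many
coordinates of \<open>v\<close>, so no extension by continuity is involved.\<close>

definition rep :: "'g \<Rightarrow> (nat \<Rightarrow> real) \<Rightarrow> nat \<Rightarrow> real"
  where "rep g v i = (if i \<in> I
    then \<Sum>m\<le>i. T i m * (ip v (b (inv g \<otimes> \<gamma> m)) - ip v (b (inv g))) else 0)"

text \<open>A sequence supported in \<open>I\<close> is determined by its inner products with the vectors \<open>b h\<close>. Identities for
\<open>rep\<close> are proved by comparing these inner products.\<close>

lemma coordinate_eq:
  assumes "\<And>j. j \<notin> I \<Longrightarrow> v j = 0"
  shows "v i = (if i \<in> I then \<Sum>m\<le>i. T i m * ip v (b (\<gamma> m)) else 0)"
proof (cases "i \<in> I")
  case True
  have "(\<Sum>m\<le>i. T i m * ip v (b (\<gamma> m))) = ip v (\<lambda>j. \<Sum>m\<le>i. T i m * b (\<gamma> m) j)"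
    by (intro ip_sum_right[symmetric] summable_b gamma_closed)
  also have "\<dots> = ip v (\<lambda>j. of_bool (j = i))" by (simp add: T_inverse[OF True])
  also have "\<dots> = v i"
    by (subst ip_eq_sum[where n = "Suc i"])
       (auto simp: of_bool_def if_distrib[of "(*) _"] cong: if_cong)
  finally show ?thesis using True by simp
qed (simp add: assms)

lemma vector_eqI:
  assumes "\<And>j. j \<notin> I \<Longrightarrow> v j = 0" "\<And>j. j \<notin> I \<Longrightarrow> w j = 0"
    and "\<And>h. h \<in> carrier G \<Longrightarrow> ip v (b h) = ip w (b h)"
  shows "v = w"
  using coordinate_eq[of v] coordinate_eq[of w] assms by (auto simp: fun_eq_iff)

lemma rep_supp: "j \<notin> I \<Longrightarrow> rep g v j = 0"
  by (simp add: rep_def)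

text \<open>The defining adjointness, which \<open>rep\<close> satisfies by construction only for the combinations encoded in \<open>T\<close>.
Writing \<open>b h\<close> as a combination of the vectors \<open>b (\<gamma> m)\<close> reduces the claim to \<open>shifted_relation\<close>.\<close>

lemma ip_rep:
  assumes g: "g \<in> carrier G" and h: "h \<in> carrier G"
  shows "ip (rep g v) (b h) = ip v (b (inv g \<otimes> h)) - ip v (b (inv g))"
proof -
  obtain n where n: "\<And>i. i \<ge> n \<Longrightarrow> b h i = 0" using b_finsupp[OF h] by (auto simp: finsupp_def)
  define D where "D x = (\<lambda>i. b (inv g \<otimes> x) i - b (inv g) i)" for x
  have ipD: "ip v (D x) = ip v (b (inv g \<otimes> x)) - ip v (b (inv g))" if "x \<in> carrier G" for x
    unfolding D_def using g that by (intro ip_diff_right summable_b) auto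
  have sD: "summable (\<lambda>i. v i * D x i)" if "x \<in> carrier G" for x
    unfolding D_def using g that by (intro finsupp_summable_mult finsupp_diff b_finsupp) auto
  \<comment> \<open>Expand \<open>b h\<close> in standard basis vectors and these in the vectors \<open>b (\<gamma> m)\<close>.\<close>
  define c where "c m = (\<Sum>i<n. b h i * T i m)" for m
  have row: "b h i * (\<Sum>m<n. T i m * f m) = b h i * (\<Sum>m\<le>i. T i m * f m)" if "i < n" for i f
  proof -
    have "(\<Sum>m<n. T i m * f m) = (\<Sum>m\<le>i. T i m * f m)"
      using that T_triangular by (intro sum.mono_neutral_right) auto
    then show ?thesis by simp
  qed
  have swap: "(\<Sum>m<n. c m * f m) = (\<Sum>i<n. b h i * (\<Sum>m\<le>i. T i m * f m))" for f
  proof -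
    have "(\<Sum>m<n. c m * f m) = (\<Sum>m<n. \<Sum>i<n. b h i * (T i m * f m))"
      by (simp add: c_def sum_distrib_right mult.assoc)
    also have "\<dots> = (\<Sum>i<n. b h i * (\<Sum>m<n. T i m * f m))"
      unfolding sum_distrib_left by (rule sum.swap)
    finally show ?thesis using row by simp
  qed
  have bh: "b h j = (\<Sum>m<n. c m * b (\<gamma> m) j)" for j
  proof -
    have "(\<Sum>m<n. c m * b (\<gamma> m) j) = (\<Sum>i<n. b h i * of_bool (j = i))"
      unfolding swap
    proof (rule sum.cong[OF refl])
      show "b h i * (\<Sum>m\<le>i. T i m * b (\<gamma> m) j) = b h i * of_bool (j = i)" for i
        by (cases "i \<in> I") (simp_all add: T_inverse b_supp[OF h])
    qed
    also have "\<dots> = b h j"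
      using n[of j] by (simp add: of_bool_def if_distrib[of "(*) _"] cong: if_cong)
    finally show ?thesis by simp
  qed
  have "ip (rep g v) (b h) = (\<Sum>i<n. rep g v i * b h i)" using n by (rule ip_eq_sum)
  also have "\<dots> = (\<Sum>i<n. b h i * (\<Sum>m\<le>i. T i m * ip v (D (\<gamma> m))))"
    by (intro sum.cong refl) (auto simp: rep_def ipD b_supp[OF h])
  also have "\<dots> = (\<Sum>m<n. c m * ip v (D (\<gamma> m)))" by (rule swap[symmetric])
  also have "\<dots> = ip v (\<lambda>i. \<Sum>m<n. c m * D (\<gamma> m) i)"
    by (intro ip_sum_right[symmetric] sD gamma_closed)
  also have "(\<lambda>i. \<Sum>m<n. c m * D (\<gamma> m) i) = D h"
    using shifted_relation[OF _ _ h bh, of "inv g"] g by (simp add: D_def fun_eq_iff)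
  finally show ?thesis using ipD[OF h] by simp
qed

lemma rep_mult:
  assumes g: "g \<in> carrier G" and h: "h \<in> carrier G"
  shows "rep (g \<otimes> h) v = rep g (rep h v)"
proof (rule vector_eqI)
  fix k assume k: "k \<in> carrier G"
  show "ip (rep (g \<otimes> h) v) (b k) = ip (rep g (rep h v)) (b k)"
    using g h k by (simp add: ip_rep inv_mult_group m_assoc)
qed (auto simp: rep_supp)

lemma rep_one:
  assumes "\<And>j. j \<notin> I \<Longrightarrow> v j = 0"
  shows "rep \<one> v = v"
proof (rule vector_eqI)
  fix k assume k: "k \<in> carrier G"
  have "ip v (b \<one>) = 0" by (simp add: ip_def b_one)
  then show "ip (rep \<one> v) (b k) = ip v (b k)" using k by (simp add: ip_rep)
qed (use assms in \<open>auto simp: rep_supp\<close>)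

lemma rep_inv:
  assumes "g \<in> carrier G" "\<And>j. j \<notin> I \<Longrightarrow> v j = 0"
  shows "rep (inv g) (rep g v) = v" "rep g (rep (inv g) v) = v"
  using assms rep_mult[of "inv g" g v] rep_mult[of g "inv g" v] rep_one[of v] by auto

lemma rep_b:
  assumes g: "g \<in> carrier G" and h: "h \<in> carrier G"
  shows "rep g (b h) = (\<lambda>i. b (g \<otimes> h) i - b g i)"
proof (rule vector_eqI)
  fix k assume k: "k \<in> carrier G"
  have "ip (\<lambda>i. b (g \<otimes> h) i - b g i) (b k) = ip (b (g \<otimes> h)) (b k) - ip (b g) (b k)"
    unfolding ip_commute[of _ "b k"] using g h by (intro ip_diff_right summable_b) auto
  moreover have "\<psi> (g \<otimes> h) k = \<psi> h (inv g \<otimes> k)" "\<psi> g k = \<psi> \<one> (inv g \<otimes> k)" "\<psi> (g \<otimes> h) g = \<psi> h \<one>"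
    "\<psi> (inv g) \<one> = \<psi> \<one> g"  "\<psi> h (inv g) = \<psi> (g \<otimes> h) \<one>"
    using g h k psi_left[of "inv g" "g \<otimes> h" k] psi_left[of "inv g" g k] psi_left[of g h \<one>]
      psi_left[of g "inv g" \<one>] psi_left[of g h "inv g"]
    by (simp_all flip: m_assoc)
  ultimately show "ip (rep g (b h)) (b k) = ip (\<lambda>i. b (g \<otimes> h) i - b g i) (b k)"
    using g h k psi_sym by (simp add: ip_rep ip_b psi_diag field_simps)
qed (use assms in \<open>auto simp: rep_supp b_supp\<close>)

lemma rep_linear:
  assumes g: "g \<in> carrier G"
  shows "rep g (\<lambda>i. v i + w i) i = rep g v i + rep g w i"
    and "rep g (\<lambda>i. a * v i) i = a * rep g v i"
proof -
  have add: "ip (\<lambda>i. v i + w i) (b x) = ip v (b x) + ip w (b x)" if "x \<in> carrier G" for x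
    unfolding ip_commute[of _ "b x"] using summable_b[OF that]
    by (intro ip_add_right) (simp_all add: mult.commute)
  have scale: "ip (\<lambda>i. a * v i) (b x) = a * ip v (b x)" if "x \<in> carrier G" for x
    unfolding ip_commute[of _ "b x"] using summable_b[OF that]
    by (intro ip_scale_right) (simp_all add: mult.commute)
  show "rep g (\<lambda>i. v i + w i) i = rep g v i + rep g w i"
    using g by (simp add: rep_def add algebra_simps flip: sum.distrib)
  show "rep g (\<lambda>i. a * v i) i = a * rep g v i"
    using g by (simp add: rep_def scale sum_distrib_left algebra_simps)
qed

text \<open>Test an initial segment \<open>x\<close> of the image against the image itself: with the isometry on finite
combinations this equals the inner product of \<open>v\<close> with a vector \<open>u\<close> of the same norm as \<open>x\<close>, and
\<open>0 \<le> \<parallel>v - u\<parallel>\<^sup>2\<close> is the desired bound.\<close>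

lemma rep_contraction:
  assumes g: "g \<in> carrier G" and v: "v \<in> l2"
  shows "rep g v \<in> l2" "ip (rep g v) (rep g v) \<le> ip v v"
proof -
  have "(\<Sum>i<n. (rep g v i)\<^sup>2) \<le> ip v v" for n
  proof -
    define x where "x i = (if i < n then rep g v i else 0)" for i
    have "x i = 0" if "i \<ge> n" for i using that by (simp add: x_def)
    moreover have "x i = 0" if "i \<notin> I" for i using that by (simp add: x_def rep_supp)
    ultimately obtain c where c: "\<And>j. x j = (\<Sum>m<n. c m * b (\<gamma> m) j)"
      using finsupp_span by blast
    then have xc: "x = (\<lambda>j. \<Sum>m<n. c m * b (\<gamma> m) j)" by (simp add: fun_eq_iff)
    define u where "u = (\<lambda>i. \<Sum>m<n. c m * (b (inv g \<otimes> \<gamma> m) i - b (inv g) i))"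
    have D: "(\<lambda>i. b (inv g \<otimes> \<gamma> m) i - b (inv g) i) \<in> finsupp" for m
      using g by (intro finsupp_diff b_finsupp) auto
    then have u: "u \<in> finsupp" unfolding u_def by (intro finsupp_sum finsupp_scale)
    have S: "ip w x = (\<Sum>i<n. w i * rep g v i)" for w
      by (subst ip_eq_sum[where n = n]) (auto simp: x_def)
    have "ip u u = ip x x"
      unfolding u_def xc using g by (intro ip_shifted_combination) auto
    also have "\<dots> = (\<Sum>i<n. (rep g v i)\<^sup>2)" unfolding S by (simp add: x_def power2_eq_square)
    finally have uu: "ip u u = (\<Sum>i<n. (rep g v i)\<^sup>2)" .
    have "(\<Sum>i<n. (rep g v i)\<^sup>2) = ip (rep g v) x" by (simp add: S power2_eq_square)
    also have "\<dots> = (\<Sum>m<n. c m * ip (rep g v) (b (\<gamma> m)))"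
      unfolding xc by (intro ip_sum_right summable_b) simp
    also have "\<dots> = (\<Sum>m<n. c m * ip v (\<lambda>i. b (inv g \<otimes> \<gamma> m) i - b (inv g) i))"
    proof (intro sum.cong refl)
      fix m
      have "ip v (\<lambda>i. b (inv g \<otimes> \<gamma> m) i - b (inv g) i) = ip v (b (inv g \<otimes> \<gamma> m)) - ip v (b (inv g))"
        using g by (intro ip_diff_right summable_b) auto
      then show "c m * ip (rep g v) (b (\<gamma> m)) = c m * ip v (\<lambda>i. b (inv g \<otimes> \<gamma> m) i - b (inv g) i)"
        using g by (simp add: ip_rep)
    qed
    also have "\<dots> = ip v u"
      unfolding u_def by (intro ip_sum_right[symmetric] finsupp_summable_mult D)
    finally have vu: "ip v u = (\<Sum>i<n. (rep g v i)\<^sup>2)" ..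
    have "0 \<le> ip (\<lambda>i. v i - u i) (\<lambda>i. v i - u i)"
      by (intro ip_self_nonneg l2_diff v finsupp_l2[OF u])
    then show ?thesis by (simp add: ip_diff_self[OF v finsupp_l2[OF u]] uu vu)
  qed
  from l2_bounded[OF this] show "rep g v \<in> l2" "ip (rep g v) (rep g v) \<le> ip v v" by blast+
qed

text \<open>A contraction whose inverse is a contraction.\<close>

lemma rep_isometry:
  assumes g: "g \<in> carrier G" and v: "v \<in> l2" "\<And>j. j \<notin> I \<Longrightarrow> v j = 0"
  shows "ip (rep g v) (rep g v) = ip v v"
proof (rule antisym)
  show "ip (rep g v) (rep g v) \<le> ip v v" by (rule rep_contraction(2)[OF g v(1)])
  have "rep (inv g) (rep g v) = v" using v(2) by (rule rep_inv(1)[OF g])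
  with rep_contraction(2)[OF inv_closed[OF g] rep_contraction(1)[OF g v(1)]]
  show "ip v v \<le> ip (rep g v) (rep g v)" by (simp only:)
qed

lemma rep_ip:
  assumes g: "g \<in> carrier G" and v: "v \<in> l2" "\<And>j. j \<notin> I \<Longrightarrow> v j = 0"
    and w: "w \<in> l2" "\<And>j. j \<notin> I \<Longrightarrow> w j = 0"
  shows "ip (rep g v) (rep g w) = ip v w"
proof -
  have "ip (rep g (\<lambda>i. v i + w i)) (rep g (\<lambda>i. v i + w i)) = ip (\<lambda>i. v i + w i) (\<lambda>i. v i + w i)"
    using v w by (intro rep_isometry g l2_add) auto
  also have "rep g (\<lambda>i. v i + w i) = (\<lambda>i. rep g v i + rep g w i)"
    by (rule ext) (rule rep_linear(1)[OF g])
  finally have "ip (rep g v) (rep g v) + 2 * ip (rep g v) (rep g w) + ip (rep g w) (rep g w) =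
      ip v v + 2 * ip v w + ip w w"
    using rep_contraction(1)[OF g v(1)] rep_contraction(1)[OF g w(1)] v(1) w(1)
    by (simp only: ip_add_self)
  moreover have "ip (rep g v) (rep g v) = ip v v" "ip (rep g w) (rep g w) = ip w w"
    using rep_isometry[OF g] v w by auto
  ultimately show ?thesis by simp
qed

end

section \<open>The complex Hilbert space\<close>

definition l2_norm :: "(nat \<Rightarrow> real) \<Rightarrow> real"
  where "l2_norm v = sqrt (ip v v)"

lemma l2_norm_nonneg: "v \<in> l2 \<Longrightarrow> 0 \<le> l2_norm v"
  by (simp add: l2_norm_def ip_self_nonneg)

lemma l2_norm_power2: "v \<in> l2 \<Longrightarrow> (l2_norm v)\<^sup>2 = ip v v"
  by (simp add: l2_norm_def ip_self_nonneg)

lemma l2_norm_triangle: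
  assumes v: "v \<in> l2" and w: "w \<in> l2"
  shows "l2_norm (\<lambda>i. v i + w i) \<le> l2_norm v + l2_norm w"
proof -
  have part: "L2_set u {..<n} \<le> l2_norm u" if "u \<in> l2" for u n
    unfolding L2_set_def l2_norm_def using sum_sq_le_ip[OF that] by simp
  have "(\<Sum>i<n. (v i + w i)\<^sup>2) \<le> (l2_norm v + l2_norm w)\<^sup>2" for n
  proof -
    have "L2_set (\<lambda>i. v i + w i) {..<n} \<le> l2_norm v + l2_norm w"
      using L2_set_triangle_ineq[of v w "{..<n}"] part[OF v, of n] part[OF w, of n] by linarith
    then have "(L2_set (\<lambda>i. v i + w i) {..<n})\<^sup>2 \<le> (l2_norm v + l2_norm w)\<^sup>2"
      by (intro power_mono L2_set_nonneg)
    then show ?thesis by (simp add: L2_set_def sum_nonneg)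
  qed
  then have "ip (\<lambda>i. v i + w i) (\<lambda>i. v i + w i) \<le> (l2_norm v + l2_norm w)\<^sup>2" by (rule l2_bounded(2))
  then show ?thesis
    unfolding l2_norm_def[of "\<lambda>i. v i + w i"] using l2_norm_nonneg[OF v] l2_norm_nonneg[OF w]
    by (intro real_le_lsqrt) auto
qed

lemma l2_norm_triangle_diff:
  assumes "u \<in> l2" "v \<in> l2" "w \<in> l2"
  shows "l2_norm (\<lambda>i. u i - w i) \<le> l2_norm (\<lambda>i. u i - v i) + l2_norm (\<lambda>i. v i - w i)"
  using l2_norm_triangle[of "\<lambda>i. u i - v i" "\<lambda>i. v i - w i"] assms by (simp add: l2_diff)

lemma l2_norm_minus_commute: "l2_norm (\<lambda>i. v i - w i) = l2_norm (\<lambda>i. w i - v i)"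
proof -
  have "(\<lambda>i. (v i - w i) * (v i - w i)) = (\<lambda>i. (w i - v i) * (w i - v i))"
    by (simp add: fun_eq_iff algebra_simps)
  then show ?thesis by (simp add: l2_norm_def ip_def)
qed

text \<open>Unitary representations are complex, whereas all the kernels are real. The complex space is therefore
assembled from real and imaginary parts in the real space.\<close>

definition l2_space :: "nat set \<Rightarrow> (nat \<Rightarrow> complex) cinner_space"
  where "l2_space I =
    \<lparr>carrier = {v. (\<forall>i. i \<notin> I \<longrightarrow> v i = 0) \<and> (\<lambda>i. Re (v i)) \<in> l2 \<and> (\<lambda>i. Im (v i)) \<in> l2},
     mult = undefined, one = undefined,
     ring.zero = (\<lambda>i. 0), add = (\<lambda>v w i. v i + w i), smult = (\<lambda>a v i. a * v i),
     cinner = (\<lambda>v w. Complex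
       (ip (\<lambda>i. Re (v i)) (\<lambda>i. Re (w i)) + ip (\<lambda>i. Im (v i)) (\<lambda>i. Im (w i)))
       (ip (\<lambda>i. Im (v i)) (\<lambda>i. Re (w i)) - ip (\<lambda>i. Re (v i)) (\<lambda>i. Im (w i))))\<rparr>"

lemma l2_space_carrier:
  "v \<in> carrier (l2_space I) \<longleftrightarrow>
    (\<forall>i. i \<notin> I \<longrightarrow> v i = 0) \<and> (\<lambda>i. Re (v i)) \<in> l2 \<and> (\<lambda>i. Im (v i)) \<in> l2"
  by (simp add: l2_space_def)

lemma l2_space_ops:
  "v \<oplus>\<^bsub>l2_space I\<^esub> w = (\<lambda>i. v i + w i)"
  "\<zero>\<^bsub>l2_space I\<^esub> = (\<lambda>i. 0)"
  "a \<odot>\<^bsub>l2_space I\<^esub> v = (\<lambda>i. a * v i)"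
  by (simp_all add: l2_space_def)

lemma Re_cinner_l2_space:
  "Re (cinner (l2_space I) v w) = ip (\<lambda>i. Re (v i)) (\<lambda>i. Re (w i)) + ip (\<lambda>i. Im (v i)) (\<lambda>i. Im (w i))"
  by (simp add: l2_space_def)

lemma Im_cinner_l2_space:
  "Im (cinner (l2_space I) v w) = ip (\<lambda>i. Im (v i)) (\<lambda>i. Re (w i)) - ip (\<lambda>i. Re (v i)) (\<lambda>i. Im (w i))"
  by (simp add: l2_space_def)

lemma l2_space_smult_closed:
  assumes "v \<in> carrier (l2_space I)"
  shows "(\<lambda>i. a * v i) \<in> carrier (l2_space I)"
  using assms by (auto simp: l2_space_carrier intro!: l2_add l2_diff l2_scale)

lemma l2_space_abelian_group: "abelian_group (l2_space I)"
proof (rule abelian_groupI)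
  fix v assume v: "v \<in> carrier (l2_space I)"
  show "\<exists>w\<in>carrier (l2_space I). w \<oplus>\<^bsub>l2_space I\<^esub> v = \<zero>\<^bsub>l2_space I\<^esub>"
    using l2_space_smult_closed[OF v, of "-1"]
    by (intro bexI[of _ "\<lambda>i. - 1 * v i"]) (simp_all add: l2_space_ops)
qed (auto simp: l2_space_ops l2_space_carrier l2_zero l2_add add_ac)

lemma l2_space_minus:
  assumes "v \<in> carrier (l2_space I)" "w \<in> carrier (l2_space I)"
  shows "v \<ominus>\<^bsub>l2_space I\<^esub> w = (\<lambda>i. v i - w i)"
proof -
  interpret abelian_group "l2_space I" by (rule l2_space_abelian_group)
  have "(\<lambda>i. - 1 * w i) \<in> carrier (l2_space I)" by (rule l2_space_smult_closed[OF assms(2)])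
  then have "\<ominus>\<^bsub>l2_space I\<^esub> w = (\<lambda>i. - 1 * w i)"
    using assms by (intro minus_equality) (simp_all add: l2_space_ops)
  then show ?thesis by (simp add: a_minus_def l2_space_ops)
qed

lemma l2_space_dist:
  assumes "v \<in> carrier (l2_space I)" "w \<in> carrier (l2_space I)"
  shows "cinner_dist (l2_space I) v w =
    sqrt ((l2_norm (\<lambda>i. Re (v i) - Re (w i)))\<^sup>2 + (l2_norm (\<lambda>i. Im (v i) - Im (w i)))\<^sup>2)"
proof -
  have "(\<lambda>i. Re (v i) - Re (w i)) \<in> l2" "(\<lambda>i. Im (v i) - Im (w i)) \<in> l2"
    using assms by (auto simp: l2_space_carrier intro: l2_diff)
  then show ?thesis
    using assms by (simp add: cinner_dist_def l2_space_minus Re_cinner_l2_space l2_norm_power2)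
qed

lemma l2_space_Metric_space:
  "Metric_space (carrier (l2_space I)) (cinner_dist (l2_space I))"
proof
  fix v w
  show "0 \<le> cinner_dist (l2_space I) v w"
  proof (cases "v \<in> carrier (l2_space I) \<and> w \<in> carrier (l2_space I)")
    case True
    then show ?thesis by (simp add: l2_space_dist)
  qed (auto simp: cinner_dist_def)
  show "cinner_dist (l2_space I) v w = cinner_dist (l2_space I) w v"
  proof (cases "v \<in> carrier (l2_space I) \<and> w \<in> carrier (l2_space I)")
    case True
    then show ?thesis
      by (simp add: l2_space_dist l2_norm_minus_commute[of "\<lambda>i. Re (v i)"] l2_norm_minus_commute[of "\<lambda>i. Im (v i)"])
  qed (auto simp: cinner_dist_def)
next
  fix v w assume vw: "v \<in> carrier (l2_space I)" "w \<in> carrier (l2_space I)"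
  then have l2: "(\<lambda>i. Re (v i) - Re (w i)) \<in> l2" "(\<lambda>i. Im (v i) - Im (w i)) \<in> l2"
    by (auto simp: l2_space_carrier intro: l2_diff)
  show "cinner_dist (l2_space I) v w = 0 \<longleftrightarrow> v = w"
  proof
    assume "cinner_dist (l2_space I) v w = 0"
    then have "l2_norm (\<lambda>i. Re (v i) - Re (w i)) = 0" "l2_norm (\<lambda>i. Im (v i) - Im (w i)) = 0"
      by (simp_all add: l2_space_dist[OF vw] sum_power2_eq_zero_iff)
    then have "Re (v i) - Re (w i) = 0" "Im (v i) - Im (w i) = 0" for i
      using ip_self_zero[OF l2(1), of i] ip_self_zero[OF l2(2), of i]
      by (simp_all add: l2_norm_def)
    then show "v = w" by (simp add: fun_eq_iff complex_eq_iff)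
  next
    assume "v = w"
    then show "cinner_dist (l2_space I) v w = 0"
      using vw by (simp add: l2_space_dist l2_norm_def ip_def)
  qed
  fix u assume u: "u \<in> carrier (l2_space I)"
  let ?r = "\<lambda>x y. l2_norm (\<lambda>i. Re (x i) - Re (y i))" and ?m = "\<lambda>x y. l2_norm (\<lambda>i. Im (x i) - Im (y i))"
  have "cinner_dist (l2_space I) v u \<le> sqrt ((?r v w + ?r w u)\<^sup>2 + (?m v w + ?m w u)\<^sup>2)"
    unfolding l2_space_dist[OF vw(1) u] using vw u
    by (intro real_sqrt_le_mono add_mono power_mono l2_norm_triangle_diff l2_norm_nonneg)
       (auto simp: l2_space_carrier intro: l2_diff)
  also have "\<dots> \<le> cinner_dist (l2_space I) v w + cinner_dist (l2_space I) w u"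
    unfolding l2_space_dist[OF vw] l2_space_dist[OF vw(2) u]
    by (rule real_sqrt_sum_squares_triangle_ineq)
  finally show "cinner_dist (l2_space I) v u \<le>
      cinner_dist (l2_space I) v w + cinner_dist (l2_space I) w u" .
qed

text \<open>Cauchy sequences have Cauchy real and imaginary parts, and the real sequences are complete by
\<open>l2_complete\<close>. Coordinates outside \<open>I\<close> vanish in the limit.\<close>

lemma l2_space_mcomplete:
  "Metric_space.mcomplete (carrier (l2_space I)) (cinner_dist (l2_space I))"
proof -
  interpret Metric_space "carrier (l2_space I)" "cinner_dist (l2_space I)"
    by (rule l2_space_Metric_space)
  show ?thesis
    unfolding mcomplete_def
  proof (intro allI impI)
    fix \<sigma> assume \<sigma>: "MCauchy \<sigma>"
    then have c: "\<sigma> n \<in> carrier (l2_space I)" for n by (auto simp: MCauchy_def)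
    have part: "\<exists>y. y \<in> l2 \<and> (\<forall>i. (\<lambda>n. f (\<sigma> n i)) \<longlonglongrightarrow> y i) \<and>
        (\<lambda>n. ip (\<lambda>i. f (\<sigma> n i) - y i) (\<lambda>i. f (\<sigma> n i) - y i)) \<longlonglongrightarrow> 0"
      if l2: "\<And>n. (\<lambda>i. f (\<sigma> n i)) \<in> l2"
        and le: "\<And>m n. l2_norm (\<lambda>i. f (\<sigma> n i) - f (\<sigma> m i)) \<le> cinner_dist (l2_space I) (\<sigma> n) (\<sigma> m)"
      for f :: "complex \<Rightarrow> real"
    proof -
      have "\<exists>N. \<forall>m\<ge>N. \<forall>n\<ge>N. ip (\<lambda>i. f (\<sigma> n i) - f (\<sigma> m i)) (\<lambda>i. f (\<sigma> n i) - f (\<sigma> m i)) \<le> \<epsilon>"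
        if \<epsilon>: "0 < \<epsilon>" for \<epsilon>
      proof -
        obtain N where N: "\<And>n n'. N \<le> n \<Longrightarrow> N \<le> n' \<Longrightarrow> cinner_dist (l2_space I) (\<sigma> n) (\<sigma> n') < sqrt \<epsilon>"
          using \<sigma> real_sqrt_gt_zero[OF \<epsilon>] unfolding MCauchy_def by blast
        have "ip (\<lambda>i. f (\<sigma> n i) - f (\<sigma> m i)) (\<lambda>i. f (\<sigma> n i) - f (\<sigma> m i)) \<le> \<epsilon>" if "m \<ge> N" "n \<ge> N" for m n
        proof -
          have "l2_norm (\<lambda>i. f (\<sigma> n i) - f (\<sigma> m i)) \<le> sqrt \<epsilon>"
            using le[of n m] N[OF that(2,1)] by linarith
          then show ?thesis by (simp add: l2_norm_def)
        qed
        then show ?thesis by blast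
      qed
      from l2_complete[of "\<lambda>n i. f (\<sigma> n i)", OF l2 this] show ?thesis by blast
    qed
    obtain a where a: "a \<in> l2" "\<And>i. (\<lambda>n. Re (\<sigma> n i)) \<longlonglongrightarrow> a i"
      "(\<lambda>n. ip (\<lambda>i. Re (\<sigma> n i) - a i) (\<lambda>i. Re (\<sigma> n i) - a i)) \<longlonglongrightarrow> 0"
    proof -
      have "(\<lambda>i. Re (\<sigma> n i)) \<in> l2" for n using c[of n] by (simp add: l2_space_carrier)
      moreover have "l2_norm (\<lambda>i. Re (\<sigma> n i) - Re (\<sigma> m i)) \<le> cinner_dist (l2_space I) (\<sigma> n) (\<sigma> m)" for m n
        unfolding l2_space_dist[OF c c] by (rule real_sqrt_sum_squares_ge1)
      ultimately show ?thesis using part[of Re] that by blast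
    qed
    obtain b where b: "b \<in> l2" "\<And>i. (\<lambda>n. Im (\<sigma> n i)) \<longlonglongrightarrow> b i"
      "(\<lambda>n. ip (\<lambda>i. Im (\<sigma> n i) - b i) (\<lambda>i. Im (\<sigma> n i) - b i)) \<longlonglongrightarrow> 0"
    proof -
      have "(\<lambda>i. Im (\<sigma> n i)) \<in> l2" for n using c[of n] by (simp add: l2_space_carrier)
      moreover have "l2_norm (\<lambda>i. Im (\<sigma> n i) - Im (\<sigma> m i)) \<le> cinner_dist (l2_space I) (\<sigma> n) (\<sigma> m)" for m n
        unfolding l2_space_dist[OF c c] by (rule real_sqrt_sum_squares_ge2)
      ultimately show ?thesis using part[of Im] that by blast
    qed
    define y where "y i = Complex (a i) (b i)" for i
    have "y i = 0" if "i \<notin> I" for i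
    proof -
      have "(\<lambda>n. Re (\<sigma> n i)) = (\<lambda>n. 0)" "(\<lambda>n. Im (\<sigma> n i)) = (\<lambda>n. 0)"
        using c that by (auto simp: l2_space_carrier)
      then have "a i = 0" "b i = 0"
        using a(2)[of i] b(2)[of i] by (simp_all add: LIMSEQ_const_iff)
      then show ?thesis by (simp add: y_def complex_eq_iff)
    qed
    then have y: "y \<in> carrier (l2_space I)" using a(1) b(1) by (simp add: l2_space_carrier y_def)
    have "(\<lambda>n. cinner_dist (l2_space I) (\<sigma> n) y) =
        (\<lambda>n. sqrt (ip (\<lambda>i. Re (\<sigma> n i) - a i) (\<lambda>i. Re (\<sigma> n i) - a i)
          + ip (\<lambda>i. Im (\<sigma> n i) - b i) (\<lambda>i. Im (\<sigma> n i) - b i)))"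
      unfolding l2_space_dist[OF c y] using c a(1) b(1)
      by (simp add: y_def l2_norm_power2 l2_diff l2_space_carrier)
    also have "\<dots> \<longlonglongrightarrow> sqrt (0 + 0)" by (intro tendsto_intros a b)
    finally have lim: "(\<lambda>n. cinner_dist (l2_space I) (\<sigma> n) y) \<longlonglongrightarrow> 0" by simp
    have "limitin mtopology \<sigma> y sequentially"
      unfolding limit_metric_sequentially
    proof (intro conjI y allI impI)
      fix \<epsilon> :: real assume "0 < \<epsilon>"
      then obtain N where "\<forall>n\<ge>N. norm (cinner_dist (l2_space I) (\<sigma> n) y - 0) < \<epsilon>"
        using LIMSEQ_D[OF lim] by blast
      then show "\<exists>N. \<forall>n\<ge>N. \<sigma> n \<in> carrier (l2_space I) \<and> cinner_dist (l2_space I) (\<sigma> n) y < \<epsilon>"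
        using c by (intro exI[of _ N]) auto
    qed
    then show "\<exists>x. limitin mtopology \<sigma> x sequentially" by blast
  qed
qed

lemma ip_add_left:
  assumes "u \<in> l2" "v \<in> l2" "w \<in> l2"
  shows "ip (\<lambda>i. u i + v i) w = ip u w + ip v w"
  using assms by (simp add: ip_commute[of _ w] ip_add_right l2_summable_mult)

lemma ip_combination_left:
  assumes "u \<in> l2" "v \<in> l2" "w \<in> l2"
  shows "ip (\<lambda>i. a * u i + c * v i) w = a * ip u w + c * ip v w"
    and "ip (\<lambda>i. a * u i - c * v i) w = a * ip u w - c * ip v w"
  using assms
  by (simp_all add: ip_commute[of _ w] ip_add_right ip_diff_right ip_scale_right l2_summable_mult l2_scale)

lemma l2_space_chilbert: "chilbert_space (l2_space I)"
proof (intro chilbert_space.intro chilbert_space_axioms.intro)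
  show "Module.module (ring_of_type_algebra :: complex ring) (l2_space I)"
  proof (rule moduleI)
    show "cring (ring_of_type_algebra :: complex ring)" by (rule cring_from_type_algebra)
  qed (auto simp: l2_space_abelian_group l2_space_smult_closed l2_space_ops ring_of_type_algebra_def
      algebra_simps)
  fix u v w assume u: "u \<in> carrier (l2_space I)" and v: "v \<in> carrier (l2_space I)"
  show "cinner (l2_space I) u v = cnj (cinner (l2_space I) v u)"
    by (simp add: l2_space_def complex_eq_iff ip_commute)
  show "cinner (l2_space I) (a \<odot>\<^bsub>l2_space I\<^esub> u) v = a * cinner (l2_space I) u v" for a
    using u v
    by (simp add: complex_eq_iff Re_cinner_l2_space Im_cinner_l2_space l2_space_ops l2_space_carrier
        ip_combination_left algebra_simps)
  assume w: "w \<in> carrier (l2_space I)"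
  show "cinner (l2_space I) (u \<oplus>\<^bsub>l2_space I\<^esub> v) w = cinner (l2_space I) u w + cinner (l2_space I) v w"
    using u v w
    by (simp add: complex_eq_iff Re_cinner_l2_space Im_cinner_l2_space l2_space_ops l2_space_carrier
        ip_add_left)
next
  fix v assume v: "v \<in> carrier (l2_space I)" and nz: "v \<noteq> \<zero>\<^bsub>l2_space I\<^esub>"
  then obtain i where i: "v i \<noteq> 0" by (auto simp: l2_space_ops)
  have "0 < (Re (v i))\<^sup>2 + (Im (v i))\<^sup>2"
    using i by (simp add: sum_power2_gt_zero_iff complex_eq_iff)
  also have "\<dots> \<le> Re (cinner (l2_space I) v v)"
    unfolding Re_cinner_l2_space using v
      sq_le_ip[of "\<lambda>i. Re (v i)" i] sq_le_ip[of "\<lambda>i. Im (v i)" i]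
    by (simp add: l2_space_carrier)
  finally show "0 < Re (cinner (l2_space I) v v)" .
qed (rule l2_space_mcomplete)

section \<open>Property (T) and kernels of negative type\<close>

context Group.group
begin

text \<open>For the affine combination of the orbit points \<open>o\<^sub>x\<^sub>m\<close> with weights \<open>w\<close> of sum 1, the squared distance
  to the base point \<open>o\<^sub>\<one>\<close> and the squared distance to the translate by \<open>g\<close>, both written in terms of the
  squared distances \<open>\<psi>\<close> of orbit points.\<close>

abbreviation combination_spread :: "('a \<Rightarrow> 'a \<Rightarrow> real) \<Rightarrow> nat \<Rightarrow> (nat \<Rightarrow> real) \<Rightarrow> (nat \<Rightarrow> 'a) \<Rightarrow> real"
  where "combination_spread \<psi> n w x \<equiv> (\<Sum>m<n. \<Sum>k<n. w m * w k *
    ((\<psi> (x m) \<one> + \<psi> \<one> (x k) - \<psi> (x m) (x k)) / 2))"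

abbreviation combination_displacement ::
  "('a \<Rightarrow> 'a \<Rightarrow> real) \<Rightarrow> 'a \<Rightarrow> nat \<Rightarrow> (nat \<Rightarrow> real) \<Rightarrow> (nat \<Rightarrow> 'a) \<Rightarrow> real"
  where "combination_displacement \<psi> g n w x \<equiv> (\<Sum>m<n. \<Sum>k<n. w m * w k *
    ((\<psi> (g \<otimes> x m) (x k) + \<psi> (x m) (g \<otimes> x k) - \<psi> (g \<otimes> x m) (g \<otimes> x k) - \<psi> (x m) (x k)) / 2))"

end

context kernel_vectors
begin

definition complex_rep :: "'g \<Rightarrow> (nat \<Rightarrow> complex) \<Rightarrow> nat \<Rightarrow> complex"
  where "complex_rep g v i = Complex (rep g (\<lambda>j. Re (v j)) i) (rep g (\<lambda>j. Im (v j)) i)"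

lemma complex_rep_parts: "(\<lambda>i. Re (complex_rep g v i)) = rep g (\<lambda>i. Re (v i))" "(\<lambda>i. Im (complex_rep g v i)) = rep g (\<lambda>i. Im (v i))"
  by (simp_all add: complex_rep_def)

lemma complex_rep_closed:
  assumes "g \<in> carrier G" "v \<in> carrier (l2_space I)"
  shows "complex_rep g v \<in> carrier (l2_space I)"
  unfolding l2_space_carrier complex_rep_parts using assms
  by (auto simp: l2_space_carrier complex_rep_def rep_supp complex_eq_iff intro: rep_contraction(1))

lemma rep_combination:
  assumes g: "g \<in> carrier G"
  shows "rep g (\<lambda>i. a * v i + c * w i) i = a * rep g v i + c * rep g w i"
    and "rep g (\<lambda>i. a * v i - c * w i) i = a * rep g v i - c * rep g w i"
proof -
  show "rep g (\<lambda>i. a * v i + c * w i) i = a * rep g v i + c * rep g w i" for c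
    unfolding rep_linear(1)[OF g, of "\<lambda>i. a * v i" "\<lambda>i. c * w i"] rep_linear(2)[OF g] by simp
  from this[of "- c"] show "rep g (\<lambda>i. a * v i - c * w i) i = a * rep g v i - c * rep g w i" by simp
qed

lemma complex_rep_unitary: "unitary_rep G (l2_space I) complex_rep"
proof (intro unitary_rep.intro unitary_rep_axioms.intro)
  show "Group.group G" by (rule is_group)
  show "chilbert_space (l2_space I)" by (rule l2_space_chilbert)
  fix g assume g: "g \<in> carrier G"
  have inv: "complex_rep (inv g) (complex_rep g v) = v" "complex_rep g (complex_rep (inv g) v) = v" if "v \<in> carrier (l2_space I)" for v
  proof -
    have 0: "Re (v j) = 0" "Im (v j) = 0" if "j \<notin> I" for j
      using that \<open>v \<in> _\<close> by (simp_all add: l2_space_carrier)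
    have "rep (inv g) (rep g (\<lambda>i. Re (v i))) = (\<lambda>i. Re (v i))" "rep g (rep (inv g) (\<lambda>i. Re (v i))) = (\<lambda>i. Re (v i))"
      "rep (inv g) (rep g (\<lambda>i. Im (v i))) = (\<lambda>i. Im (v i))" "rep g (rep (inv g) (\<lambda>i. Im (v i))) = (\<lambda>i. Im (v i))"
      by (rule rep_inv[OF g], erule 0)+
    then show "complex_rep (inv g) (complex_rep g v) = v" "complex_rep g (complex_rep (inv g) v) = v"
      unfolding complex_rep_def[of _ "complex_rep _ _", abs_def] complex_rep_parts by (simp_all add: fun_eq_iff complex_eq_iff)
  qed
  show "bij_betw (complex_rep g) (carrier (l2_space I)) (carrier (l2_space I))"
    by (rule bij_betw_byWitness[where f' = "complex_rep (inv g)"]) (use g in \<open>auto simp: inv complex_rep_closed\<close>)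
  fix v w
  assume v: "v \<in> carrier (l2_space I)"
  show "complex_rep g (a \<odot>\<^bsub>l2_space I\<^esub> v) = a \<odot>\<^bsub>l2_space I\<^esub> complex_rep g v" for a
    by (simp add: fun_eq_iff complex_eq_iff l2_space_ops complex_rep_def rep_combination[OF g])
  assume w: "w \<in> carrier (l2_space I)"
  show "complex_rep g (v \<oplus>\<^bsub>l2_space I\<^esub> w) = complex_rep g v \<oplus>\<^bsub>l2_space I\<^esub> complex_rep g w"
    by (simp add: fun_eq_iff complex_eq_iff l2_space_ops complex_rep_def rep_linear(1)[OF g])
  show "cinner (l2_space I) (complex_rep g v) (complex_rep g w) = cinner (l2_space I) v w"
    unfolding complex_eq_iff Re_cinner_l2_space Im_cinner_l2_space complex_rep_parts
    using v w by (simp add: rep_ip[OF g] l2_space_carrier)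
next
  fix g h and v :: "nat \<Rightarrow> complex" assume "g \<in> carrier G" "h \<in> carrier G"
  then show "complex_rep (g \<otimes> h) v = complex_rep g (complex_rep h v)"
    unfolding complex_rep_def[of g "complex_rep h v", abs_def] complex_rep_parts
    by (simp add: fun_eq_iff complex_rep_def rep_mult)
qed

text \<open>The vectors \<open>b g\<close> form a cocycle for the representation. A primitive \<open>v\<close> of this cocycle may be replaced by
its real part, because the cocycle and the matrices of the action are real.\<close>

lemma property_T_fixed_point:
  assumes T: "property_T G"
  obtains v where "v \<in> l2" "\<And>j. j \<notin> I \<Longrightarrow> v j = 0"
    "\<And>g i. g \<in> carrier G \<Longrightarrow> b g i = rep g v i - v i"
proof -
  let ?c = "\<lambda>g\<in>carrier G. \<lambda>i. complex_of_real (b g i)"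
  have bl2: "(\<lambda>i. complex_of_real (b g i)) \<in> carrier (l2_space I)" if "g \<in> carrier G" for g
    using that by (simp add: l2_space_carrier b_supp l2_zero finsupp_l2[OF b_finsupp])
  have rep0: "rep g (\<lambda>j. 0) i = 0" for g i by (simp add: rep_def ip_def)
  have "?c \<in> one_cocycles G (l2_space I) complex_rep"
    unfolding one_cocycles_def
  proof (intro CollectI conjI ballI)
    show "?c \<in> carrier G \<rightarrow>\<^sub>E carrier (l2_space I)" using bl2 by auto
    fix g h assume gh: "g \<in> carrier G" "h \<in> carrier G"
    then show "?c (g \<otimes> h) = ?c g \<oplus>\<^bsub>l2_space I\<^esub> complex_rep g (?c h)"
      by (simp add: l2_space_ops complex_rep_def fun_eq_iff complex_eq_iff rep_b rep0)
  qed
  also have "one_cocycles G (l2_space I) complex_rep = one_coboundaries G (l2_space I) complex_rep"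
    using T complex_rep_unitary by (simp add: property_T_def H1_vanishes_def)
  finally obtain v where v: "v \<in> carrier (l2_space I)"
    and c: "?c = (\<lambda>g\<in>carrier G. complex_rep g v \<ominus>\<^bsub>l2_space I\<^esub> v)"
    unfolding one_coboundaries_def by blast
  show ?thesis
  proof
    show "(\<lambda>i. Re (v i)) \<in> l2" "\<And>j. j \<notin> I \<Longrightarrow> Re (v j) = 0"
      using v by (simp_all add: l2_space_carrier)
    fix g i assume g: "g \<in> carrier G"
    have "?c g = complex_rep g v \<ominus>\<^bsub>l2_space I\<^esub> v" using g unfolding c by simp
    also have "\<dots> = (\<lambda>i. complex_rep g v i - v i)" by (rule l2_space_minus[OF complex_rep_closed[OF g v] v])
    finally have "complex_of_real (b g i) = complex_rep g v i - v i" using g by (simp add: fun_eq_iff)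
    then have "Re (complex_of_real (b g i)) = Re (complex_rep g v i - v i)" by (rule arg_cong)
    then show "b g i = rep g (\<lambda>i. Re (v i)) i - Re (v i)" by (simp add: complex_rep_def)
  qed
qed

lemma rep_sum:
  assumes g: "g \<in> carrier G"
  shows "rep g (\<lambda>i. \<Sum>m<(n::nat). a m * u m i) i = (\<Sum>m<n. a m * rep g (u m) i)"
proof (induction n)
  case 0
  then show ?case by (simp add: rep_def ip_def)
next
  case (Suc n)
  then show ?case
    unfolding sum.lessThan_Suc
      rep_linear(1)[OF g, of "\<lambda>i. \<Sum>m<n. a m * u m i" "\<lambda>i. a n * u n i"] rep_linear(2)[OF g] by simp
qed

text \<open>In the affine picture the fixed point is \<open>o\<^sub>\<one> - v\<close>. Truncations of \<open>v\<close> have finite support and are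
therefore finite combinations of the vectors \<open>b (\<gamma> m)\<close>; giving the remaining weight to the base point
makes the weights sum to 1. The spread stays below \<open>\<parallel>v\<parallel>\<^sup>2\<close> for all truncations, and the displacement
is at most \<open>4 \<parallel>r\<parallel>\<^sup>2\<close> for the remainder \<open>r\<close> of \<open>v\<close>.\<close>

lemma approximate_fixed_point:
  assumes T: "property_T G"
  shows "\<exists>R. \<forall>\<epsilon>>0. \<exists>n (w :: nat \<Rightarrow> real) x.
    (\<forall>m<n. x m \<in> carrier G) \<and> (\<Sum>m<n. w m) = 1 \<and>
    combination_spread \<psi> n w x \<le> R \<and>
    (\<forall>g\<in>carrier G. combination_displacement \<psi> g n w x \<le> \<epsilon>)"
proof -
  obtain v where v: "v \<in> l2" "\<And>j. j \<notin> I \<Longrightarrow> v j = 0"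
    and bv: "\<And>g i. g \<in> carrier G \<Longrightarrow> b g i = rep g v i - v i"
    using property_T_fixed_point[OF T] by blast
  show ?thesis
  proof (intro exI[of _ "ip v v"] allI impI)
    fix \<epsilon> :: real assume \<epsilon>: "0 < \<epsilon>"
    let ?t = "\<lambda>N i. if i < N then v i else 0"
    obtain N where N: "norm (ip (\<lambda>i. v i - ?t N i) (\<lambda>i. v i - ?t N i) - 0) < \<epsilon> / 4"
      using LIMSEQ_D[OF truncation_tendsto[OF v(1)], of "\<epsilon> / 4"] \<epsilon> by auto
    define vN where "vN = ?t N"
    define r where "r i = v i - vN i" for i
    have rr: "ip r r \<le> \<epsilon> / 4" using N unfolding r_def[abs_def] vN_def by simp
    have vNf: "vN \<in> finsupp" unfolding finsupp_def vN_def by (auto intro!: exI[of _ N])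
    have vN0: "vN i = 0" if "i \<ge> N" for i using that by (simp add: vN_def)
    have vN1: "vN i = 0" if "i \<notin> I" for i using that v(2) by (simp add: vN_def)
    obtain c where c: "\<And>j. vN j = (\<Sum>m<N. c m * b (\<gamma> m) j)"
      using finsupp_span[of N vN, OF vN0 vN1] by blast
    have rl2: "r \<in> l2" unfolding r_def[abs_def] by (rule l2_diff[OF v(1) finsupp_l2[OF vNf]])
    define x where "x m = (if m < N then \<gamma> m else \<one>)" for m
    \<comment> \<open>The weights of \<open>o\<^sub>\<one> - (\<Sum>m<N. c m (o\<^sub>\<gamma>\<^sub>m - o\<^sub>\<one>))\<close>, with the base point as the last point.\<close>
    define w where "w m = (if m < N then - c m else 1 + (\<Sum>m<N. c m))" for m
    have x: "x m \<in> carrier G" for m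
      unfolding x_def by simp
    have split: "(\<Sum>m<Suc N. w m * f (x m)) = (1 + (\<Sum>m<N. c m)) * f \<one> - (\<Sum>m<N. c m * f (\<gamma> m))" for f
    proof -
      have "(\<Sum>m<N. w m * f (x m)) = (\<Sum>m<N. - (c m * f (\<gamma> m)))"
        by (rule sum.cong) (simp_all add: w_def x_def)
      moreover have "w N * f (x N) = (1 + (\<Sum>m<N. c m)) * f \<one>" by (simp add: w_def x_def)
      ultimately show ?thesis unfolding sum.lessThan_Suc sum_negf by linarith
    qed
    have one: "(\<Sum>m<Suc N. w m) = 1" using split[of "\<lambda>_. 1"] by (simp only: mult_1_right add_diff_cancel_right')
    have P: "(\<Sum>m<Suc N. w m * b (x m) i) = - vN i" for i
      using split[of "\<lambda>z. b z i"] unfolding b_one c[symmetric] by linarith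
    have "combination_spread \<psi> (Suc N) w x =
        ip (\<lambda>i. \<Sum>m<Suc N. w m * b (x m) i) (\<lambda>i. \<Sum>m<Suc N. w m * b (x m) i)"
      by (subst ip_combination) (simp_all only: b_finsupp x ip_b)
    also have "\<dots> = ip vN vN" unfolding P by (simp add: ip_def)
    also have "\<dots> = (\<Sum>i<N. (v i)\<^sup>2)"
    proof -
      have "ip vN vN = (\<Sum>i<N. vN i * vN i)" by (rule ip_eq_sum) (rule vN0)
      then show ?thesis by (simp add: vN_def power2_eq_square)
    qed
    also have "\<dots> \<le> ip v v" by (rule sum_sq_le_ip[OF v(1)])
    finally have E1: "combination_spread \<psi> (Suc N) w x \<le> ip v v" .
    have E2: "combination_displacement \<psi> g (Suc N) w x \<le> \<epsilon>"
      if g: "g \<in> carrier G" for g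
    proof -
      let ?u = "\<lambda>m i. b (g \<otimes> x m) i - b (x m) i"
      have "(\<Sum>m<Suc N. w m * ?u m i) = rep g r i - r i" for i
      proof -
        have "(\<Sum>m<Suc N. w m * ?u m i) =
            (\<Sum>m<Suc N. w m * b g i + w m * rep g (b (x m)) i - w m * b (x m) i)"
          by (intro sum.cong refl) (simp add: rep_b[OF g x] algebra_simps)
        also have "\<dots> = b g i + (\<Sum>m<Suc N. w m * rep g (b (x m)) i) - (\<Sum>m<Suc N. w m * b (x m) i)"
          unfolding sum_subtractf sum.distrib sum_distrib_right[symmetric] one by (simp only: mult_1_left)
        also have "\<dots> = b g i + rep g (\<lambda>i. - vN i) i + vN i"
          unfolding rep_sum[OF g, where u = "\<lambda>m. b (x m)", symmetric] P by (rule diff_minus_eq_add)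
        also have "rep g (\<lambda>i. - vN i) i = rep g (\<lambda>i. 1 * r i - 1 * v i) i" by (simp add: r_def)
        also have "\<dots> = rep g r i - rep g v i" unfolding rep_combination(2)[OF g] by simp
        finally show ?thesis by (simp add: bv[OF g] r_def)
      qed
      note u = this
      have "combination_displacement \<psi> g (Suc N) w x =
          ip (\<lambda>i. \<Sum>m<Suc N. w m * ?u m i) (\<lambda>i. \<Sum>m<Suc N. w m * ?u m i)"
      proof -
        have "?u m \<in> finsupp" for m by (intro finsupp_diff b_finsupp m_closed g x)
        then show ?thesis
          unfolding ip_combination[where u = ?u, OF \<open>\<And>m. ?u m \<in> finsupp\<close>]
          by (simp only: x g m_closed ip_b_diff)
      qed
      also have "\<dots> = ip (\<lambda>i. rep g r i - r i) (\<lambda>i. rep g r i - r i)" by (simp only: u)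
      also have "\<dots> = ip (rep g r) (rep g r) - 2 * ip (rep g r) r + ip r r"
        by (rule ip_diff_self[OF rep_contraction(1)[OF g rl2] rl2])
      also have "\<dots> \<le> 2 * (ip (rep g r) (rep g r) + ip r r)"
      proof -
        have "p - 2 * q + s \<le> 2 * (p + s)" if "0 \<le> p + 2 * q + s" for p q s :: real
          using that by simp
        moreover have "0 \<le> ip (rep g r) (rep g r) + 2 * ip (rep g r) r + ip r r"
          using ip_self_nonneg[OF l2_add[OF rep_contraction(1)[OF g rl2] rl2]]
          unfolding ip_add_self[OF rep_contraction(1)[OF g rl2] rl2] .
        ultimately show ?thesis .
      qed
      also have "\<dots> \<le> 2 * (\<epsilon> / 4 + \<epsilon> / 4)"
      proof -
        have "2 * (p + s) \<le> 2 * (t / 4 + t / 4)" if "s \<le> t / 4" "p \<le> s" for p s t :: real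
          using that by simp
        from this[OF rr rep_contraction(2)[OF g rl2]] show ?thesis .
      qed
      finally show ?thesis by simp
    qed
    show "\<exists>n (w :: nat \<Rightarrow> real) x.
      (\<forall>m<n. x m \<in> carrier G) \<and> (\<Sum>m<n. w m) = 1 \<and>
      combination_spread \<psi> n w x \<le> ip v v \<and>
      (\<forall>g\<in>carrier G. combination_displacement \<psi> g n w x \<le> \<epsilon>)"
      using x one E1 E2 by (intro exI[of _ "Suc N"] exI[of _ w] exI[of _ x]) blast
  qed
qed

end

text \<open>The Delorme-Guichardet argument for one kernel: \<open>\<psi>\<close> is the squared distance on an orbit of an affine
isometric action, and property (T) gives this action a fixed point. The important point is the order of
quantifiers: the bound \<open>R\<close> on the distance to the base point is chosen before the precision \<open>\<epsilon>\<close>.\<close>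

lemma (in Group.group) property_T_approximate_fixed_point:
  fixes \<psi> :: "'a \<Rightarrow> 'a \<Rightarrow> real"
  assumes T: "property_T G"
    and sym: "\<And>g h. \<psi> g h = \<psi> h g"
    and diag: "\<And>g. g \<in> carrier G \<Longrightarrow> \<psi> g g = 0"
    and left: "\<And>k g h. \<lbrakk>k \<in> carrier G; g \<in> carrier G; h \<in> carrier G\<rbrakk> \<Longrightarrow> \<psi> (k \<otimes> g) (k \<otimes> h) = \<psi> g h"
    and neg: "\<And>n t x. \<lbrakk>\<And>m. m < (n::nat) \<Longrightarrow> x m \<in> carrier G; (\<Sum>m<n. t m) = 0\<rbrakk> \<Longrightarrow>
      (\<Sum>m<n. \<Sum>k<n. t m * t k * \<psi> (x m) (x k)) \<le> 0"
  shows "\<exists>R. \<forall>\<epsilon>>0. \<exists>n (w :: nat \<Rightarrow> real) x.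
    (\<forall>m<n. x m \<in> carrier G) \<and> (\<Sum>m<n. w m) = 1 \<and>
    combination_spread \<psi> n w x \<le> R \<and>
    (\<forall>g\<in>carrier G. combination_displacement \<psi> g n w x \<le> \<epsilon>)"
proof -
  have "countable (carrier G)" using T by (simp add: property_T_def)
  then obtain \<gamma> :: "nat \<Rightarrow> 'a" where \<gamma>: "range \<gamma> = carrier G"
    using range_from_nat_into[of "carrier G"] one_closed by blast
  have \<gamma>G: "\<gamma> i \<in> carrier G" for i using \<gamma> by blast
  define K where "K i j = (\<psi> (\<gamma> i) \<one> + \<psi> \<one> (\<gamma> j) - \<psi> (\<gamma> i) (\<gamma> j)) / 2" for i j
  have psd: "positive_semidefinite K"
    unfolding positive_semidefinite_def
  proof (intro conjI allI)
    show "K i j = K j i" for i j by (simp add: K_def sym[of _ \<one>] sym[of "\<gamma> j"])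
    fix n and a :: "nat \<Rightarrow> real"
    define S where "S = (\<Sum>m<n. a m)"
    define L where "L = (\<Sum>m<n. a m * \<psi> (\<gamma> m) \<one>)"
    define Q where "Q = (\<Sum>m<n. \<Sum>k<n. a m * a k * \<psi> (\<gamma> m) (\<gamma> k))"
    define x where "x m = (if m < n then \<gamma> m else \<one>)" for m
    \<comment> \<open>Weights of sum 0: an extra point at the base point compensates for the sum of \<open>a\<close>.\<close>
    define t where "t m = (if m < n then a m else - S)" for m
    have split: "(\<Sum>m<Suc n. t m * f (x m)) = (\<Sum>m<n. a m * f (\<gamma> m)) - S * f \<one>" for f
    proof -
      have "(\<Sum>m<n. t m * f (x m)) = (\<Sum>m<n. a m * f (\<gamma> m))"
        by (rule sum.cong) (simp_all add: t_def x_def)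
      moreover have "t n * f (x n) = - (S * f \<one>)" by (simp add: t_def x_def)
      ultimately show ?thesis unfolding sum.lessThan_Suc by linarith
    qed
    have "(\<Sum>m<Suc n. \<Sum>k<Suc n. t m * t k * \<psi> (x m) (x k)) =
        (\<Sum>m<Suc n. t m * (\<Sum>k<Suc n. t k * \<psi> (x m) (x k)))"
      by (simp only: sum_distrib_left mult.assoc)
    also have "\<dots> = (\<Sum>m<Suc n. t m * ((\<Sum>k<n. a k * \<psi> (x m) (\<gamma> k)) - S * \<psi> (x m) \<one>))"
      by (simp only: split)
    also have "\<dots> = (\<Sum>m<n. a m * ((\<Sum>k<n. a k * \<psi> (\<gamma> m) (\<gamma> k)) - S * \<psi> (\<gamma> m) \<one>))
        - S * ((\<Sum>k<n. a k * \<psi> \<one> (\<gamma> k)) - S * \<psi> \<one> \<one>)"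
      by (rule split)
    also have "(\<Sum>k<n. a k * \<psi> \<one> (\<gamma> k)) = L" unfolding L_def by (simp only: sym[of \<one>])
    also have "(\<Sum>m<n. a m * ((\<Sum>k<n. a k * \<psi> (\<gamma> m) (\<gamma> k)) - S * \<psi> (\<gamma> m) \<one>)) = Q - S * L"
      by (simp add: Q_def L_def right_diff_distrib sum_subtractf sum_distrib_left mult_ac)
    finally have total: "(\<Sum>m<Suc n. \<Sum>k<Suc n. t m * t k * \<psi> (x m) (x k)) =
      Q - S * L - S * (L - S * \<psi> \<one> \<one>)" .
    have "x m \<in> carrier G" for m unfolding x_def using \<gamma>G by simp
    moreover have "(\<Sum>m<Suc n. t m) = 0"
      using split[of "\<lambda>_. 1"] by (simp only: S_def mult_1_right diff_self)
    ultimately have "Q - S * L - S * (L - S * \<psi> \<one> \<one>) \<le> 0"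
      using neg[of "Suc n" x t] unfolding total by blast
    then have q: "Q - 2 * (S * L) \<le> 0" by (simp add: diag algebra_simps)
    have eq: "(\<Sum>i<n. \<Sum>j<n. a i * a j * K i j) =
        ((\<Sum>i<n. \<Sum>j<n. a j * (a i * \<psi> (\<gamma> i) \<one>)) + (\<Sum>i<n. \<Sum>j<n. a i * (a j * \<psi> (\<gamma> j) \<one>)) - Q) / 2"
      unfolding Q_def sum_subtractf[symmetric] sum.distrib[symmetric] sum_divide_distrib
      by (intro sum.cong refl) (simp add: K_def sym[of \<one>] algebra_simps)
    have eq1: "(\<Sum>i<n. \<Sum>j<n. a j * (a i * \<psi> (\<gamma> i) \<one>)) = S * L"
      unfolding sum_distrib_right[symmetric] sum_distrib_left[symmetric] by (simp add: S_def L_def)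
    have eq2: "(\<Sum>i<n. \<Sum>j<n. a i * (a j * \<psi> (\<gamma> j) \<one>)) = S * L"
      unfolding sum_distrib_left[symmetric] sum_distrib_right[symmetric] by (simp add: S_def L_def)
    have "0 \<le> (p + p - u) / 2" if "u - 2 * p \<le> 0" for p u :: real using that by simp
    from this[OF q] show "0 \<le> (\<Sum>i<n. \<Sum>j<n. a i * a j * K i j)" unfolding eq eq1 eq2 .
  qed
  obtain \<beta> I where lower: "\<And>i m. i < m \<Longrightarrow> \<beta> i m = 0"
    and I: "\<And>i m. m \<notin> I \<Longrightarrow> \<beta> i m = 0" and dg: "\<And>i. i \<in> I \<Longrightarrow> \<beta> i i \<noteq> 0"
    and K: "\<And>i j. K i j = (\<Sum>m\<le>i. \<beta> i m * \<beta> j m)"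
    by (rule Cholesky_decomposition[OF psd]) (rule that)
  obtain T where T0: "\<And>i m. i \<in> I \<Longrightarrow> i < m \<Longrightarrow> T i m = 0"
    and Tinv: "\<And>i j. i \<in> I \<Longrightarrow> (\<Sum>m\<le>i. T i m * \<beta> m j) = of_bool (j = i)"
  proof -
    have "\<forall>i\<in>I. \<exists>t. (\<forall>m>i. t m = 0) \<and> (\<forall>j. (\<Sum>m\<le>i. t m * \<beta> m j) = of_bool (j = i))"
      by (intro ballI triangular_inverse_row[OF lower I dg])
    from bchoice[OF this] obtain T
      where "\<forall>i\<in>I. (\<forall>m>i. T i m = 0) \<and> (\<forall>j. (\<Sum>m\<le>i. T i m * \<beta> m j) = of_bool (j = i))" ..
    then show ?thesis by (intro that[of T]) simp_all
  qed
  have fs: "\<beta> i \<in> finsupp" for i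
  proof -
    have "\<forall>m\<ge>Suc i. \<beta> i m = 0" by (simp add: lower)
    then show ?thesis unfolding finsupp_def by blast
  qed
  have ipK: "ip (\<beta> i) (\<beta> j) = K i j" for i j
  proof -
    have "ip (\<beta> j) (\<beta> i) = (\<Sum>m<Suc i. \<beta> j m * \<beta> i m)"
      by (rule ip_eq_sum) (simp add: lower)
    also have "\<dots> = K i j"
      unfolding K lessThan_Suc_atMost by (rule sum.cong[OF refl mult.commute])
    finally show ?thesis by (simp only: ip_commute[of "\<beta> i" "\<beta> j"])
  qed
  have same: "\<beta> i = \<beta> j" if "\<gamma> i = \<gamma> j" for i j
  proof
    fix m
    have "ip (\<lambda>m. \<beta> i m - \<beta> j m) (\<lambda>m. \<beta> i m - \<beta> j m) = 0"
      unfolding ip_diff_self[OF finsupp_l2[OF fs] finsupp_l2[OF fs]] ipK using that by (simp add: K_def)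
    then have "\<beta> i m - \<beta> j m = 0"
      using ip_self_zero[of "\<lambda>m. \<beta> i m - \<beta> j m" m, OF finsupp_l2[OF finsupp_diff[OF fs fs]]] by blast
    then show "\<beta> i m = \<beta> j m" by simp
  qed
  \<comment> \<open>Repetitions in the enumeration \<open>\<gamma>\<close> do no harm: equal elements have equal vectors.\<close>
  define b where "b g = \<beta> (SOME i. \<gamma> i = g)" for g
  have b: "b (\<gamma> i) = \<beta> i" for i unfolding b_def by (rule same) (rule someI[of _ i], simp)
  have b': "\<exists>i. g = \<gamma> i" if "g \<in> carrier G" for g using that \<gamma> by blast
  have "kernel_vectors G \<psi> \<gamma> b I (\<lambda>i m. if i \<in> I then T i m else 0)"
  proof (intro kernel_vectors.intro kernel_vectors_axioms.intro)
    show "Group.group G" by (rule is_group)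
    show "ip (b g) (b h) = (\<psi> g \<one> + \<psi> \<one> h - \<psi> g h) / 2" if gh: "g \<in> carrier G" "h \<in> carrier G" for g h
      using b'[OF gh(1)] b'[OF gh(2)] by (auto simp: b ipK K_def)
    show "b g \<in> finsupp" if "g \<in> carrier G" for g using b'[OF that] fs by (auto simp: b)
    show "b g i = 0" if "g \<in> carrier G" "i \<notin> I" for g i using b'[OF that(1)] I[OF that(2)] by (auto simp: b)
    show "(if i \<in> I then T i m else 0) = 0" if "i < m" for i m using T0[OF _ that] by simp
    show "(\<Sum>m\<le>i. (if i \<in> I then T i m else 0) * b (\<gamma> m) j) = of_bool (j = i)" if "i \<in> I" for i j
      using that Tinv[OF that] by (simp only: b if_True)
  qed (fact \<gamma> sym diag left)+
  then show ?thesis by (rule kernel_vectors.approximate_fixed_point) (rule T)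
qed

section \<open>Property (T) and integer-valued almost cocycles\<close>

text \<open>In the application, \<open>n\<close> is the index in a sequence of counterexamples. Passing to a limit
of the normalized distances \<open>\<psi>n\<close> removes the error in the cocycle identity, so that property (T) can be
applied to an honest action; finitely many values of \<open>\<psi>\<close> are then approximated by those of \<open>\<psi>n\<close> for
a large \<open>n\<close>, where \<open>integral_rounding\<close> applies.\<close>

lemma (in Group.group) property_T_almost_cocycle:
  fixes Y :: "nat \<Rightarrow> 'x set" and act :: "nat \<Rightarrow> 'a \<Rightarrow> 'x \<Rightarrow> 'x"
    and c :: "nat \<Rightarrow> 'a \<Rightarrow> 'x \<Rightarrow> int" and N :: "nat \<Rightarrow> real"
  assumes T: "property_T G"
    and Y: "\<And>n. finite (Y n)"
    and act: "\<And>n g. g \<in> carrier G \<Longrightarrow> bij_betw (act n g) (Y n) (Y n)"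
    and N: "\<And>n. 0 < N n"
    and bounded: "\<And>n g. g \<in> carrier G \<Longrightarrow> (\<Sum>x\<in>Y n. real_of_int \<bar>c n g x\<bar>) \<le> L g * N n"
    and almost: "\<And>n g h. \<lbrakk>g \<in> carrier G; h \<in> carrier G\<rbrakk> \<Longrightarrow>
      (\<Sum>x\<in>Y n. real_of_int \<bar>c n (g \<otimes> h) x - (c n g x + c n h (act n g x))\<bar>) \<le> \<delta> n g h * N n"
    and \<delta>: "\<And>g h. \<lbrakk>g \<in> carrier G; h \<in> carrier G\<rbrakk> \<Longrightarrow> (\<lambda>n. \<delta> n g h) \<longlonglongrightarrow> 0"
    and S: "finite S" "S \<subseteq> carrier G" and \<epsilon>: "0 < \<epsilon>"
  shows "\<exists>n\<ge>n0. \<exists>f :: 'x \<Rightarrow> int.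
    (\<Sum>s\<in>S. \<Sum>x\<in>Y n. real_of_int \<bar>c n s x - (f (act n s x) - f x)\<bar>) \<le> \<epsilon> * N n"
proof -
  define \<psi>n where "\<psi>n n g h = (\<Sum>x\<in>Y n. real_of_int \<bar>c n g x - c n h x\<bar>) / N n" for n g h
  have N0: "0 \<le> N n" for n using N[of n] by simp
  have \<psi>n_nonneg: "0 \<le> \<psi>n n g h" for n g h
    unfolding \<psi>n_def by (intro divide_nonneg_nonneg sum_nonneg N0) simp
  have \<psi>n_bound: "\<psi>n n g h \<le> L g + L h" if "g \<in> carrier G" "h \<in> carrier G" for n g h
  proof -
    have "(\<Sum>x\<in>Y n. real_of_int \<bar>c n g x - c n h x\<bar>) \<le>
        (\<Sum>x\<in>Y n. real_of_int \<bar>c n g x\<bar> + real_of_int \<bar>c n h x\<bar>)"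
      by (intro sum_mono) linarith
    also have "\<dots> \<le> (L g + L h) * N n"
      unfolding sum.distrib distrib_right by (intro add_mono bounded that)
    finally show ?thesis unfolding \<psi>n_def using N[of n] by (simp add: pos_divide_le_eq)
  qed
  \<comment> \<open>Dividing by \<open>B\<close> makes the bounds uniform in the group elements, as the selection of a subsequence requires.\<close>
  define B where "B p = 1 + \<bar>L (fst p)\<bar> + \<bar>L (snd p)\<bar>" for p
  have B: "1 \<le> B p" for p by (simp add: B_def)
  have cG: "countable (carrier G)" using T by (simp add: property_T_def)
  obtain k where k: "strict_mono (k :: nat \<Rightarrow> nat)" and
    lim: "\<And>p. p \<in> carrier G \<times> carrier G \<Longrightarrow> \<exists>l. (\<lambda>n. \<psi>n (k n) (fst p) (snd p) / B p) \<longlonglongrightarrow> l"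
  proof (rule function_convergent_subsequence[of "carrier G \<times> carrier G" "\<lambda>n p. \<psi>n n (fst p) (snd p) / B p" 1])
    show "countable (carrier G \<times> carrier G)" by (intro countable_SIGMA cG)
    fix n p assume p: "p \<in> carrier G \<times> carrier G"
    have "\<psi>n n (fst p) (snd p) \<le> B p"
      using \<psi>n_bound[of "fst p" "snd p" n] p unfolding B_def by (simp add: mem_Times_iff)
    then show "norm (\<psi>n n (fst p) (snd p) / B p) \<le> 1"
      using B[of p] \<psi>n_nonneg[of n "fst p" "snd p"] by simp
  qed (rule that)
  define \<psi> where "\<psi> g h = (if g \<in> carrier G \<and> h \<in> carrier G then lim (\<lambda>n. \<psi>n (k n) g h) else 0)" for g h
  have \<psi>: "(\<lambda>n. \<psi>n (k n) g h) \<longlonglongrightarrow> \<psi> g h" if "g \<in> carrier G" "h \<in> carrier G" for g h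
  proof -
    from lim[of "(g, h)"] that obtain l where "(\<lambda>n. \<psi>n (k n) g h / B (g, h)) \<longlonglongrightarrow> l" by auto
    then have "(\<lambda>n. B (g, h) * (\<psi>n (k n) g h / B (g, h))) \<longlonglongrightarrow> B (g, h) * l" by (rule tendsto_mult_left)
    moreover have "B (g, h) \<noteq> 0" using B[of "(g, h)"] by simp
    ultimately have "(\<lambda>n. \<psi>n (k n) g h) \<longlonglongrightarrow> B (g, h) * l" by simp
    then show ?thesis using that by (simp add: \<psi>_def limI)
  qed
  have \<delta>k: "(\<lambda>n. \<delta> (k n) g h) \<longlonglongrightarrow> 0" if "g \<in> carrier G" "h \<in> carrier G" for g h
    using LIMSEQ_subseq_LIMSEQ[OF \<delta>[OF that] k] by (simp add: o_def)
  \<comment> \<open>\<open>\<psi>n n (g \<otimes> h) h'\<close> with \<open>c n (g \<otimes> h)\<close> replaced by the value that an exact cocycle would have.\<close>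
  define Dn where "Dn n g h h' = (\<Sum>x\<in>Y n. real_of_int \<bar>c n g x + c n h (act n g x) - c n h' x\<bar>) / N n" for n g h h'
  have sum_abs_diff: "\<bar>(\<Sum>x\<in>Y n. real_of_int \<bar>u x - w x\<bar>) - (\<Sum>x\<in>Y n. real_of_int \<bar>v x - w x\<bar>)\<bar> \<le>
      (\<Sum>x\<in>Y n. real_of_int \<bar>u x - v x\<bar>)" for n and u v w :: "'x \<Rightarrow> int"
  proof -
    have "\<bar>(\<Sum>x\<in>Y n. real_of_int \<bar>u x - w x\<bar>) - (\<Sum>x\<in>Y n. real_of_int \<bar>v x - w x\<bar>)\<bar> \<le>
        (\<Sum>x\<in>Y n. \<bar>real_of_int \<bar>u x - w x\<bar> - real_of_int \<bar>v x - w x\<bar>\<bar>)"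
      unfolding sum_subtractf[symmetric] by (rule sum_abs)
    also have "\<dots> \<le> (\<Sum>x\<in>Y n. real_of_int \<bar>u x - v x\<bar>)" by (intro sum_mono) linarith
    finally show ?thesis .
  qed
  have Dn_near: "\<bar>\<psi>n n (g \<otimes> h) h' - Dn n g h h'\<bar> \<le> \<delta> n g h"
    if "g \<in> carrier G" "h \<in> carrier G" for n g h h'
  proof -
    have "\<psi>n n (g \<otimes> h) h' - Dn n g h h' = ((\<Sum>x\<in>Y n. real_of_int \<bar>c n (g \<otimes> h) x - c n h' x\<bar>)
        - (\<Sum>x\<in>Y n. real_of_int \<bar>c n g x + c n h (act n g x) - c n h' x\<bar>)) / N n"
      unfolding \<psi>n_def Dn_def by (rule diff_divide_distrib[symmetric])
    then have "\<bar>\<psi>n n (g \<otimes> h) h' - Dn n g h h'\<bar> = \<bar>(\<Sum>x\<in>Y n. real_of_int \<bar>c n (g \<otimes> h) x - c n h' x\<bar>)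
        - (\<Sum>x\<in>Y n. real_of_int \<bar>c n g x + c n h (act n g x) - c n h' x\<bar>)\<bar> / N n"
      using N0[of n] by (simp only: abs_divide abs_of_nonneg)
    also have "\<dots> \<le> (\<delta> n g h * N n) / N n"
      using sum_abs_diff[where n = n and u = "c n (g \<otimes> h)" and w = "c n h'" and v = "\<lambda>x. c n g x + c n h (act n g x)"] almost[OF that, of n]
      by (intro divide_right_mono N0) linarith
    finally show ?thesis using N[of n] by simp
  qed
  have \<psi>n_sym: "\<psi>n n g h = \<psi>n n h g" for n g h
    unfolding \<psi>n_def by (simp only: abs_minus_commute)
  have Dn_lim: "(\<lambda>n. Dn (k n) g h h') \<longlonglongrightarrow> \<psi> (g \<otimes> h) h'"
    if "g \<in> carrier G" "h \<in> carrier G" "h' \<in> carrier G" for g h h'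
  proof -
    have "(\<lambda>n. \<psi>n (k n) (g \<otimes> h) h' - Dn (k n) g h h') \<longlonglongrightarrow> 0"
      by (rule Lim_null_comparison[OF _ \<delta>k[OF that(1,2)]]) (simp add: Dn_near[OF that(1,2)])
    from tendsto_diff[OF \<psi>[OF m_closed[OF that(1,2)] that(3)] this] show ?thesis by simp
  qed
  have left_n: "\<bar>\<psi>n n (g \<otimes> h) (g \<otimes> h') - \<psi>n n h h'\<bar> \<le> \<delta> n g h + \<delta> n g h'"
    if "g \<in> carrier G" "h \<in> carrier G" "h' \<in> carrier G" for n g h h'
  proof -
    let ?u = "\<lambda>h x. c n g x + c n h (act n g x)"
    have "(\<Sum>x\<in>Y n. real_of_int \<bar>c n h (act n g x) - c n h' (act n g x)\<bar>) =
        (\<Sum>x\<in>Y n. real_of_int \<bar>c n h x - c n h' x\<bar>)"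
      by (rule sum.reindex_bij_betw[OF act[OF that(1)]])
    then have eq: "\<psi>n n h h' = (\<Sum>x\<in>Y n. real_of_int \<bar>?u h x - ?u h' x\<bar>) / N n"
      by (simp add: \<psi>n_def)
    have flip: "(\<Sum>x\<in>Y n. real_of_int \<bar>v x - u x\<bar>) = (\<Sum>x\<in>Y n. real_of_int \<bar>u x - v x\<bar>)"
      for u v :: "'x \<Rightarrow> int"
      by (intro sum.cong refl arg_cong[where f = real_of_int] abs_minus_commute)
    have "\<bar>(\<Sum>x\<in>Y n. real_of_int \<bar>c n (g \<otimes> h) x - ?u h' x\<bar>) - (\<Sum>x\<in>Y n. real_of_int \<bar>?u h x - ?u h' x\<bar>)\<bar>
        \<le> \<delta> n g h * N n"
      using sum_abs_diff[where n = n and u = "c n (g \<otimes> h)" and w = "?u h'" and v = "?u h"] almost[OF that(1,2), of n]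
      by (rule order_trans)
    then have "\<bar>(\<Sum>x\<in>Y n. real_of_int \<bar>?u h' x - c n (g \<otimes> h) x\<bar>) - (\<Sum>x\<in>Y n. real_of_int \<bar>?u h x - ?u h' x\<bar>)\<bar> / N n
        \<le> \<delta> n g h"
      unfolding flip[of "c n (g \<otimes> h)" "?u h'"] pos_divide_le_eq[OF N] .
    then have "\<bar>Dn n g h' (g \<otimes> h) - \<psi>n n h h'\<bar> \<le> \<delta> n g h"
      unfolding eq Dn_def diff_divide_distrib[symmetric] abs_divide abs_of_pos[OF N] .
    moreover have "\<bar>\<psi>n n (g \<otimes> h) (g \<otimes> h') - Dn n g h' (g \<otimes> h)\<bar> \<le> \<delta> n g h'"
      using Dn_near[OF that(1,3), of n "g \<otimes> h"] by (simp only: \<psi>n_sym)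
    ultimately show ?thesis by linarith
  qed
  have left: "\<psi> (g \<otimes> h) (g \<otimes> h') = \<psi> h h'"
    if "g \<in> carrier G" "h \<in> carrier G" "h' \<in> carrier G" for g h h'
  proof -
    have "(\<lambda>n. \<psi>n (k n) (g \<otimes> h) (g \<otimes> h') - \<psi>n (k n) h h') \<longlonglongrightarrow> 0"
    proof (rule Lim_null_comparison)
      show "(\<lambda>n. \<delta> (k n) g h + \<delta> (k n) g h') \<longlonglongrightarrow> 0"
        using tendsto_add[OF \<delta>k[OF that(1,2)] \<delta>k[OF that(1,3)]] by simp
    qed (simp add: left_n[OF that])
    moreover have "(\<lambda>n. \<psi>n (k n) (g \<otimes> h) (g \<otimes> h') - \<psi>n (k n) h h') \<longlonglongrightarrow> \<psi> (g \<otimes> h) (g \<otimes> h') - \<psi> h h'"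
      by (intro tendsto_diff \<psi> m_closed that)
    ultimately have "\<psi> (g \<otimes> h) (g \<otimes> h') - \<psi> h h' = 0" by (rule LIMSEQ_unique[rotated])
    then show ?thesis by simp
  qed
  have sym: "\<psi> g h = \<psi> h g" for g h
    unfolding \<psi>_def by (simp only: \<psi>n_sym[of _ h g] conj_commute)
  have diag: "\<psi> g g = 0" if "g \<in> carrier G" for g
  proof -
    have "(\<lambda>n. \<psi>n (k n) g g) = (\<lambda>n. 0)" by (simp add: \<psi>n_def)
    then show ?thesis using \<psi>[OF that that] by (simp add: LIMSEQ_const_iff)
  qed
  have neg: "(\<Sum>i<p. \<Sum>j<p. t i * t j * \<psi> (x i) (x j)) \<le> 0"
    if x: "\<And>i. i < p \<Longrightarrow> x i \<in> carrier G" and t: "(\<Sum>i<p. t i) = 0"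
    for p :: nat and t :: "nat \<Rightarrow> real" and x
  proof (rule LIMSEQ_le_const2)
    show "(\<lambda>n. \<Sum>i<p. \<Sum>j<p. t i * t j * \<psi>n (k n) (x i) (x j)) \<longlonglongrightarrow> (\<Sum>i<p. \<Sum>j<p. t i * t j * \<psi> (x i) (x j))"
      by (intro tendsto_sum tendsto_mult_left \<psi> x) simp_all
    have "(\<Sum>i<p. \<Sum>j<p. t i * t j * \<psi>n n (x i) (x j)) \<le> 0" for n
    proof -
      have "(\<Sum>i<p. \<Sum>j<p. t i * t j * \<psi>n n (x i) (x j)) =
          (\<Sum>i<p. \<Sum>j<p. \<Sum>y\<in>Y n. t i * t j * real_of_int \<bar>c n (x i) y - c n (x j) y\<bar>) / N n"
        by (simp only: \<psi>n_def sum_distrib_left sum_divide_distrib times_divide_eq_right)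
      also have "(\<Sum>i<p. \<Sum>j<p. \<Sum>y\<in>Y n. t i * t j * real_of_int \<bar>c n (x i) y - c n (x j) y\<bar>) =
          (\<Sum>i<p. \<Sum>y\<in>Y n. \<Sum>j<p. t i * t j * real_of_int \<bar>c n (x i) y - c n (x j) y\<bar>)"
        by (intro sum.cong[OF refl] sum.swap)
      also have "\<dots> = (\<Sum>y\<in>Y n. \<Sum>i<p. \<Sum>j<p. t i * t j * real_of_int \<bar>c n (x i) y - c n (x j) y\<bar>)"
        by (rule sum.swap)
      also have "\<dots> / N n \<le> 0"
        by (intro divide_nonpos_nonneg sum_nonpos N0 int_distance_negative_type[OF t])
      finally show ?thesis .
    qed
    then show "\<exists>M. \<forall>n\<ge>M. (\<Sum>i<p. \<Sum>j<p. t i * t j * \<psi>n (k n) (x i) (x j)) \<le> 0" by blast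
  qed
  obtain R where R: "\<And>\<epsilon>. 0 < \<epsilon> \<Longrightarrow> \<exists>p (w :: nat \<Rightarrow> real) x.
    (\<forall>m<p. x m \<in> carrier G) \<and> (\<Sum>m<p. w m) = 1 \<and>
    combination_spread \<psi> p w x \<le> R \<and>
    (\<forall>g\<in>carrier G. combination_displacement \<psi> g p w x \<le> \<epsilon>)"
    using property_T_approximate_fixed_point[OF T sym diag left neg] by blast
  define R' where "R' = \<bar>R\<bar> + 1"
  define C where "C = real (card S) + 1"
  have C: "0 < C" "real (card S) \<le> C" by (simp_all add: C_def)
  have R': "0 < R'" "R < R'" by (simp_all add: R'_def)
  \<comment> \<open>Rounding costs \<open>3 * (9 * l * R' + 2 * \<epsilon>1 / (2 * l))\<close> for each of at most \<open>C\<close> elements of \<open>S\<close>. The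
    constant \<open>l\<close> makes the first term at most half of \<open>\<epsilon>\<close>, and then \<open>\<epsilon>1\<close> the second.\<close>
  define l where "l = min (1/6) (\<epsilon> / (54 * C * R'))"
  have l: "0 < l" "l \<le> 1/6" using C R' \<epsilon> by (simp_all add: l_def)
  have lCR: "27 * C * l * R' \<le> \<epsilon> / 2"
  proof -
    have "l \<le> \<epsilon> / (54 * C * R')" by (simp add: l_def)
    then have "l * (54 * C * R') \<le> \<epsilon>" using C R' by (simp add: pos_le_divide_eq)
    then show ?thesis by (simp add: mult_ac)
  qed
  define \<epsilon>1 where "\<epsilon>1 = \<epsilon> * l / (6 * C)"
  have \<epsilon>1: "0 < \<epsilon>1" using \<epsilon> l C by (simp add: \<epsilon>1_def)
  obtain p and w :: "nat \<Rightarrow> real" and x where x: "\<And>m. m < p \<Longrightarrow> x m \<in> carrier G"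
    and w: "(\<Sum>m<p. w m) = 1"
    and U: "combination_spread \<psi> p w x \<le> R"
    and E: "\<And>g. g \<in> carrier G \<Longrightarrow> combination_displacement \<psi> g p w x \<le> \<epsilon>1"
    using R[OF \<epsilon>1] by blast
  define spread where "spread n = (\<Sum>m<p. \<Sum>i<p. w m * w i *
    ((\<psi>n n (x m) \<one> + \<psi>n n \<one> (x i) - \<psi>n n (x m) (x i)) / 2))" for n
  define defect where "defect n g = (\<Sum>m<p. \<Sum>i<p. w m * w i *
    ((Dn n g (x i) (x m) + Dn n g (x m) (x i) - \<psi>n n (x m) (x i) - \<psi>n n (x m) (x i)) / 2))" for n g
  have "(\<lambda>n. spread (k n)) \<longlonglongrightarrow> combination_spread \<psi> p w x"
    unfolding spread_def by (intro tendsto_sum tendsto_mult_left tendsto_divide tendsto_add tendsto_diff tendsto_const \<psi> x one_closed) simp_all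
  then have evU: "eventually (\<lambda>n. spread (k n) < R') sequentially"
    by (rule order_tendstoD(2)) (use U R' in linarith)
  have evE: "eventually (\<lambda>n. defect (k n) g < 2 * \<epsilon>1) sequentially" if g: "g \<in> carrier G" for g
  proof (rule order_tendstoD(2))
    show "(\<lambda>n. defect (k n) g) \<longlonglongrightarrow> (\<Sum>m<p. \<Sum>i<p. w m * w i *
      ((\<psi> (g \<otimes> x i) (x m) + \<psi> (g \<otimes> x m) (x i) - \<psi> (x m) (x i) - \<psi> (x m) (x i)) / 2))"
      unfolding defect_def
      by (intro tendsto_sum tendsto_mult_left tendsto_divide tendsto_add tendsto_diff tendsto_const \<psi> Dn_lim x g) simp_all
    have "(\<Sum>m<p. \<Sum>i<p. w m * w i *
      ((\<psi> (g \<otimes> x i) (x m) + \<psi> (g \<otimes> x m) (x i) - \<psi> (x m) (x i) - \<psi> (x m) (x i)) / 2)) =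
      combination_displacement \<psi> g p w x"
    proof (intro sum.cong refl)
      fix m i assume "m \<in> {..<p}" "i \<in> {..<p}"
      then have "\<psi> (g \<otimes> x m) (g \<otimes> x i) = \<psi> (x m) (x i)" by (intro left g x) simp_all
      then show "w m * w i * ((\<psi> (g \<otimes> x i) (x m) + \<psi> (g \<otimes> x m) (x i) - \<psi> (x m) (x i) - \<psi> (x m) (x i)) / 2) =
        w m * w i * ((\<psi> (g \<otimes> x m) (x i) + \<psi> (x m) (g \<otimes> x i) - \<psi> (g \<otimes> x m) (g \<otimes> x i) - \<psi> (x m) (x i)) / 2)"
        using sym[of "g \<otimes> x i" "x m"] by simp
    qed
    then show "(\<Sum>m<p. \<Sum>i<p. w m * w i *
      ((\<psi> (g \<otimes> x i) (x m) + \<psi> (g \<otimes> x m) (x i) - \<psi> (x m) (x i) - \<psi> (x m) (x i)) / 2)) < 2 * \<epsilon>1"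
      using E[OF g] \<epsilon>1 by linarith
  qed
  have "eventually (\<lambda>n. spread (k n) < R' \<and> (\<forall>s\<in>S. defect (k n) s < 2 * \<epsilon>1) \<and> n0 \<le> n) sequentially"
    using S by (intro eventually_conj evU eventually_ball_finite ballI evE eventually_ge_at_top) auto
  then obtain n where n: "spread (k n) < R'" "\<And>s. s \<in> S \<Longrightarrow> defect (k n) s < 2 * \<epsilon>1" "n0 \<le> n"
    unfolding eventually_sequentially by blast
  define q where "q = k n"
  have q: "n0 \<le> q" using n(3) seq_suble[OF k, of n] by (simp add: q_def)
  \<comment> \<open>Interchange the sum over \<open>Y q\<close> with the quadratic forms in the weights.\<close>
  have pull: "(\<Sum>y\<in>Y q. \<Sum>m<p. \<Sum>i<p. w m * w i * (real_of_int (A m i y) / 2)) =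
      N q * (\<Sum>m<p. \<Sum>i<p. w m * w i * ((\<Sum>y\<in>Y q. real_of_int (A m i y)) / N q / 2))" for A
  proof -
    have "(\<Sum>y\<in>Y q. \<Sum>m<p. \<Sum>i<p. w m * w i * (real_of_int (A m i y) / 2)) =
      (\<Sum>m<p. \<Sum>y\<in>Y q. \<Sum>i<p. w m * w i * (real_of_int (A m i y) / 2))" by (rule sum.swap)
    also have "\<dots> = (\<Sum>m<p. \<Sum>i<p. \<Sum>y\<in>Y q. w m * w i * (real_of_int (A m i y) / 2))"
      by (intro sum.cong[OF refl] sum.swap)
    also have "\<dots> = (\<Sum>m<p. \<Sum>i<p. N q * (w m * w i * ((\<Sum>y\<in>Y q. real_of_int (A m i y)) / N q / 2)))"
      using N[of q] by (intro sum.cong refl) (simp add: sum_distrib_left sum_divide_distrib)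
    finally show ?thesis by (simp only: sum_distrib_left)
  qed
  have Uq: "(\<Sum>y\<in>Y q. \<Sum>m<p. \<Sum>i<p. w m * w i *
      ((\<bar>c q (x m) y - c q \<one> y\<bar> + \<bar>c q \<one> y - c q (x i) y\<bar> - \<bar>c q (x m) y - c q (x i) y\<bar>) / 2)) = N q * spread q"
    unfolding pull spread_def \<psi>n_def
    by (simp only: sum.distrib sum_subtractf of_int_add of_int_diff add_divide_distrib diff_divide_distrib)
  have Eq: "(\<Sum>y\<in>Y q. \<Sum>m<p. \<Sum>i<p. w m * w i *
      ((\<bar>c q (x m) y - (c q s y + c q (x i) (act q s y))\<bar> + \<bar>c q s y + c q (x m) (act q s y) - c q (x i) y\<bar>
       - \<bar>c q (x m) y - c q (x i) y\<bar> - \<bar>c q (x m) (act q s y) - c q (x i) (act q s y)\<bar>) / 2)) = N q * defect q s"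
    if s: "s \<in> S" for s
  proof -
    have sG: "s \<in> carrier G" using s S by blast
    have 1: "(\<Sum>y\<in>Y q. real_of_int \<bar>c q (x m) (act q s y) - c q (x i) (act q s y)\<bar>) =
      (\<Sum>y\<in>Y q. real_of_int \<bar>c q (x m) y - c q (x i) y\<bar>)" for m i
      by (rule sum.reindex_bij_betw[OF act[OF sG]])
    have 2: "\<bar>c q (x m) y - (c q s y + c q (x i) (act q s y))\<bar> = \<bar>c q s y + c q (x i) (act q s y) - c q (x m) y\<bar>" for m i y
      by (rule abs_minus_commute)
    show ?thesis
      unfolding pull 2 defect_def \<psi>n_def Dn_def
      by (simp only: sum.distrib sum_subtractf of_int_add of_int_diff add_divide_distrib diff_divide_distrib 1)
  qed
  obtain f :: "'x \<Rightarrow> int" where f: "(\<Sum>s\<in>S. \<Sum>y\<in>Y q. real_of_int \<bar>c q s y - (f (act q s y) - f y)\<bar>)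
    \<le> 3 * (\<Sum>s\<in>S. 9 * l * (N q * spread q) + N q * defect q s / (2 * l))"
  proof -
    have "bij_betw (act q s) (Y q) (Y q)" if "s \<in> S" for s using S that by (intro act) blast
    from integral_rounding[where act = "act q" and a = "c q" and z = "\<lambda>m. c q (x m)" and ?z0.0 = "c q \<one>",
        OF Y[of q] S(1) this w l, unfolded Uq]
    obtain f :: "'x \<Rightarrow> int" where f: "(\<Sum>s\<in>S. \<Sum>y\<in>Y q. real_of_int \<bar>c q s y - (f (act q s y) - f y)\<bar>)
      \<le> 3 * (\<Sum>s\<in>S. 9 * l * (N q * spread q) + (\<Sum>y\<in>Y q. \<Sum>m<p. \<Sum>i<p. w m * w i *
      ((\<bar>c q (x m) y - (c q s y + c q (x i) (act q s y))\<bar> + \<bar>c q s y + c q (x m) (act q s y) - c q (x i) y\<bar>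
       - \<bar>c q (x m) y - c q (x i) y\<bar> - \<bar>c q (x m) (act q s y) - c q (x i) (act q s y)\<bar>) / 2)) / (2 * l))" ..
    also have "\<dots> = 3 * (\<Sum>s\<in>S. 9 * l * (N q * spread q) + N q * defect q s / (2 * l))"
      by (intro arg_cong[where f = "(*) 3"] sum.cong refl) (simp only: Eq)
    finally show ?thesis by (rule that)
  qed
  note f
  also have "3 * (\<Sum>s\<in>S. 9 * l * (N q * spread q) + N q * defect q s / (2 * l)) \<le>
      3 * (\<Sum>s\<in>S. 9 * l * (N q * R') + N q * (2 * \<epsilon>1) / (2 * l))"
    using n(1,2) l N0[of q]
    by (intro mult_left_mono sum_mono add_mono divide_right_mono) (simp_all add: q_def less_imp_le)
  also have "\<dots> = real (card S) * (N q * (27 * l * R' + 3 * \<epsilon>1 / l))"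
    using l by (simp add: field_simps)
  also have "\<dots> \<le> C * (N q * (27 * l * R' + 3 * \<epsilon>1 / l))"
    using C l R' \<epsilon>1 N0[of q] by (intro mult_right_mono) auto
  also have "\<dots> = N q * (27 * C * l * R' + \<epsilon> / 2)"
    using C l by (simp add: \<epsilon>1_def field_simps)
  also have "\<dots> \<le> N q * (\<epsilon> / 2 + \<epsilon> / 2)"
    using lCR N0[of q] by (intro mult_left_mono add_mono) auto
  also have "\<dots> = \<epsilon> * N q" by (simp add: mult.commute)
  finally show ?thesis using q by blast
qed

section \<open>Modules over group rings and additive functionals\<close>

text \<open>Identities in the modules are tested on additive maps to the integers. For free modules these
separate points (lemma \<open>eq_if_functionals_agree\<close>), and computations with them are ordinary integer sums.\<close>

definition additive_functional :: "('a, 'm, 'z) module_scheme \<Rightarrow> ('m \<Rightarrow> int) \<Rightarrow> bool"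
  where "additive_functional M f \<longleftrightarrow>
    (\<forall>x\<in>carrier M. \<forall>y\<in>carrier M. f (x \<oplus>\<^bsub>M\<^esub> y) = f x + f y)"

lemma additive_functional_add:
  "\<lbrakk>additive_functional M f; x \<in> carrier M; y \<in> carrier M\<rbrakk> \<Longrightarrow> f (x \<oplus>\<^bsub>M\<^esub> y) = f x + f y"
  by (simp add: additive_functional_def)

text \<open>The value at \<open>a\<close> of the additive map from the group ring to the integers with values \<open>v\<close> on the group.\<close>

definition pairing :: "('g \<Rightarrow> int) \<Rightarrow> ('g \<Rightarrow> int) \<Rightarrow> int"
  where "pairing a v = (\<Sum>g\<in>{g. a g \<noteq> 0}. a g * v g)"

lemma pairing_eq_sum:
  assumes "finite S" "{g. a g \<noteq> 0} \<subseteq> S"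
  shows "pairing a v = (\<Sum>g\<in>S. a g * v g)"
  unfolding pairing_def using assms by (intro sum.mono_neutral_left) auto

lemma pairing_add:
  assumes "finite {g. a g \<noteq> 0}" "finite {g. b g \<noteq> 0}"
  shows "pairing (\<lambda>g. a g + b g) v = pairing a v + pairing b v"
proof -
  let ?S = "{g. a g \<noteq> 0} \<union> {g. b g \<noteq> 0}"
  have S: "finite ?S" using assms by simp
  have "pairing (\<lambda>g. a g + b g) v = (\<Sum>g\<in>?S. (a g + b g) * v g)"
    by (rule pairing_eq_sum[OF S]) auto
  moreover have "pairing a v = (\<Sum>g\<in>?S. a g * v g)" by (rule pairing_eq_sum[OF S]) auto
  moreover have "pairing b v = (\<Sum>g\<in>?S. b g * v g)" by (rule pairing_eq_sum[OF S]) auto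
  ultimately show ?thesis by (simp add: distrib_right sum.distrib)
qed

lemma pairing_of: "pairing (group_ring_of g) v = v g"
  by (subst pairing_eq_sum[of "{g}"]) (auto simp: group_ring_of_def)

lemma int_additive_eq:
  fixes f :: "int \<Rightarrow> int"
  assumes f: "\<And>m n. f (m + n) = f m + f n"
  shows "f n = n * f 1"
proof (induction n rule: int_induct[where k = 0])
  case base
  show ?case using f[of 0 0] by simp
next
  case (step1 i)
  then show ?case using f[of i 1] by (simp add: algebra_simps)
next
  case (step2 i)
  then show ?case using f[of "i - 1" 1] by (simp add: algebra_simps)
qed

locale group_ring_module = Group.group G for G :: "('g, 'b) monoid_scheme" (structure) +
  fixes M :: "('g \<Rightarrow> int, 'm) module"
  assumes left_module: "left_module (group_ring G) M"
begin

sublocale M: left_module "group_ring G" M by (rule left_module)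

definition translate :: "'g \<Rightarrow> 'm \<Rightarrow> 'm"
  where "translate g y = group_ring_of g \<odot>\<^bsub>M\<^esub> y"

lemma translate_closed: "\<lbrakk>g \<in> carrier G; y \<in> carrier M\<rbrakk> \<Longrightarrow> translate g y \<in> carrier M"
  unfolding translate_def by (rule M.smult_closed[OF group_ring_of_closed])

lemma translate_mult:
  "\<lbrakk>g \<in> carrier G; h \<in> carrier G; y \<in> carrier M\<rbrakk> \<Longrightarrow> translate (g \<otimes> h) y = translate g (translate h y)"
  unfolding translate_def by (simp add: group_ring_of_mult M.smult_assoc group_ring_of_closed)

lemma translate_one: "y \<in> carrier M \<Longrightarrow> translate \<one> y = y"
proof -
  have "group_ring_of \<one> = \<one>\<^bsub>group_ring G\<^esub>" by (simp add: group_ring_of_def group_ring_def)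
  then show "y \<in> carrier M \<Longrightarrow> translate \<one> y = y" by (simp add: translate_def M.smult_one)
qed

lemma additive_translate:
  assumes "additive_functional M f" "g \<in> carrier G"
  shows "additive_functional M (\<lambda>y. f (translate g y))"
  unfolding additive_functional_def
proof (intro ballI)
  fix x y assume "x \<in> carrier M" "y \<in> carrier M"
  then show "f (translate g (x \<oplus>\<^bsub>M\<^esub> y)) = f (translate g x) + f (translate g y)"
    using assms translate_closed[OF assms(2)]
    by (simp add: translate_def M.smult_r_distr group_ring_of_closed additive_functional_add)
qed

text \<open>Scalars are integer combinations of group elements, so an additive map is known on \<open>a \<odot>\<^bsub>M\<^esub> y\<close> as soon as
it is known on the translates of \<open>y\<close>. Induction over the support of \<open>a\<close>.\<close>

lemma additive_smult:
  assumes f: "additive_functional M f" and a: "a \<in> carrier (group_ring G)" and y: "y \<in> carrier M"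
  shows "f (a \<odot>\<^bsub>M\<^esub> y) = pairing a (\<lambda>g. f (translate g y))"
proof -
  have add: "f ((\<lambda>g. a g + b g) \<odot>\<^bsub>M\<^esub> y) = f (a \<odot>\<^bsub>M\<^esub> y) + f (b \<odot>\<^bsub>M\<^esub> y)"
    if "a \<in> carrier (group_ring G)" "b \<in> carrier (group_ring G)" for a b
  proof -
    have "(a \<oplus>\<^bsub>group_ring G\<^esub> b) \<odot>\<^bsub>M\<^esub> y = a \<odot>\<^bsub>M\<^esub> y \<oplus>\<^bsub>M\<^esub> b \<odot>\<^bsub>M\<^esub> y"
      using that y by (rule M.smult_l_distr)
    moreover have "a \<oplus>\<^bsub>group_ring G\<^esub> b = (\<lambda>g. a g + b g)" by (simp add: group_ring_def)
    ultimately show ?thesis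
      using f that y by (simp add: additive_functional_add M.smult_closed)
  qed
  \<comment> \<open>The element \<open>n s\<close> of the group ring.\<close>
  define single where "single s n = (\<lambda>g::'g. if g = s then n else 0 :: int)" for s n
  have single_closed: "single s n \<in> carrier (group_ring G)" if "s \<in> carrier G" for s n
    using that by (auto simp: single_def group_ring_def)
  have single: "f (single s n \<odot>\<^bsub>M\<^esub> y) = n * f (translate s y)" if s: "s \<in> carrier G" for s n
  proof -
    have "f (single s n \<odot>\<^bsub>M\<^esub> y) = n * f (single s 1 \<odot>\<^bsub>M\<^esub> y)"
    proof (rule int_additive_eq)
      fix m n
      have "single s (m + n) = (\<lambda>g. single s m g + single s n g)" by (simp add: single_def fun_eq_iff)
      then show "f (single s (m + n) \<odot>\<^bsub>M\<^esub> y) = f (single s m \<odot>\<^bsub>M\<^esub> y) + f (single s n \<odot>\<^bsub>M\<^esub> y)"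
        using add[OF single_closed[OF s] single_closed[OF s]] by simp
    qed
    moreover have "single s 1 = group_ring_of s" by (simp add: single_def group_ring_of_def)
    ultimately show ?thesis by (simp add: translate_def)
  qed
  have "{g. a g \<noteq> 0} \<subseteq> S \<Longrightarrow> f (a \<odot>\<^bsub>M\<^esub> y) = (\<Sum>g\<in>S. a g * f (translate g y))"
    if "finite S" "S \<subseteq> carrier G" "a \<in> carrier (group_ring G)" for S a
    using that
  proof (induction S arbitrary: a rule: finite_induct)
    case empty
    then have "(\<lambda>g. a g + a g) = a" by (simp add: fun_eq_iff)
    then show ?case using add[OF empty.prems(3) empty.prems(3)] by simp
  next
    case (insert s S)
    define a' where "a' = a(s := 0)"
    have s: "s \<in> carrier G" and S: "S \<subseteq> carrier G" using insert.prems by auto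
    have a': "a' \<in> carrier (group_ring G)"
      using insert.prems(3) by (auto simp: a'_def group_ring_def intro: rev_finite_subset)
    have eq: "a = (\<lambda>g. single s (a s) g + a' g)" by (simp add: a'_def single_def fun_eq_iff)
    have "f (a \<odot>\<^bsub>M\<^esub> y) = a s * f (translate s y) + f (a' \<odot>\<^bsub>M\<^esub> y)"
      using add[OF single_closed[OF s] a', of "a s"] single[OF s] eq by simp
    also have "f (a' \<odot>\<^bsub>M\<^esub> y) = (\<Sum>g\<in>S. a' g * f (translate g y))"
    proof (rule insert.IH[OF _ S a'])
      show "{g. a' g \<noteq> 0} \<subseteq> S" using insert.prems(1) by (auto simp: a'_def)
    qed
    also have "\<dots> = (\<Sum>g\<in>S. a g * f (translate g y))"
      using insert.hyps(2) by (intro sum.cong refl) (auto simp: a'_def)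
    finally show ?case using insert.hyps by simp
  qed
  from this[OF _ _ a subset_refl] a show ?thesis by (simp add: pairing_def group_ring_def)
qed

lemma additive_zero:
  assumes "additive_functional M f" shows "f \<zero>\<^bsub>M\<^esub> = 0"
  using additive_functional_add[OF assms, of "\<zero>\<^bsub>M\<^esub>" "\<zero>\<^bsub>M\<^esub>"] by simp

lemma additive_finsum:
  assumes f: "additive_functional M f" and B: "finite B" and u: "u \<in> B \<rightarrow> carrier M"
  shows "f (\<Oplus>\<^bsub>M\<^esub>b\<in>B. u b) = (\<Sum>b\<in>B. f (u b))"
  using B u
proof (induction B rule: finite_induct)
  case empty
  then show ?case by (simp add: additive_zero[OF f])
next
  case (insert b B)
  have u: "u \<in> B \<rightarrow> carrier M" "u b \<in> carrier M" using insert.prems by auto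
  have "(\<Oplus>\<^bsub>M\<^esub>b\<in>insert b B. u b) = u b \<oplus>\<^bsub>M\<^esub> (\<Oplus>\<^bsub>M\<^esub>b\<in>B. u b)"
    using insert.hyps u by (rule M.M.finsum_insert)
  then show ?case
    using insert.IH[OF u(1)] insert.hyps u M.M.finsum_closed[OF u(1)]
    by (simp add: additive_functional_add[OF f])
qed

text \<open>The multiple \<open>n x\<close> is the product of \<open>x\<close> with the scalar \<open>n\<close> of the group ring. The combination is described
by its values under additive maps, since these are all that later arguments use.\<close>

lemma integer_combination:
  assumes J: "finite J" and m: "\<And>j. j \<in> J \<Longrightarrow> m j \<in> carrier M"
  shows "\<exists>p\<in>carrier M. \<forall>f. additive_functional M f \<longrightarrow> f p = (\<Sum>j\<in>J. n j * f (m j))"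
  using J m
proof (induction J rule: finite_induct)
  case empty
  then show ?case by (intro bexI[of _ "\<zero>\<^bsub>M\<^esub>"]) (auto simp: additive_zero)
next
  case (insert j J)
  then obtain p where p: "p \<in> carrier M" "\<And>f. additive_functional M f \<Longrightarrow> f p = (\<Sum>j\<in>J. n j * f (m j))"
    by auto
  define a where "a = (\<lambda>g. if g = \<one> then n j else 0)"
  have a: "a \<in> carrier (group_ring G)" by (auto simp: a_def group_ring_def)
  have mj: "m j \<in> carrier M" using insert.prems by simp
  have "f (a \<odot>\<^bsub>M\<^esub> m j) = n j * f (m j)" if "additive_functional M f" for f
  proof -
    have "f (a \<odot>\<^bsub>M\<^esub> m j) = (\<Sum>g\<in>{\<one>}. a g * f (translate g (m j)))"
      unfolding additive_smult[OF that a mj] by (rule pairing_eq_sum) (auto simp: a_def)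
    then show ?thesis by (simp add: a_def translate_one[OF mj])
  qed
  then show ?case
    using p insert.hyps M.smult_closed[OF a mj]
    by (intro bexI[of _ "a \<odot>\<^bsub>M\<^esub> m j \<oplus>\<^bsub>M\<^esub> p"]) (auto simp: additive_functional_add)
qed

end

locale free_group_ring_module = group_ring_module G M
  for G :: "('g, 'b) monoid_scheme" (structure) and M :: "('g \<Rightarrow> int, 'm) module" +
  fixes B :: "'m set"
  assumes basis: "finite_basis (group_ring G) M B"
begin

lemma finite_B: "finite B" and B_closed: "b \<in> B \<Longrightarrow> b \<in> carrier M"
  using basis by (auto simp: finite_basis_def)

definition coords :: "'m \<Rightarrow> 'm \<Rightarrow> 'g \<Rightarrow> int"
  where "coords y = (THE c. c \<in> B \<rightarrow>\<^sub>E carrier (group_ring G) \<and> y = (\<Oplus>\<^bsub>M\<^esub>b\<in>B. c b \<odot>\<^bsub>M\<^esub> b))"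

lemma coords:
  assumes "y \<in> carrier M"
  shows "coords y \<in> B \<rightarrow>\<^sub>E carrier (group_ring G)" "y = (\<Oplus>\<^bsub>M\<^esub>b\<in>B. coords y b \<odot>\<^bsub>M\<^esub> b)"
proof -
  have "\<exists>!c. c \<in> B \<rightarrow>\<^sub>E carrier (group_ring G) \<and> y = (\<Oplus>\<^bsub>M\<^esub>b\<in>B. c b \<odot>\<^bsub>M\<^esub> b)"
    using basis assms unfolding finite_basis_def by blast
  from theI'[OF this] show "coords y \<in> B \<rightarrow>\<^sub>E carrier (group_ring G)"
    "y = (\<Oplus>\<^bsub>M\<^esub>b\<in>B. coords y b \<odot>\<^bsub>M\<^esub> b)" unfolding coords_def by blast+
qed

lemma coords_unique:
  assumes c: "\<And>b. b \<in> B \<Longrightarrow> c b \<in> carrier (group_ring G)" and b: "b \<in> B"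
  shows "coords (\<Oplus>\<^bsub>M\<^esub>b\<in>B. c b \<odot>\<^bsub>M\<^esub> b) b = c b"
proof -
  let ?y = "\<Oplus>\<^bsub>M\<^esub>b\<in>B. c b \<odot>\<^bsub>M\<^esub> b"
  have y: "?y \<in> carrier M"
    using c B_closed by (intro M.M.finsum_closed) (auto intro: M.smult_closed)
  have "?y = (\<Oplus>\<^bsub>M\<^esub>b\<in>B. (restrict c B) b \<odot>\<^bsub>M\<^esub> b)"
    using c B_closed by (intro M.M.finsum_cong') (auto intro: M.smult_closed)
  moreover have "restrict c B \<in> B \<rightarrow>\<^sub>E carrier (group_ring G)" using c by auto
  moreover have "\<exists>!c. c \<in> B \<rightarrow>\<^sub>E carrier (group_ring G) \<and> ?y = (\<Oplus>\<^bsub>M\<^esub>b\<in>B. c b \<odot>\<^bsub>M\<^esub> b)"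
    using basis y unfolding finite_basis_def by blast
  ultimately have "coords ?y = restrict c B" using coords[OF y] by blast
  then show ?thesis using b by simp
qed

lemma coords_closed: "\<lbrakk>y \<in> carrier M; b \<in> B\<rbrakk> \<Longrightarrow> coords y b \<in> carrier (group_ring G)"
  using coords(1) by blast

lemma coords_finite: "\<lbrakk>y \<in> carrier M; b \<in> B\<rbrakk> \<Longrightarrow> finite {g. coords y b g \<noteq> 0}"
  and coords_supp: "\<lbrakk>y \<in> carrier M; b \<in> B; coords y b g \<noteq> 0\<rbrakk> \<Longrightarrow> g \<in> carrier G"
  using coords_closed[of y b] by (auto simp: group_ring_def)

lemma additive_expand:
  assumes f: "additive_functional M f" and y: "y \<in> carrier M"
  shows "f y = (\<Sum>b\<in>B. pairing (coords y b) (\<lambda>g. f (translate g b)))"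
proof -
  have "f y = f (\<Oplus>\<^bsub>M\<^esub>b\<in>B. coords y b \<odot>\<^bsub>M\<^esub> b)" using coords(2)[OF y] by simp
  also have "\<dots> = (\<Sum>b\<in>B. f (coords y b \<odot>\<^bsub>M\<^esub> b))"
    using coords_closed[OF y] B_closed
    by (intro additive_finsum[OF f finite_B]) (auto intro: M.smult_closed)
  also have "\<dots> = (\<Sum>b\<in>B. pairing (coords y b) (\<lambda>g. f (translate g b)))"
    using coords_closed[OF y] B_closed by (intro sum.cong refl additive_smult[OF f])
  finally show ?thesis .
qed

lemma coords_add:
  assumes x: "x \<in> carrier M" and y: "y \<in> carrier M" and b: "b \<in> B"
  shows "coords (x \<oplus>\<^bsub>M\<^esub> y) b = (\<lambda>g. coords x b g + coords y b g)"
proof -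
  have cl: "coords x b \<odot>\<^bsub>M\<^esub> b \<in> carrier M" "coords y b \<odot>\<^bsub>M\<^esub> b \<in> carrier M" if "b \<in> B" for b
    using that coords_closed x y B_closed by (auto intro: M.smult_closed)
  have "x \<oplus>\<^bsub>M\<^esub> y = (\<Oplus>\<^bsub>M\<^esub>b\<in>B. coords x b \<odot>\<^bsub>M\<^esub> b) \<oplus>\<^bsub>M\<^esub> (\<Oplus>\<^bsub>M\<^esub>b\<in>B. coords y b \<odot>\<^bsub>M\<^esub> b)"
    using coords(2)[OF x] coords(2)[OF y] by simp
  also have "\<dots> = (\<Oplus>\<^bsub>M\<^esub>b\<in>B. coords x b \<odot>\<^bsub>M\<^esub> b \<oplus>\<^bsub>M\<^esub> coords y b \<odot>\<^bsub>M\<^esub> b)"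
    using cl by (intro M.M.finsum_addf[symmetric]) auto
  also have "\<dots> = (\<Oplus>\<^bsub>M\<^esub>b\<in>B. (coords x b \<oplus>\<^bsub>group_ring G\<^esub> coords y b) \<odot>\<^bsub>M\<^esub> b)"
    using coords_closed x y B_closed
    by (intro M.M.finsum_cong') (auto simp: M.smult_l_distr intro!: M.M.a_closed M.smult_closed)
  finally have "coords (x \<oplus>\<^bsub>M\<^esub> y) b = coords x b \<oplus>\<^bsub>group_ring G\<^esub> coords y b"
    using coords_closed x y b by (simp add: coords_unique group_ring_add_closed)
  then show ?thesis by (simp add: group_ring_def)
qed

lemma coords_translate_basis:
  assumes g: "g \<in> carrier G" and b: "b \<in> B" and b': "b' \<in> B"
  shows "coords (translate g b) b' = (if b' = b then group_ring_of g else (\<lambda>_. 0))"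
proof -
  let ?c = "\<lambda>b'. if b' = b then group_ring_of g else (\<lambda>_. 0)"
  have zero: "(\<lambda>_. 0) \<in> carrier (group_ring G)" "(\<lambda>_. 0) = \<zero>\<^bsub>group_ring G\<^esub>" by (auto simp: group_ring_def)
  have z: "(\<lambda>_. 0) \<odot>\<^bsub>M\<^esub> x = \<zero>\<^bsub>M\<^esub>" if x: "x \<in> carrier M" for x
  proof -
    have cl: "(\<lambda>_. 0) \<odot>\<^bsub>M\<^esub> x \<in> carrier M" using zero x by (intro M.smult_closed)
    have "(\<lambda>_. 0) \<odot>\<^bsub>M\<^esub> x \<oplus>\<^bsub>M\<^esub> (\<lambda>_. 0) \<odot>\<^bsub>M\<^esub> x = (\<lambda>_. 0) \<odot>\<^bsub>M\<^esub> x"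
      using M.smult_l_distr[OF zero(1) zero(1) x] by (simp add: group_ring_def)
    then show ?thesis using cl by (simp add: M.M.add.l_cancel_one')
  qed
  have "translate g b = (\<Oplus>\<^bsub>M\<^esub>b'\<in>B. if b = b' then translate g b' else \<zero>\<^bsub>M\<^esub>)"
    using finite_B b g B_closed by (intro M.M.finsum_singleton[symmetric]) (auto intro: translate_closed)
  also have "\<dots> = (\<Oplus>\<^bsub>M\<^esub>b'\<in>B. ?c b' \<odot>\<^bsub>M\<^esub> b')"
    using g B_closed z by (intro M.M.finsum_cong') (auto simp: translate_def intro!: M.smult_closed group_ring_of_closed zero)
  finally have "coords (translate g b) b' = coords (\<Oplus>\<^bsub>M\<^esub>b'\<in>B. ?c b' \<odot>\<^bsub>M\<^esub> b') b'" by simp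
  also have "\<dots> = ?c b'" using g b' zero by (intro coords_unique) (auto intro: group_ring_of_closed)
  finally show ?thesis .
qed

text \<open>The coefficients in a basis are themselves additive maps to the integers.\<close>

lemma eq_if_functionals_agree:
  assumes x: "x \<in> carrier M" and y: "y \<in> carrier M"
    and agree: "\<And>f. additive_functional M f \<Longrightarrow> f x = f y"
  shows "x = y"
proof -
  have "coords x b g = coords y b g" if "b \<in> B" for b g
    by (rule agree[of "\<lambda>y. coords y b g"]) (simp add: additive_functional_def coords_add[OF _ _ that])
  then have "coords x b = coords y b" if "b \<in> B" for b using that by (simp add: fun_eq_iff)
  then have "coords x = coords y" using coords(1)[OF x] coords(1)[OF y] by (rule PiE_ext[rotated 2])
  then show ?thesis using coords(2)[OF x] coords(2)[OF y] by simp
qed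

text \<open>As an abelian group, \<open>M\<close> is free on the translates of the basis.\<close>

lemma free_extension:
  obtains f where "additive_functional M f"
    "\<And>b g. \<lbrakk>b \<in> B; g \<in> carrier G\<rbrakk> \<Longrightarrow> f (translate g b) = v b g"
proof
  let ?f = "\<lambda>y. \<Sum>b\<in>B. pairing (coords y b) (v b)"
  show "additive_functional M ?f"
    unfolding additive_functional_def
    by (simp add: coords_add pairing_add coords_finite sum.distrib)
  fix b g assume b: "b \<in> B" and g: "g \<in> carrier G"
  have "?f (translate g b) = (\<Sum>b'\<in>B. if b' = b then v b' g else 0)"
  proof (rule sum.cong[OF refl])
    fix b' assume b': "b' \<in> B"
    have "pairing (\<lambda>_. 0) (v b') = 0" by (simp add: pairing_def)
    then show "pairing (coords (translate g b) b') (v b') = (if b' = b then v b' g else 0)"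
      by (simp add: coords_translate_basis[OF g b b'] pairing_of)
  qed
  then show "?f (translate g b) = v b g" using finite_B b by simp
qed

end

section \<open>Cochains and sums over cosets\<close>

context Group.group
begin

definition coset_rep :: "'a set \<Rightarrow> 'a"
  where "coset_rep K = (SOME t. t \<in> K)"

lemma coset_rep:
  assumes H: "subgroup H G" and K: "K \<in> rcosets H"
  shows "coset_rep K \<in> carrier G" "H #> coset_rep K = K"
proof -
  obtain g where g: "g \<in> carrier G" "K = H #> g" using K by (auto simp: RCOSETS_def)
  have "g \<in> K" using rcos_self[OF g(1) H] g by simp
  then have mem: "coset_rep K \<in> K" unfolding coset_rep_def by (rule someI)
  then show "coset_rep K \<in> carrier G" using g r_coset_subset_G[OF subgroup.subset[OF H] g(1)] by blast
  show "H #> coset_rep K = K" using repr_independence[OF _ g(1) H] mem g(2) by simp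
qed

text \<open>\<open>G\<close> acts from the right on the right cosets of \<open>H\<close>. On functions on \<open>G\<close> that are invariant under left
multiplication by \<open>H\<close> this is the left action by \<open>(g f)(t) = f (t \<otimes> g)\<close>.\<close>

lemma rcosets_translation:
  assumes H: "subgroup H G" and g: "g \<in> carrier G"
  shows "bij_betw (\<lambda>K. K #> g) (rcosets H) (rcosets H)"
proof -
  have sub: "K \<subseteq> carrier G" if "K \<in> rcosets H" for K
    using that r_coset_subset_G[OF subgroup.subset[OF H]] by (auto simp: RCOSETS_def)
  have closed: "K #> g \<in> rcosets H" if K: "K \<in> rcosets H" and g: "g \<in> carrier G" for K g
  proof -
    have "K #> g = H #> (coset_rep K \<otimes> g)"
      using coset_mult_assoc[OF subgroup.subset[OF H] coset_rep(1)[OF H K] g] coset_rep(2)[OF H K] by simp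
    then show ?thesis using coset_rep(1)[OF H K] g by (auto simp: RCOSETS_def)
  qed
  have "K #> g #> inv g = K" "K #> inv g #> g = K" if "K \<in> rcosets H" for K
    using coset_mult_assoc[OF sub[OF that]] coset_mult_one[OF sub[OF that]] g by simp_all
  then show ?thesis
    using closed g by (intro bij_betw_byWitness[where f' = "\<lambda>K. K #> inv g"]) auto
qed

lemma coset_rep_translate:
  assumes H: "subgroup H G" and K: "K \<in> rcosets H" and g: "g \<in> carrier G"
    and u: "\<And>h t. \<lbrakk>h \<in> H; t \<in> carrier G\<rbrakk> \<Longrightarrow> u (h \<otimes> t) = u t"
  shows "u (coset_rep (K #> g)) = u (coset_rep K \<otimes> g)"
proof -
  have Kg: "K #> g \<in> rcosets H" using bij_betwE[OF rcosets_translation[OF H g]] K by blast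
  note r = coset_rep[OF H K] and rg = coset_rep[OF H Kg]
  have "K #> g = H #> (coset_rep K \<otimes> g)"
    using coset_mult_assoc[OF subgroup.subset[OF H] r(1) g] r(2) by simp
  then have "coset_rep (K #> g) \<in> H #> (coset_rep K \<otimes> g)"
    using rcos_self[OF rg(1) H] rg(2) by simp
  then obtain h where "h \<in> H" "coset_rep (K #> g) = h \<otimes> (coset_rep K \<otimes> g)"
    by (auto simp: r_coset_def)
  then show ?thesis using u r(1) g by simp
qed

end

context group_ring_module
begin

lemma cochain_additive:
  "\<phi> \<in> cochains G H M \<Longrightarrow> additive_functional M \<phi>"
  by (auto simp: cochains_def left_module_hom_def additive_functional_def trivial_module_def)

lemma cochain_invariant:
  assumes \<phi>: "\<phi> \<in> cochains G H M" and h: "h \<in> H" and y: "y \<in> carrier M"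
  shows "\<phi> (translate h y) = \<phi> y"
proof -
  have "group_ring_of h \<in> carrier (group_ring (G\<lparr>carrier := H\<rparr>))"
    using h by (auto simp: group_ring_of_def group_ring_def)
  then have "\<phi> (translate h y) = group_ring_of h \<odot>\<^bsub>trivial_module\<^esub> \<phi> y"
    using \<phi> y unfolding cochains_def left_module_hom_def translate_def by blast
  then show ?thesis by (simp add: trivial_module_def group_ring_of_def)
qed

text \<open>Invariance under \<open>H\<close> is enough for linearity over its group ring, because the scalars act on the integers
through the augmentation.\<close>

lemma cochainI:
  assumes H: "subgroup H G" and f: "additive_functional M f"
    and inv: "\<And>h y. \<lbrakk>h \<in> H; y \<in> carrier M\<rbrakk> \<Longrightarrow> f (translate h y) = f y"
  shows "restrict f (carrier M) \<in> cochains G H M"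
proof -
  have "f (a \<odot>\<^bsub>M\<^esub> y) = (\<Sum>g\<in>{g. a g \<noteq> 0}. a g) * f y"
    if a: "a \<in> carrier (group_ring (G\<lparr>carrier := H\<rparr>))" and y: "y \<in> carrier M" for a y
  proof -
    have aH: "{g. a g \<noteq> 0} \<subseteq> H" using a by (simp add: group_ring_def)
    have aG: "a \<in> carrier (group_ring G)"
      using a subgroup.subset[OF H] by (auto simp: group_ring_def)
    have "f (a \<odot>\<^bsub>M\<^esub> y) = (\<Sum>g\<in>{g. a g \<noteq> 0}. a g * f (translate g y))"
      using additive_smult[OF f aG y] by (simp add: pairing_def)
    also have "\<dots> = (\<Sum>g\<in>{g. a g \<noteq> 0}. a g * f y)"
      using aH inv[OF _ y] by (intro sum.cong refl) auto
    finally show ?thesis by (simp add: sum_distrib_right)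
  qed
  moreover have "a \<in> carrier (group_ring G)" if "a \<in> carrier (group_ring (G\<lparr>carrier := H\<rparr>))" for a
    using that subgroup.subset[OF H] by (auto simp: group_ring_def)
  ultimately show ?thesis
    using f M.smult_closed
    by (auto simp: cochains_def left_module_hom_def trivial_module_def additive_functional_def)
qed

lemma cochain_translation_invariant:
  assumes H: "subgroup H G" and \<phi>: "\<phi> \<in> cochains G H M" and y: "y \<in> carrier M"
    and h: "h \<in> H" and t: "t \<in> carrier G"
  shows "\<phi> (translate (h \<otimes> t) y) = \<phi> (translate t y)"
  using cochain_invariant[OF \<phi> h translate_closed[OF t y]] translate_mult[OF _ t y] subgroup.subset[OF H] h
  by auto

abbreviation orbit_norm :: "'g set \<Rightarrow> ('m \<Rightarrow> int) \<Rightarrow> 'm \<Rightarrow> real"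
  where "orbit_norm H \<phi> y \<equiv> (\<Sum>K\<in>rcosets H. real_of_int \<bar>\<phi> (translate (coset_rep K) y)\<bar>)"

lemma l1_norm_eq:
  "l1_norm G H M B \<phi> = (\<Sum>K\<in>rcosets H. \<Sum>b\<in>B. real_of_int \<bar>\<phi> (translate (coset_rep K) b)\<bar>)"
  by (simp add: l1_norm_def translate_def coset_rep_def)

lemma l1_norm_nonneg: "0 \<le> l1_norm G H M B \<phi>"
  unfolding l1_norm_eq by (intro sum_nonneg) simp

lemma additive_hom:
  assumes N: "left_module (group_ring G) N" and d: "d \<in> left_module_hom (group_ring G) M N"
    and f: "additive_functional N f"
  shows "additive_functional M (\<lambda>y. f (d y))"
  using d f unfolding left_module_hom_def additive_functional_def by (simp add: Pi_iff)

lemma hom_translate: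
  assumes N: "left_module (group_ring G) N" and d: "d \<in> left_module_hom (group_ring G) M N"
    and g: "g \<in> carrier G" and y: "y \<in> carrier M"
  shows "d (translate g y) = group_ring_module.translate N g (d y)"
proof -
  interpret N: group_ring_module G N
    by (intro group_ring_module.intro group_ring_module_axioms.intro is_group N)
  show ?thesis
    using d y group_ring_of_closed[OF g] unfolding left_module_hom_def translate_def N.translate_def by blast
qed

end

context free_group_ring_module
begin

text \<open>Expand \<open>y\<close> in translates of the basis. Translating a basis element only permutes the cosets, so each
term contributes at most the norm of \<open>\<phi>\<close>; the constant is the \<open>\<ell>\<^sup>1\<close>-norm of the coefficients of \<open>y\<close>,
which does not involve \<open>H\<close>.\<close>

lemma cochain_value_bound:
  assumes y: "y \<in> carrier M"
  shows "\<exists>C\<ge>0. \<forall>H \<phi>. subgroup H G \<longrightarrow> finite (rcosets H) \<longrightarrow> \<phi> \<in> cochains G H M \<longrightarrow>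
    orbit_norm H \<phi> y \<le> C * l1_norm G H M B \<phi>"
proof -
  let ?S = "\<lambda>b. {g. coords y b g \<noteq> 0}"
  define C where "C = (\<Sum>b\<in>B. \<Sum>g\<in>?S b. real_of_int \<bar>coords y b g\<bar>)"
  have "orbit_norm H \<phi> y \<le> C * l1_norm G H M B \<phi>"
    if H: "subgroup H G" and fin: "finite (rcosets H)" and \<phi>: "\<phi> \<in> cochains G H M" for H \<phi>
  proof -
    have one: "orbit_norm H \<phi> (translate g b) \<le> l1_norm G H M B \<phi>"
      if b: "b \<in> B" and g: "g \<in> carrier G" for b g
    proof -
      have "orbit_norm H \<phi> (translate g b) =
          (\<Sum>K\<in>rcosets H. real_of_int \<bar>\<phi> (translate (coset_rep (K #> g)) b)\<bar>)"
      proof (rule sum.cong[OF refl])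
        fix K assume K: "K \<in> rcosets H"
        have "\<phi> (translate (coset_rep (K #> g)) b) = \<phi> (translate (coset_rep K \<otimes> g) b)"
          by (rule coset_rep_translate[OF H K g, where u = "\<lambda>t. \<phi> (translate t b)"])
             (rule cochain_translation_invariant[OF H \<phi> B_closed[OF b]])
        also have "\<dots> = \<phi> (translate (coset_rep K) (translate g b))"
          using translate_mult[OF coset_rep(1)[OF H K] g B_closed[OF b]] by simp
        finally show "real_of_int \<bar>\<phi> (translate (coset_rep K) (translate g b))\<bar> =
          real_of_int \<bar>\<phi> (translate (coset_rep (K #> g)) b)\<bar>" by simp
      qed
      also have "\<dots> = orbit_norm H \<phi> b"
        by (rule sum.reindex_bij_betw[OF rcosets_translation[OF H g]])
      also have "\<dots> \<le> l1_norm G H M B \<phi>"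
        unfolding l1_norm_eq
        by (rule sum_mono, rule member_le_sum[OF b _ finite_B]) simp
      finally show ?thesis .
    qed
    have "orbit_norm H \<phi> y \<le>
      (\<Sum>K\<in>rcosets H. \<Sum>b\<in>B. \<Sum>g\<in>?S b. real_of_int \<bar>coords y b g\<bar> *
        real_of_int \<bar>\<phi> (translate (coset_rep K) (translate g b))\<bar>)"
    proof (rule sum_mono)
      fix K assume K: "K \<in> rcosets H"
      have "\<phi> (translate (coset_rep K) y) =
          (\<Sum>b\<in>B. \<Sum>g\<in>?S b. coords y b g * \<phi> (translate (coset_rep K) (translate g b)))"
        unfolding additive_expand[OF additive_translate[OF cochain_additive[OF \<phi>] coset_rep(1)[OF H K]] y]
        by (simp add: pairing_def)
      then have "real_of_int \<bar>\<phi> (translate (coset_rep K) y)\<bar> =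
          \<bar>\<Sum>b\<in>B. \<Sum>g\<in>?S b. real_of_int (coords y b g) * real_of_int (\<phi> (translate (coset_rep K) (translate g b)))\<bar>"
        by simp
      also have "\<dots> \<le> (\<Sum>b\<in>B. \<bar>\<Sum>g\<in>?S b. real_of_int (coords y b g) * real_of_int (\<phi> (translate (coset_rep K) (translate g b)))\<bar>)"
        by (rule sum_abs)
      also have "\<dots> \<le> (\<Sum>b\<in>B. \<Sum>g\<in>?S b. \<bar>real_of_int (coords y b g) * real_of_int (\<phi> (translate (coset_rep K) (translate g b)))\<bar>)"
        by (intro sum_mono sum_abs)
      finally show "real_of_int \<bar>\<phi> (translate (coset_rep K) y)\<bar> \<le> (\<Sum>b\<in>B. \<Sum>g\<in>?S b. real_of_int \<bar>coords y b g\<bar> *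
        real_of_int \<bar>\<phi> (translate (coset_rep K) (translate g b))\<bar>)" by (simp add: abs_mult)
    qed
    also have "\<dots> = (\<Sum>b\<in>B. \<Sum>K\<in>rcosets H. \<Sum>g\<in>?S b. real_of_int \<bar>coords y b g\<bar> *
        real_of_int \<bar>\<phi> (translate (coset_rep K) (translate g b))\<bar>)" by (rule sum.swap)
    also have "\<dots> = (\<Sum>b\<in>B. \<Sum>g\<in>?S b. \<Sum>K\<in>rcosets H. real_of_int \<bar>coords y b g\<bar> *
        real_of_int \<bar>\<phi> (translate (coset_rep K) (translate g b))\<bar>)"
      by (rule sum.cong[OF refl], rule sum.swap)
    also have "\<dots> = (\<Sum>b\<in>B. \<Sum>g\<in>?S b. real_of_int \<bar>coords y b g\<bar> *
        orbit_norm H \<phi> (translate g b))"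
      by (simp only: sum_distrib_left)
    also have "\<dots> \<le> (\<Sum>b\<in>B. \<Sum>g\<in>?S b. real_of_int \<bar>coords y b g\<bar> * l1_norm G H M B \<phi>)"
      by (intro sum_mono mult_left_mono one) (auto intro: coords_supp[OF y])
    also have "\<dots> = C * l1_norm G H M B \<phi>" by (simp only: C_def sum_distrib_right)
    finally show ?thesis .
  qed
  moreover have "0 \<le> C" unfolding C_def by (intro sum_nonneg) simp
  ultimately show ?thesis by blast
qed

end

section \<open>Free partial resolutions of length two\<close>

text \<open>The modules \<open>F 0\<close>, \<open>F 1\<close> and \<open>F 2\<close> are used as separate constants, so the index 1 has to keep its form.\<close>

declare One_nat_def [simp del]

locale free_two_step_resolution = Group.group G for G :: "('g, 'b) monoid_scheme" (structure) +
  fixes F :: "nat \<Rightarrow> ('g \<Rightarrow> int, 'm) module" and d :: "nat \<Rightarrow> 'm \<Rightarrow> 'm" and e :: "'m \<Rightarrow> int"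
    and B :: "nat \<Rightarrow> 'm set"
  assumes resolution: "partial_resolution G 2 F d e"
    and bases: "i \<le> 2 \<Longrightarrow> finite_basis (group_ring G) (F i) (B i)"
begin

lemma modules: "i \<le> 2 \<Longrightarrow> left_module (group_ring G) (F i)"
  using resolution by (simp add: partial_resolution_def)

lemma free_modules: "i \<le> 2 \<Longrightarrow> free_group_ring_module G (F i) (B i)"
  by (intro free_group_ring_module.intro group_ring_module.intro group_ring_module_axioms.intro
      free_group_ring_module_axioms.intro is_group modules bases)

sublocale F0: free_group_ring_module G "F 0" "B 0" by (rule free_modules) simp
sublocale F1: free_group_ring_module G "F 1" "B 1" by (rule free_modules) simp
sublocale F2: free_group_ring_module G "F 2" "B 2" by (rule free_modules) simp

lemma d1_hom: "d 1 \<in> left_module_hom (group_ring G) (F 1) (F 0)"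
  and d2_hom: "d 2 \<in> left_module_hom (group_ring G) (F 2) (F 1)"
proof -
  have "\<forall>i<2. d (Suc i) \<in> left_module_hom (group_ring G) (F (Suc i)) (F i)"
    using resolution unfolding partial_resolution_def by blast
  from spec[OF this, of 0] spec[OF this, of 1]
  show "d 1 \<in> left_module_hom (group_ring G) (F 1) (F 0)"
    and "d 2 \<in> left_module_hom (group_ring G) (F 2) (F 1)" by (simp_all add: numeral_2_eq_2 One_nat_def)
qed

lemma d1_closed: "y \<in> carrier (F 1) \<Longrightarrow> d 1 y \<in> carrier (F 0)"
  and d2_closed: "z \<in> carrier (F 2) \<Longrightarrow> d 2 z \<in> carrier (F 1)"
  using d1_hom d2_hom by (auto simp: left_module_hom_def)

lemma exact:
  shows "d 1 ` carrier (F 1) = {x \<in> carrier (F 0). e x = 0}"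
    and "d 2 ` carrier (F 2) = {y \<in> carrier (F 1). d 1 y = \<zero>\<^bsub>F 0\<^esub>}"
proof -
  have 1: "0 < (2::nat) \<longrightarrow> d 1 ` carrier (F 1) = a_kernel (F 0) (trivial_module :: ('g \<Rightarrow> int, int) module) e"
    and 2: "\<forall>i. Suc i < 2 \<longrightarrow> d (Suc (Suc i)) ` carrier (F (Suc (Suc i))) = a_kernel (F (Suc i)) (F i) (d (Suc i))"
    using resolution unfolding partial_resolution_def by blast+
  show "d 1 ` carrier (F 1) = {x \<in> carrier (F 0). e x = 0}"
    using 1 by (simp add: a_kernel_def' trivial_module_def)
  show "d 2 ` carrier (F 2) = {y \<in> carrier (F 1). d 1 y = \<zero>\<^bsub>F 0\<^esub>}"
    using spec[OF 2, of 0] by (simp add: a_kernel_def' numeral_2_eq_2 One_nat_def)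
qed

lemma e_hom: "e \<in> left_module_hom (group_ring G) (F 0) trivial_module" and e_surj: "e ` carrier (F 0) = UNIV"
  using resolution by (simp_all add: partial_resolution_def)

lemma e_additive: "additive_functional (F 0) e"
  using e_hom by (auto simp: left_module_hom_def additive_functional_def trivial_module_def)

lemma e_translate:
  assumes g: "g \<in> carrier G" and x: "x \<in> carrier (F 0)"
  shows "e (F0.translate g x) = e x"
proof -
  have "e (F0.translate g x) = group_ring_of g \<odot>\<^bsub>trivial_module\<^esub> e x"
    using e_hom group_ring_of_closed[OF g] x unfolding left_module_hom_def F0.translate_def by blast
  then show ?thesis by (simp add: trivial_module_def group_ring_of_def)
qed

lemma d1_translate:
  "\<lbrakk>g \<in> carrier G; y \<in> carrier (F 1)\<rbrakk> \<Longrightarrow> d 1 (F1.translate g y) = F0.translate g (d 1 y)"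
  by (rule F1.hom_translate[OF F0.left_module d1_hom])

lemma d2_translate:
  "\<lbrakk>g \<in> carrier G; z \<in> carrier (F 2)\<rbrakk> \<Longrightarrow> d 2 (F2.translate g z) = F1.translate g (d 2 z)"
  by (rule F2.hom_translate[OF F1.left_module d2_hom])

lemma additive_d1: "additive_functional (F 0) f \<Longrightarrow> additive_functional (F 1) (\<lambda>y. f (d 1 y))"
  by (rule F1.additive_hom[OF F0.left_module d1_hom])

lemma additive_d2: "additive_functional (F 1) f \<Longrightarrow> additive_functional (F 2) (\<lambda>z. f (d 2 z))"
  by (rule F2.additive_hom[OF F1.left_module d2_hom])

lemma boundary0:
  assumes x: "x \<in> carrier (F 0)" and "e x = 0"
  obtains y where "y \<in> carrier (F 1)" "d 1 y = x"
proof -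
  have "x \<in> d 1 ` carrier (F 1)" unfolding exact(1) using assms by simp
  then show ?thesis by (rule imageE) (rule that, simp_all)
qed

text \<open>Exactness at \<open>F 1\<close>, with the condition of being a cycle tested on additive maps.\<close>

lemma boundary1:
  assumes y: "y \<in> carrier (F 1)" and cycle: "\<forall>f. additive_functional (F 0) f \<longrightarrow> f (d 1 y) = 0"
  obtains z where "z \<in> carrier (F 2)" "d 2 z = y"
proof -
  have "d 1 y = \<zero>\<^bsub>F 0\<^esub>"
    by (rule F0.eq_if_functionals_agree[OF d1_closed[OF y] F0.M.M.zero_closed])
       (simp add: cycle F0.additive_zero)
  then have "y \<in> d 2 ` carrier (F 2)" unfolding exact(2) using y by simp
  then show ?thesis by (rule imageE) (rule that, simp_all)
qed

definition basepoint :: 'm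
  where "basepoint = (SOME x. x \<in> carrier (F 0) \<and> e x = 1)"

lemma basepoint: "basepoint \<in> carrier (F 0)" "e basepoint = 1"
proof -
  have "\<exists>x. x \<in> carrier (F 0) \<and> e x = 1" using e_surj by (metis UNIV_I imageE)
  from someI_ex[OF this] show "basepoint \<in> carrier (F 0)" "e basepoint = 1"
    unfolding basepoint_def by blast+
qed

lemma lift_exists:
  assumes x: "x \<in> carrier (F 0)"
  shows "\<exists>y. y \<in> carrier (F 1) \<and> (\<forall>f. additive_functional (F 0) f \<longrightarrow>
    f (d 1 y) = f x - e x * f basepoint)"
proof -
  define m where "m i = (if i = (0::nat) then x else basepoint)" for i
  have "m i \<in> carrier (F 0)" for i using basepoint(1) x by (simp add: m_def)
  then obtain p where p: "p \<in> carrier (F 0)"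
    "\<And>f. additive_functional (F 0) f \<Longrightarrow> f p = (\<Sum>i\<in>{0,1}. (if i = 0 then 1 else - e x) * f (m i))"
    using F0.integer_combination[of "{0,1}" m "\<lambda>i. if i = 0 then 1 else - e x"] by auto
  have fp: "f p = f x - e x * f basepoint" if "additive_functional (F 0) f" for f
    using p(2)[OF that] by (simp add: m_def)
  have "e p = 0" using fp[OF e_additive] basepoint(2) by simp
  from boundary0[OF p(1) this] show ?thesis using fp by metis
qed

text \<open>An element of \<open>F 1\<close> with boundary \<open>x - e x * basepoint\<close>. Chosen on a basis of \<open>F 0\<close>, such elements amount
to a contracting homotopy in the lowest degree.\<close>

definition lift :: "'m \<Rightarrow> 'm"
  where "lift x = (SOME y. y \<in> carrier (F 1) \<and> (\<forall>f. additive_functional (F 0) f \<longrightarrow>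
    f (d 1 y) = f x - e x * f basepoint))"

lemma lift:
  assumes x: "x \<in> carrier (F 0)"
  shows "lift x \<in> carrier (F 1)"
    and "additive_functional (F 0) f \<Longrightarrow> f (d 1 (lift x)) = f x - e x * f basepoint"
  using someI_ex[OF lift_exists[OF x], folded lift_def] by blast+

text \<open>A path from the base point to its translate by \<open>g\<close>, in the language of a complex on which \<open>G\<close> acts.\<close>

definition link :: "'g \<Rightarrow> 'm"
  where "link g = lift (F0.translate g basepoint)"

lemma link:
  assumes g: "g \<in> carrier G"
  shows "link g \<in> carrier (F 1)"
    and "additive_functional (F 0) f \<Longrightarrow> f (d 1 (link g)) = f (F0.translate g basepoint) - f basepoint"
  using lift[OF F0.translate_closed[OF g basepoint(1)]] e_translate[OF g basepoint(1)] basepoint(2)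
  by (simp_all add: link_def)

text \<open>The three links form a closed triangle, which is filled by exactness at \<open>F 1\<close>.\<close>

lemma link_cocycle_defect:
  assumes g: "g \<in> carrier G" and h: "h \<in> carrier G"
  shows "\<exists>z\<in>carrier (F 2). \<forall>f. additive_functional (F 1) f \<longrightarrow>
    f (d 2 z) = f (link (g \<otimes> h)) - f (link g) - f (F1.translate g (link h))"
proof -
  have gh: "g \<otimes> h \<in> carrier G" using g h by simp
  define m where "m i = (if i = (0::nat) then link (g \<otimes> h) else if i = 1 then link g else F1.translate g (link h))" for i
  have "m i \<in> carrier (F 1)" for i
    using link(1)[OF g] link(1)[OF gh] F1.translate_closed[OF g link(1)[OF h]] by (simp add: m_def)
  then obtain p where p: "p \<in> carrier (F 1)"
    "\<And>f. additive_functional (F 1) f \<Longrightarrow> f p = (\<Sum>i\<in>{0,1,2}. (if i = 0 then 1 else -1) * f (m i))"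
    using F1.integer_combination[of "{0,1,2}" m "\<lambda>i. if i = 0 then 1 else -1"] by auto
  have fp: "f p = f (link (g \<otimes> h)) - f (link g) - f (F1.translate g (link h))"
    if "additive_functional (F 1) f" for f
    using p(2)[OF that] by (simp add: m_def)
  have "f (d 1 p) = 0" if f: "additive_functional (F 0) f" for f
  proof -
    have "f (d 1 (F1.translate g (link h))) = f (F0.translate g (d 1 (link h)))"
      by (simp add: d1_translate[OF g link(1)[OF h]])
    also have "\<dots> = f (F0.translate g (F0.translate h basepoint)) - f (F0.translate g basepoint)"
      by (rule link(2)[OF h F0.additive_translate[OF f g]])
    finally show ?thesis
      using fp[OF additive_d1[OF f]] link(2)[OF g f] link(2)[OF gh f]
        F0.translate_mult[OF g h basepoint(1)] by simp
  qed
  then have "\<forall>f. additive_functional (F 0) f \<longrightarrow> f (d 1 p) = 0" by blast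
  from boundary1[OF p(1) this] obtain z where z: "z \<in> carrier (F 2)" "d 2 z = p" .
  show ?thesis
    by (rule bexI[OF _ z(1)], intro allI impI) (simp only: z(2) fp)
qed

text \<open>The group elements in the matrix of \<open>d 1\<close>. Only for these has the almost cocycle to be approximated.\<close>

definition support :: "'g set"
  where "support = (\<Union>a\<in>B 1. \<Union>b\<in>B 0. {g. F0.coords (d 1 a) b g \<noteq> 0})"

text \<open>The image of \<open>d 1 a\<close> under the map from \<open>F 0\<close> to the group ring that sends each basis element \<open>b\<close> to \<open>e b\<close>.\<close>

definition weight :: "'m \<Rightarrow> 'g \<Rightarrow> int"
  where "weight a g = (\<Sum>b\<in>B 0. e b * F0.coords (d 1 a) b g)"

lemma finite_support: "finite support" and support_closed: "support \<subseteq> carrier G"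
  using F0.coords_finite[OF d1_closed[OF F1.B_closed]] F0.coords_supp[OF d1_closed[OF F1.B_closed]]
    F0.finite_B F1.finite_B unfolding support_def by auto

lemma expand_over_support:
  assumes a: "a \<in> B 1" and f: "additive_functional (F 0) f"
  shows "f (d 1 a) = (\<Sum>b\<in>B 0. \<Sum>g\<in>support. F0.coords (d 1 a) b g * f (F0.translate g b))"
  unfolding F0.additive_expand[OF f d1_closed[OF F1.B_closed[OF a]]]
  by (intro sum.cong refl pairing_eq_sum[OF finite_support]) (use a in \<open>auto simp: support_def\<close>)

text \<open>The augmentation of the image of \<open>d 1 a\<close> in the group ring is \<open>e (d 1 a)\<close>. This makes sums over \<open>support\<close>
with these weights insensitive to constants.\<close>

lemma weight_sum_eq_0:
  assumes a: "a \<in> B 1"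
  shows "(\<Sum>g\<in>support. weight a g) = 0"
proof -
  have "d 1 a \<in> {x \<in> carrier (F 0). e x = 0}"
    unfolding exact(1)[symmetric] by (rule imageI[OF F1.B_closed[OF a]])
  then have "e (d 1 a) = 0" by simp
  moreover have "e (d 1 a) = (\<Sum>b\<in>B 0. \<Sum>g\<in>support. F0.coords (d 1 a) b g * e (F0.translate g b))"
    by (rule expand_over_support[OF a e_additive])
  moreover have "\<dots> = (\<Sum>b\<in>B 0. \<Sum>g\<in>support. e b * F0.coords (d 1 a) b g)"
    using support_closed F0.B_closed by (intro sum.cong refl) (auto simp: e_translate)
  moreover have "\<dots> = (\<Sum>g\<in>support. weight a g)" unfolding weight_def by (rule sum.swap)
  ultimately show ?thesis by simp
qed

text \<open>Apply the homotopy \<open>lift\<close> to \<open>d 1 a\<close> term by term and account for the base points by the links. The result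
has the same boundary as \<open>a\<close>, so it differs from \<open>a\<close> by the image of an element of \<open>F 2\<close>.\<close>

lemma basis_element_decomposition:
  assumes a: "a \<in> B 1"
  shows "\<exists>z\<in>carrier (F 2). \<forall>f. additive_functional (F 1) f \<longrightarrow>
    f a = (\<Sum>b\<in>B 0. \<Sum>g\<in>support. F0.coords (d 1 a) b g * f (F1.translate g (lift b)))
      + (\<Sum>g\<in>support. weight a g * f (link g)) + f (d 2 z)"
proof -
  let ?r = "F0.coords (d 1 a)"
  have sG: "g \<in> carrier G" if "g \<in> support" for g using that support_closed by blast
  obtain p1 where p1: "p1 \<in> carrier (F 1)" "\<And>f. additive_functional (F 1) f \<Longrightarrow>
      f p1 = (\<Sum>(b, g)\<in>B 0 \<times> support. ?r b g * f (F1.translate g (lift b)))"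
    using F1.integer_combination[of "B 0 \<times> support" "\<lambda>(b, g). F1.translate g (lift b)" "\<lambda>(b, g). ?r b g"]
      F0.finite_B finite_support F1.translate_closed[OF sG lift(1)[OF F0.B_closed]] by (auto simp: split_def)
  obtain p2 where p2: "p2 \<in> carrier (F 1)" "\<And>f. additive_functional (F 1) f \<Longrightarrow>
      f p2 = (\<Sum>g\<in>support. weight a g * f (link g))"
    using F1.integer_combination[of support link "weight a"] finite_support link(1)[OF sG] by auto
  define m where "m i = (if i = (0::nat) then a else if i = 1 then p1 else p2)" for i
  have "m i \<in> carrier (F 1)" for i using F1.B_closed[OF a] p1(1) p2(1) by (simp add: m_def)
  then obtain p where p: "p \<in> carrier (F 1)"
    "\<And>f. additive_functional (F 1) f \<Longrightarrow> f p = (\<Sum>i\<in>{0,1,2}. (if i = 0 then 1 else -1) * f (m i))"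
    using F1.integer_combination[of "{0,1,2}" m "\<lambda>i. if i = 0 then 1 else -1"] by auto
  have fp: "f p = f a - (\<Sum>b\<in>B 0. \<Sum>g\<in>support. ?r b g * f (F1.translate g (lift b)))
      - (\<Sum>g\<in>support. weight a g * f (link g))" if "additive_functional (F 1) f" for f
    using p(2)[OF that] p1(2)[OF that] p2(2)[OF that] by (simp add: m_def sum.cartesian_product)
  have "f (d 1 p) = 0" if f: "additive_functional (F 0) f" for f
  proof -
    have fill: "f (d 1 (F1.translate g (lift b))) = f (F0.translate g b) - e b * f (F0.translate g basepoint)"
      if "g \<in> support" "b \<in> B 0" for g b
      using lift(2)[OF F0.B_closed[OF that(2)] F0.additive_translate[OF f sG[OF that(1)]]]
        d1_translate[OF sG[OF that(1)] lift(1)[OF F0.B_closed[OF that(2)]]] by simp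
    have "(\<Sum>b\<in>B 0. \<Sum>g\<in>support. ?r b g * f (d 1 (F1.translate g (lift b)))) =
        (\<Sum>b\<in>B 0. \<Sum>g\<in>support. ?r b g * f (F0.translate g b) - e b * ?r b g * f (F0.translate g basepoint))"
      by (intro sum.cong refl) (simp add: fill algebra_simps)
    also have "\<dots> = f (d 1 a) - (\<Sum>b\<in>B 0. \<Sum>g\<in>support. e b * ?r b g * f (F0.translate g basepoint))"
      unfolding expand_over_support[OF a f] by (simp only: sum_subtractf)
    also have "(\<Sum>b\<in>B 0. \<Sum>g\<in>support. e b * ?r b g * f (F0.translate g basepoint)) =
        (\<Sum>g\<in>support. weight a g * f (F0.translate g basepoint))"
      unfolding weight_def sum_distrib_right by (rule sum.swap)
    finally have 1: "(\<Sum>b\<in>B 0. \<Sum>g\<in>support. ?r b g * f (d 1 (F1.translate g (lift b)))) =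
      f (d 1 a) - (\<Sum>g\<in>support. weight a g * f (F0.translate g basepoint))" .
    have "(\<Sum>g\<in>support. weight a g * f (d 1 (link g))) =
        (\<Sum>g\<in>support. weight a g * f (F0.translate g basepoint) - weight a g * f basepoint)"
      by (intro sum.cong refl) (simp add: link(2)[OF sG f] right_diff_distrib)
    also have "\<dots> = (\<Sum>g\<in>support. weight a g * f (F0.translate g basepoint))"
      by (simp add: sum_subtractf weight_sum_eq_0[OF a] flip: sum_distrib_right)
    finally have 2: "(\<Sum>g\<in>support. weight a g * f (d 1 (link g))) =
      (\<Sum>g\<in>support. weight a g * f (F0.translate g basepoint))" .
    show ?thesis using fp[OF additive_d1[OF f]] 1 2 by simp
  qed
  then have "\<forall>f. additive_functional (F 0) f \<longrightarrow> f (d 1 p) = 0" by blast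
  from boundary1[OF p(1) this] obtain z where z: "z \<in> carrier (F 2)" "d 2 z = p" .
  show ?thesis
  proof (rule bexI[OF _ z(1)], intro allI impI)
    fix f assume f: "additive_functional (F 1) f"
    show "f a = (\<Sum>b\<in>B 0. \<Sum>g\<in>support. ?r b g * f (F1.translate g (lift b)))
      + (\<Sum>g\<in>support. weight a g * f (link g)) + f (d 2 z)"
      unfolding z(2) fp[OF f] by simp
  qed
qed

end

section \<open>Uniformly bounded primitives\<close>

context free_two_step_resolution
begin

abbreviation coboundary :: "('m \<Rightarrow> int) \<Rightarrow> 'm \<Rightarrow> int"
  where "coboundary \<equiv> coboundary_map F d 1"

lemma coboundary_eq: "coboundary \<phi> = (\<lambda>z\<in>carrier (F 2). \<phi> (d 2 z))"
  by (simp add: coboundary_map_def compose_def)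

lemma coboundary_cochain:
  assumes H: "subgroup H G" and \<phi>: "\<phi> \<in> cochains G H (F 1)"
  shows "coboundary \<phi> \<in> cochains G H (F 2)"
  unfolding coboundary_eq
proof (rule F2.cochainI[OF H])
  show "additive_functional (F 2) (\<lambda>z. \<phi> (d 2 z))"
    by (rule additive_d2[OF F1.cochain_additive[OF \<phi>]])
  fix h z assume h: "h \<in> H" and z: "z \<in> carrier (F 2)"
  have "h \<in> carrier G" using h subgroup.subset[OF H] by blast
  then show "\<phi> (d 2 (F2.translate h z)) = \<phi> (d 2 z)"
    using F1.cochain_invariant[OF \<phi> h d2_closed[OF z]] z by (simp add: d2_translate)
qed

text \<open>On images of elements of \<open>F 2\<close> the values of a cochain are values of its coboundary.\<close>

lemma coboundary_value_bound:
  assumes z: "z \<in> carrier (F 2)"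
  shows "\<exists>C\<ge>0. \<forall>H \<phi>. subgroup H G \<longrightarrow> finite (rcosets H) \<longrightarrow> \<phi> \<in> cochains G H (F 1) \<longrightarrow>
    F1.orbit_norm H \<phi> (d 2 z)
      \<le> C * l1_norm G H (F 2) (B 2) (coboundary \<phi>)"
proof -
  obtain C where C: "0 \<le> C" and bound: "\<And>H \<eta>. \<lbrakk>subgroup H G; finite (rcosets H); \<eta> \<in> cochains G H (F 2)\<rbrakk> \<Longrightarrow>
    F2.orbit_norm H \<eta> z \<le> C * l1_norm G H (F 2) (B 2) \<eta>"
    using F2.cochain_value_bound[OF z] by blast
  have "F1.orbit_norm H \<phi> (d 2 z)
      \<le> C * l1_norm G H (F 2) (B 2) (coboundary \<phi>)"
    if H: "subgroup H G" and fin: "finite (rcosets H)" and \<phi>: "\<phi> \<in> cochains G H (F 1)" for H \<phi>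
  proof -
    have "F1.orbit_norm H \<phi> (d 2 z) =
        F2.orbit_norm H (coboundary \<phi>) z"
    proof (rule sum.cong[OF refl])
      fix K assume "K \<in> rcosets H"
      then have t: "coset_rep K \<in> carrier G" by (rule coset_rep(1)[OF H])
      show "real_of_int \<bar>\<phi> (F1.translate (coset_rep K) (d 2 z))\<bar> =
        real_of_int \<bar>coboundary \<phi> (F2.translate (coset_rep K) z)\<bar>"
        using F2.translate_closed[OF t z] by (simp add: coboundary_eq d2_translate[OF t z])
    qed
    also have "\<dots> \<le> C * l1_norm G H (F 2) (B 2) (coboundary \<phi>)"
      by (rule bound[OF H fin coboundary_cochain[OF H \<phi>]])
    finally show ?thesis .
  qed
  with C show ?thesis by blast
qed

abbreviation link_error :: "'g set \<Rightarrow> ('m \<Rightarrow> int) \<Rightarrow> ('g set \<Rightarrow> int) \<Rightarrow> real"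
  where "link_error H \<omega> f \<equiv> (\<Sum>g\<in>support. \<Sum>K\<in>rcosets H.
    real_of_int \<bar>\<omega> (F1.translate (coset_rep K) (link g)) - (f (K #> g) - f K)\<bar>)"

abbreviation total_weight :: real
  where "total_weight \<equiv> (\<Sum>a\<in>B 1. \<Sum>g\<in>support. real_of_int \<bar>weight a g\<bar>)"

text \<open>If \<open>\<omega>\<close> were the coboundary of a cochain \<open>f'\<close> with the values \<open>f\<close> on the translates of the base point,
then the values of \<open>f'\<close> on the basis of \<open>F 0\<close> could be read off from \<open>\<omega>\<close> on the lifts of the basis.
These values define \<open>f'\<close> in general. By
\<open>basis_element_decomposition\<close>, the difference of \<open>\<omega>\<close> and the coboundary of \<open>f'\<close> at a basis element of
\<open>F 1\<close> is a combination of the errors on the links and one value of the coboundary of \<open>\<omega>\<close>.\<close>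

lemma primitive_correction:
  "\<exists>C\<ge>0. \<forall>H \<omega> f. subgroup H G \<longrightarrow> finite (rcosets H) \<longrightarrow> \<omega> \<in> cochains G H (F 1) \<longrightarrow>
    (\<exists>\<omega>'\<in>cochains G H (F 1). coboundary \<omega>' = coboundary \<omega> \<and>
      l1_norm G H (F 1) (B 1) \<omega>' \<le>
        total_weight *
          link_error H \<omega> f
        + C * l1_norm G H (F 2) (B 2) (coboundary \<omega>))"
proof -
  have "\<forall>a\<in>B 1. \<exists>z. z \<in> carrier (F 2) \<and> (\<forall>f. additive_functional (F 1) f \<longrightarrow>
    f a = (\<Sum>b\<in>B 0. \<Sum>g\<in>support. F0.coords (d 1 a) b g * f (F1.translate g (lift b)))
      + (\<Sum>g\<in>support. weight a g * f (link g)) + f (d 2 z))"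
    using basis_element_decomposition by blast
  from bchoice[OF this] obtain z where z: "\<And>a. a \<in> B 1 \<Longrightarrow> z a \<in> carrier (F 2)"
    and dec: "\<And>a f. \<lbrakk>a \<in> B 1; additive_functional (F 1) f\<rbrakk> \<Longrightarrow>
      f a = (\<Sum>b\<in>B 0. \<Sum>g\<in>support. F0.coords (d 1 a) b g * f (F1.translate g (lift b)))
      + (\<Sum>g\<in>support. weight a g * f (link g)) + f (d 2 (z a))" by blast
  have "\<forall>a\<in>B 1. \<exists>C\<ge>0. \<forall>H \<phi>. subgroup H G \<longrightarrow> finite (rcosets H) \<longrightarrow> \<phi> \<in> cochains G H (F 1) \<longrightarrow>
    F1.orbit_norm H \<phi> (d 2 (z a))
      \<le> C * l1_norm G H (F 2) (B 2) (coboundary \<phi>)"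
    using coboundary_value_bound[OF z] by blast
  from bchoice[OF this] obtain c where c: "\<And>a. a \<in> B 1 \<Longrightarrow> 0 \<le> c a"
    and bound: "\<And>a H \<phi>. \<lbrakk>a \<in> B 1; subgroup H G; finite (rcosets H); \<phi> \<in> cochains G H (F 1)\<rbrakk> \<Longrightarrow>
    F1.orbit_norm H \<phi> (d 2 (z a))
      \<le> c a * l1_norm G H (F 2) (B 2) (coboundary \<phi>)" by blast
  have sG: "g \<in> carrier G" if "g \<in> support" for g using that support_closed by blast
  have main: "\<exists>\<omega>'\<in>cochains G H (F 1). coboundary \<omega>' = coboundary \<omega> \<and>
      l1_norm G H (F 1) (B 1) \<omega>' \<le>
        total_weight *
          link_error H \<omega> f
        + (\<Sum>a\<in>B 1. c a) * l1_norm G H (F 2) (B 2) (coboundary \<omega>)"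
    if H: "subgroup H G" and fin: "finite (rcosets H)" and \<omega>: "\<omega> \<in> cochains G H (F 1)"
    for H \<omega> and f :: "'g set \<Rightarrow> int"
  proof -
    have HG: "h \<in> carrier G" if "h \<in> H" for h using that subgroup.subset[OF H] by blast
    note \<omega>_add = F1.cochain_additive[OF \<omega>]
    \<comment> \<open>The boundary of \<open>lift b\<close> is \<open>b - e b * basepoint\<close>, and \<open>f\<close> stands for the values on translates of the base point.\<close>
    define v where "v b g = e b * f (H #> g) + \<omega> (F1.translate g (lift b))" for b g
    obtain f' where f': "additive_functional (F 0) f'"
      and f'_basis: "\<And>b g. \<lbrakk>b \<in> B 0; g \<in> carrier G\<rbrakk> \<Longrightarrow> f' (F0.translate g b) = v b g"
      by (rule F0.free_extension[of v]) (rule that)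
    have v_inv: "v b (h \<otimes> g) = v b g" if b: "b \<in> B 0" and h: "h \<in> H" and g: "g \<in> carrier G" for b h g
    proof -
      have "H #> (h \<otimes> g) = H #> g"
        using coset_mult_assoc[OF subgroup.subset[OF H] HG[OF h] g] coset_join2[OF HG[OF h] H h] by simp
      then show ?thesis
        unfolding v_def using F1.cochain_translation_invariant[OF H \<omega> lift(1)[OF F0.B_closed[OF b]] h g] by simp
    qed
    have f'_translate_basis: "f' (F0.translate t (F0.translate g b)) = v b (t \<otimes> g)"
      if "b \<in> B 0" "t \<in> carrier G" "g \<in> carrier G" for b t g
      using that F0.translate_mult[OF that(2,3) F0.B_closed[OF that(1)]] f'_basis[OF that(1), of "t \<otimes> g"]
      by simp
    have f'_inv: "f' (F0.translate h x) = f' x" if h: "h \<in> H" and x: "x \<in> carrier (F 0)" for h x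
    proof -
      have "f' (F0.translate h x) =
          (\<Sum>b\<in>B 0. pairing (F0.coords x b) (\<lambda>g. f' (F0.translate h (F0.translate g b))))"
        by (rule F0.additive_expand[OF F0.additive_translate[OF f' HG[OF h]] x])
      also have "\<dots> = (\<Sum>b\<in>B 0. pairing (F0.coords x b) (\<lambda>g. f' (F0.translate g b)))"
      proof (rule sum.cong[OF refl])
        fix b assume b: "b \<in> B 0"
        show "pairing (F0.coords x b) (\<lambda>g. f' (F0.translate h (F0.translate g b))) =
          pairing (F0.coords x b) (\<lambda>g. f' (F0.translate g b))"
          unfolding pairing_def
        proof (rule sum.cong[OF refl])
          fix g assume "g \<in> {g. F0.coords x b g \<noteq> 0}"
          then have g: "g \<in> carrier G" using F0.coords_supp[OF x b] by simp
          show "F0.coords x b g * f' (F0.translate h (F0.translate g b)) = F0.coords x b g * f' (F0.translate g b)"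
            by (simp add: f'_translate_basis[OF b HG[OF h] g] f'_basis[OF b g] v_inv[OF b h g])
        qed
      qed
      also have "\<dots> = f' x" by (rule F0.additive_expand[OF f' x, symmetric])
      finally show ?thesis .
    qed
    define u where "u y = \<omega> y - f' (d 1 y)" for y
    have u_add: "additive_functional (F 1) u"
      using \<omega>_add additive_d1[OF f'] by (simp add: additive_functional_def u_def)
    have u_inv: "u (F1.translate h y) = u y" if h: "h \<in> H" and y: "y \<in> carrier (F 1)" for h y
      unfolding u_def d1_translate[OF HG[OF h] y]
      by (simp only: F1.cochain_invariant[OF \<omega> h y] f'_inv[OF h d1_closed[OF y]])
    define \<omega>' where "\<omega>' = restrict u (carrier (F 1))"
    have \<omega>': "\<omega>' \<in> cochains G H (F 1)" unfolding \<omega>'_def by (rule F1.cochainI[OF H u_add u_inv])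
    have "coboundary \<omega>' = coboundary \<omega>"
      unfolding coboundary_eq
    proof (rule restrict_ext)
      fix x assume x: "x \<in> carrier (F 2)"
      have "d 2 x \<in> {y \<in> carrier (F 1). d 1 y = \<zero>\<^bsub>F 0\<^esub>}"
        unfolding exact(2)[symmetric] by (rule imageI[OF x])
      then show "\<omega>' (d 2 x) = \<omega> (d 2 x)" by (simp add: \<omega>'_def u_def F0.additive_zero[OF f'])
    qed
    moreover have "l1_norm G H (F 1) (B 1) \<omega>' \<le>
        total_weight *
          link_error H \<omega> f
        + (\<Sum>a\<in>B 1. c a) * l1_norm G H (F 2) (B 2) (coboundary \<omega>)"
    proof -
      define err where "err g K = \<omega> (F1.translate (coset_rep K) (link g)) - (f (K #> g) - f K)" for g K
      define E where "E g = (\<Sum>K\<in>rcosets H. real_of_int \<bar>err g K\<bar>)" for g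
      have u_basis: "u (F1.translate (coset_rep K) a) =
          (\<Sum>g\<in>support. weight a g * err g K) + \<omega> (F1.translate (coset_rep K) (d 2 (z a)))"
        if K: "K \<in> rcosets H" and a: "a \<in> B 1" for K a
      proof -
        let ?t = "coset_rep K"
        have t: "?t \<in> carrier G" and HtK: "H #> ?t = K" by (rule coset_rep[OF H K])+
        have step: "H #> (?t \<otimes> g) = K #> g" if "g \<in> carrier G" for g
          using coset_mult_assoc[OF subgroup.subset[OF H] t that] HtK by simp
        let ?r = "F0.coords (d 1 a)"
        have \<omega>a: "\<omega> (F1.translate ?t a) =
            (\<Sum>b\<in>B 0. \<Sum>g\<in>support. ?r b g * \<omega> (F1.translate ?t (F1.translate g (lift b))))
            + (\<Sum>g\<in>support. weight a g * \<omega> (F1.translate ?t (link g))) + \<omega> (F1.translate ?t (d 2 (z a)))"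
          by (rule dec[OF a F1.additive_translate[OF \<omega>_add t]])
        have "f' (d 1 (F1.translate ?t a)) = f' (F0.translate ?t (d 1 a))"
          by (simp only: d1_translate[OF t F1.B_closed[OF a]])
        also have "\<dots> = (\<Sum>b\<in>B 0. \<Sum>g\<in>support. ?r b g * f' (F0.translate ?t (F0.translate g b)))"
          by (rule expand_over_support[OF a F0.additive_translate[OF f' t]])
        also have "\<dots> = (\<Sum>b\<in>B 0. \<Sum>g\<in>support. e b * ?r b g * f (K #> g)
            + ?r b g * \<omega> (F1.translate ?t (F1.translate g (lift b))))"
        proof (intro sum.cong refl)
          fix b g assume b: "b \<in> B 0" and "g \<in> support"
          then have g: "g \<in> carrier G" by (simp add: sG)
          show "?r b g * f' (F0.translate ?t (F0.translate g b)) =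
            e b * ?r b g * f (K #> g) + ?r b g * \<omega> (F1.translate ?t (F1.translate g (lift b)))"
            unfolding f'_translate_basis[OF b t g] v_def step[OF g] F1.translate_mult[OF t g lift(1)[OF F0.B_closed[OF b]]]
            by (simp add: algebra_simps)
        qed
        also have "\<dots> = (\<Sum>g\<in>support. weight a g * f (K #> g))
            + (\<Sum>b\<in>B 0. \<Sum>g\<in>support. ?r b g * \<omega> (F1.translate ?t (F1.translate g (lift b))))"
        proof -
          have "(\<Sum>b\<in>B 0. \<Sum>g\<in>support. e b * ?r b g * f (K #> g)) = (\<Sum>g\<in>support. weight a g * f (K #> g))"
            unfolding weight_def sum_distrib_right by (rule sum.swap)
          then show ?thesis by (simp only: sum.distrib)
        qed
        finally have f'a: "f' (d 1 (F1.translate ?t a)) = (\<Sum>g\<in>support. weight a g * f (K #> g))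
            + (\<Sum>b\<in>B 0. \<Sum>g\<in>support. ?r b g * \<omega> (F1.translate ?t (F1.translate g (lift b))))" .
        have "(\<Sum>g\<in>support. weight a g * f K) = 0"
          unfolding sum_distrib_right[symmetric] weight_sum_eq_0[OF a] by simp
        moreover have "(\<Sum>g\<in>support. weight a g * err g K) =
            (\<Sum>g\<in>support. weight a g * \<omega> (F1.translate ?t (link g)))
            - (\<Sum>g\<in>support. weight a g * f (K #> g)) + (\<Sum>g\<in>support. weight a g * f K)"
          unfolding sum_subtractf[symmetric] sum.distrib[symmetric]
          by (intro sum.cong refl) (simp add: err_def algebra_simps)
        ultimately show ?thesis unfolding u_def \<omega>a f'a by simp
      qed
      have "l1_norm G H (F 1) (B 1) \<omega>' \<le> (\<Sum>K\<in>rcosets H. \<Sum>a\<in>B 1.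
          (\<Sum>g\<in>support. real_of_int \<bar>weight a g\<bar> * real_of_int \<bar>err g K\<bar>)
          + real_of_int \<bar>\<omega> (F1.translate (coset_rep K) (d 2 (z a)))\<bar>)"
        unfolding F1.l1_norm_eq
      proof (intro sum_mono)
        fix K a assume K: "K \<in> rcosets H" and a: "a \<in> B 1"
        have "\<omega>' (F1.translate (coset_rep K) a) = u (F1.translate (coset_rep K) a)"
          using F1.translate_closed[OF coset_rep(1)[OF H K] F1.B_closed[OF a]] by (simp add: \<omega>'_def)
        also have "\<dots> = (\<Sum>g\<in>support. weight a g * err g K) + \<omega> (F1.translate (coset_rep K) (d 2 (z a)))"
          by (rule u_basis[OF K a])
        finally have "\<bar>\<omega>' (F1.translate (coset_rep K) a)\<bar> \<le>
            \<bar>\<Sum>g\<in>support. weight a g * err g K\<bar> + \<bar>\<omega> (F1.translate (coset_rep K) (d 2 (z a)))\<bar>"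
          by (simp only: abs_triangle_ineq)
        also have "\<bar>\<Sum>g\<in>support. weight a g * err g K\<bar> \<le> (\<Sum>g\<in>support. \<bar>weight a g\<bar> * \<bar>err g K\<bar>)"
          unfolding abs_mult[symmetric] by (rule sum_abs)
        finally have "\<bar>\<omega>' (F1.translate (coset_rep K) a)\<bar> \<le>
            (\<Sum>g\<in>support. \<bar>weight a g\<bar> * \<bar>err g K\<bar>) + \<bar>\<omega> (F1.translate (coset_rep K) (d 2 (z a)))\<bar>" by simp
        then have "real_of_int \<bar>\<omega>' (F1.translate (coset_rep K) a)\<bar> \<le>
            real_of_int ((\<Sum>g\<in>support. \<bar>weight a g\<bar> * \<bar>err g K\<bar>) + \<bar>\<omega> (F1.translate (coset_rep K) (d 2 (z a)))\<bar>)"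
          by (simp only: of_int_le_iff)
        then show "real_of_int \<bar>\<omega>' (F1.translate (coset_rep K) a)\<bar> \<le>
            (\<Sum>g\<in>support. real_of_int \<bar>weight a g\<bar> * real_of_int \<bar>err g K\<bar>)
            + real_of_int \<bar>\<omega> (F1.translate (coset_rep K) (d 2 (z a)))\<bar>"
          by (simp only: of_int_add of_int_sum of_int_mult)
      qed
      also have "\<dots> = (\<Sum>a\<in>B 1. \<Sum>K\<in>rcosets H.
          (\<Sum>g\<in>support. real_of_int \<bar>weight a g\<bar> * real_of_int \<bar>err g K\<bar>)
          + real_of_int \<bar>\<omega> (F1.translate (coset_rep K) (d 2 (z a)))\<bar>)" by (rule sum.swap)
      also have "\<dots> = (\<Sum>a\<in>B 1. (\<Sum>g\<in>support. real_of_int \<bar>weight a g\<bar> * E g)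
          + F1.orbit_norm H \<omega> (d 2 (z a)))"
        unfolding sum.distrib E_def sum_distrib_left
        by (intro arg_cong2[where f = "(+)"] sum.cong refl sum.swap)
      also have "\<dots> \<le> (\<Sum>a\<in>B 1. (\<Sum>g\<in>support. real_of_int \<bar>weight a g\<bar> * (\<Sum>g\<in>support. E g))
          + c a * l1_norm G H (F 2) (B 2) (coboundary \<omega>))"
      proof (intro sum_mono add_mono mult_left_mono)
        have E0: "0 \<le> E g" for g unfolding E_def by (rule sum_nonneg) simp
        show "E g \<le> (\<Sum>g\<in>support. E g)" if "g \<in> support" for g
          by (rule member_le_sum[OF that E0 finite_support])
        show "F1.orbit_norm H \<omega> (d 2 (z a))
          \<le> c a * l1_norm G H (F 2) (B 2) (coboundary \<omega>)" if "a \<in> B 1" for a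
          by (rule bound[OF that H fin \<omega>])
      qed simp
      also have "\<dots> = total_weight * (\<Sum>g\<in>support. E g)
          + (\<Sum>a\<in>B 1. c a) * l1_norm G H (F 2) (B 2) (coboundary \<omega>)"
        by (simp only: sum.distrib sum_distrib_right)
      finally show ?thesis unfolding E_def err_def .
    qed
    ultimately show ?thesis using \<omega>' by blast
  qed
  have "0 \<le> (\<Sum>a\<in>B 1. c a)" using c by (rule sum_nonneg)
  then show ?thesis using main by (intro exI[of _ "\<Sum>a\<in>B 1. c a"]) blast
qed

text \<open>The norm takes values in the natural numbers.\<close>

lemma minimal_primitive:
  assumes "\<omega>0 \<in> cochains G H (F 1)"
  obtains \<omega> where "\<omega> \<in> cochains G H (F 1)" "coboundary \<omega> = coboundary \<omega>0"
    "\<And>\<omega>'. \<lbrakk>\<omega>' \<in> cochains G H (F 1); coboundary \<omega>' = coboundary \<omega>0\<rbrakk> \<Longrightarrow>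
      l1_norm G H (F 1) (B 1) \<omega> \<le> l1_norm G H (F 1) (B 1) \<omega>'"
proof -
  define nat_norm where "nat_norm \<phi> = (\<Sum>K\<in>rcosets H. \<Sum>b\<in>B 1. nat \<bar>\<phi> (F1.translate (coset_rep K) b)\<bar>)" for \<phi>
  have nat_norm: "l1_norm G H (F 1) (B 1) \<phi> = real (nat_norm \<phi>)" for \<phi>
    unfolding F1.l1_norm_eq nat_norm_def of_nat_sum by (intro sum.cong refl) simp
  define P where "P \<omega> \<longleftrightarrow> \<omega> \<in> cochains G H (F 1) \<and> coboundary \<omega> = coboundary \<omega>0" for \<omega>
  have "P \<omega>0" using assms by (simp add: P_def)
  from ex_has_least_nat[of P, OF this, of nat_norm]
  obtain \<omega> where \<omega>: "P \<omega>" and least: "\<forall>\<omega>'. P \<omega>' \<longrightarrow> nat_norm \<omega> \<le> nat_norm \<omega>'" by blast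
  show ?thesis
  proof (rule that[of \<omega>])
    show "\<omega> \<in> cochains G H (F 1)" "coboundary \<omega> = coboundary \<omega>0" using \<omega> by (simp_all add: P_def)
    fix \<omega>' assume "\<omega>' \<in> cochains G H (F 1)" "coboundary \<omega>' = coboundary \<omega>0"
    then have "P \<omega>'" unfolding P_def ..
    then show "l1_norm G H (F 1) (B 1) \<omega> \<le> l1_norm G H (F 1) (B 1) \<omega>'"
      unfolding nat_norm of_nat_le_iff using least by blast
  qed
qed

text \<open>A sequence of counterexamples of least norm gives an almost cocycle for the action on cosets. Its
approximation by the coboundary of an integer-valued function makes \<open>primitive_correction\<close> return a
primitive of smaller norm.\<close>

lemma property_T_uniform_primitives:
  assumes T: "property_T G"
  shows "\<exists>C::real. \<forall>H. H \<lhd> G \<and> finite (rcosets H) \<longrightarrow>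
    (\<forall>\<eta> \<in> coboundary ` cochains G H (F 1). \<exists>\<omega> \<in> cochains G H (F 1).
        coboundary \<omega> = \<eta> \<and> l1_norm G H (F 1) (B 1) \<omega> \<le> C * l1_norm G H (F 2) (B 2) \<eta>)"
proof (rule ccontr)
  assume contra: "\<not> ?thesis"
  let ?n1 = "\<lambda>H. l1_norm G H (F 1) (B 1)" and ?n2 = "\<lambda>H \<omega>. l1_norm G H (F 2) (B 2) (coboundary \<omega>)"
  have "\<exists>H \<omega>. subgroup H G \<and> finite (rcosets H) \<and> \<omega> \<in> cochains G H (F 1) \<and>
      (\<forall>\<omega>'. \<omega>' \<in> cochains G H (F 1) \<and> coboundary \<omega>' = coboundary \<omega> \<longrightarrow> ?n1 H \<omega> \<le> ?n1 H \<omega>') \<and>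
      real (Suc n) * ?n2 H \<omega> < ?n1 H \<omega>" for n
  proof -
    from contra obtain H \<omega>0 where H: "H \<lhd> G" "finite (rcosets H)" and \<omega>0: "\<omega>0 \<in> cochains G H (F 1)"
      and bad: "\<And>\<omega>. \<lbrakk>\<omega> \<in> cochains G H (F 1); coboundary \<omega> = coboundary \<omega>0\<rbrakk> \<Longrightarrow>
        \<not> ?n1 H \<omega> \<le> real (Suc n) * ?n2 H \<omega>0" by blast
    obtain \<omega> where \<omega>: "\<omega> \<in> cochains G H (F 1)" "coboundary \<omega> = coboundary \<omega>0"
      and min: "\<And>\<omega>'. \<lbrakk>\<omega>' \<in> cochains G H (F 1); coboundary \<omega>' = coboundary \<omega>0\<rbrakk> \<Longrightarrow> ?n1 H \<omega> \<le> ?n1 H \<omega>'"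
      by (rule minimal_primitive[OF \<omega>0]) (rule that)
    show ?thesis
      using normal_imp_subgroup[OF H(1)] H(2) \<omega> min bad[OF \<omega>]
      by (intro exI[of _ H] exI[of _ \<omega>]) (simp add: not_le)
  qed
  then obtain H \<omega> where H: "\<And>n. subgroup (H n) G" and fin: "\<And>n. finite (rcosets (H n))"
    and \<omega>: "\<And>n. \<omega> n \<in> cochains G (H n) (F 1)"
    and minimal: "\<And>n \<omega>'. \<lbrakk>\<omega>' \<in> cochains G (H n) (F 1); coboundary \<omega>' = coboundary (\<omega> n)\<rbrakk> \<Longrightarrow>
      ?n1 (H n) (\<omega> n) \<le> ?n1 (H n) \<omega>'"
    and large: "\<And>n. real (Suc n) * ?n2 (H n) (\<omega> n) < ?n1 (H n) (\<omega> n)" by metis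
  define N where "N n = ?n1 (H n) (\<omega> n)" for n
  have n2: "0 \<le> ?n2 (H n) (\<omega> n)" for n by (rule F2.l1_norm_nonneg)
  have N: "0 < N n" for n
  proof -
    have "0 \<le> real (Suc n) * ?n2 (H n) (\<omega> n)" by (intro mult_nonneg_nonneg n2) simp
    then show ?thesis using large[of n] by (simp only: N_def)
  qed
  have small: "?n2 (H n) (\<omega> n) \<le> N n / real (Suc n)" for n
    using large[of n] by (simp only: N_def pos_le_divide_eq[OF of_nat_0_less_iff[THEN iffD2, OF zero_less_Suc]]
        mult.commute[of _ "real (Suc n)"] less_imp_le)
  define c where "c n g K = \<omega> n (F1.translate (coset_rep K) (link g))" for n g K
  have "\<forall>g\<in>carrier G. \<exists>C\<ge>0. \<forall>H \<phi>. subgroup H G \<longrightarrow> finite (rcosets H) \<longrightarrow> \<phi> \<in> cochains G H (F 1) \<longrightarrow>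
    F1.orbit_norm H \<phi> (link g) \<le> C * ?n1 H \<phi>"
    using F1.cochain_value_bound[OF link(1)] by blast
  from bchoice[OF this] obtain L where L: "\<And>g H \<phi>. \<lbrakk>g \<in> carrier G; subgroup H G; finite (rcosets H);
      \<phi> \<in> cochains G H (F 1)\<rbrakk> \<Longrightarrow>
    F1.orbit_norm H \<phi> (link g) \<le> L g * ?n1 H \<phi>" by blast
  define defect_bound where "defect_bound g h C \<longleftrightarrow> (\<forall>H \<phi>. subgroup H G \<longrightarrow> finite (rcosets H) \<longrightarrow> \<phi> \<in> cochains G H (F 1) \<longrightarrow>
    (\<Sum>K\<in>rcosets H. real_of_int \<bar>\<phi> (F1.translate (coset_rep K) (link (g \<otimes> h)))
      - (\<phi> (F1.translate (coset_rep K) (link g)) + \<phi> (F1.translate (coset_rep (K #> g)) (link h)))\<bar>) \<le> C * ?n2 H \<phi>)" for g h C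
  have "\<exists>C. defect_bound g h C"
    if g: "g \<in> carrier G" and h: "h \<in> carrier G" for g h
  proof -
    obtain z where z: "z \<in> carrier (F 2)" and fz: "\<And>f. additive_functional (F 1) f \<Longrightarrow>
      f (d 2 z) = f (link (g \<otimes> h)) - f (link g) - f (F1.translate g (link h))"
      using link_cocycle_defect[OF g h] by blast
    obtain C where C: "\<And>H \<phi>. \<lbrakk>subgroup H G; finite (rcosets H); \<phi> \<in> cochains G H (F 1)\<rbrakk> \<Longrightarrow>
      F1.orbit_norm H \<phi> (d 2 z) \<le> C * ?n2 H \<phi>"
      using coboundary_value_bound[OF z] by blast
    have "\<phi> (F1.translate (coset_rep K) (link (g \<otimes> h)))
      - (\<phi> (F1.translate (coset_rep K) (link g)) + \<phi> (F1.translate (coset_rep (K #> g)) (link h))) =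
      \<phi> (F1.translate (coset_rep K) (d 2 z))"
      if H: "subgroup H G" and \<phi>: "\<phi> \<in> cochains G H (F 1)" and K: "K \<in> rcosets H" for H \<phi> K
    proof -
      have t: "coset_rep K \<in> carrier G" by (rule coset_rep(1)[OF H K])
      have "\<phi> (F1.translate (coset_rep (K #> g)) (link h)) = \<phi> (F1.translate (coset_rep K \<otimes> g) (link h))"
        by (rule coset_rep_translate[OF H K g, where u = "\<lambda>t. \<phi> (F1.translate t (link h))"])
           (rule F1.cochain_translation_invariant[OF H \<phi> link(1)[OF h]])
      then show ?thesis
        using fz[OF F1.additive_translate[OF F1.cochain_additive[OF \<phi>] t]]
        by (simp add: F1.translate_mult[OF t g link(1)[OF h]])
    qed
    then have "defect_bound g h C" unfolding defect_bound_def using C by (simp cong: sum.cong)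
    then show ?thesis ..
  qed
  then have "\<forall>p\<in>carrier G \<times> carrier G. \<exists>C. defect_bound (fst p) (snd p) C" by auto
  from bchoice[OF this] obtain D' where "\<forall>p\<in>carrier G \<times> carrier G. defect_bound (fst p) (snd p) (D' p)" ..
  then have D': "defect_bound g h (D' (g, h))" if "g \<in> carrier G" "h \<in> carrier G" for g h using that by auto
  define D where "D g h = D' (g, h)" for g h
  have D: "(\<Sum>K\<in>rcosets H. real_of_int \<bar>\<phi> (F1.translate (coset_rep K) (link (g \<otimes> h)))
      - (\<phi> (F1.translate (coset_rep K) (link g)) + \<phi> (F1.translate (coset_rep (K #> g)) (link h)))\<bar>) \<le> D g h * ?n2 H \<phi>"
    if "g \<in> carrier G" "h \<in> carrier G" "subgroup H G" "finite (rcosets H)" "\<phi> \<in> cochains G H (F 1)"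
    for g h H \<phi>
    using D'[OF that(1,2)] that(3-) unfolding defect_bound_def D_def by blast
  define \<delta> where "\<delta> n g h = \<bar>D g h\<bar> / real (Suc n)" for n g h
  have almost: "(\<Sum>K\<in>rcosets (H n). real_of_int \<bar>c n (g \<otimes> h) K - (c n g K + c n h (K #> g))\<bar>) \<le> \<delta> n g h * N n"
    if "g \<in> carrier G" "h \<in> carrier G" for n g h
  proof -
    have "(\<Sum>K\<in>rcosets (H n). real_of_int \<bar>c n (g \<otimes> h) K - (c n g K + c n h (K #> g))\<bar>) \<le> D g h * ?n2 (H n) (\<omega> n)"
      unfolding c_def by (rule D[OF that H fin \<omega>])
    also have "\<dots> \<le> \<bar>D g h\<bar> * ?n2 (H n) (\<omega> n)" by (intro mult_right_mono n2) simp
    also have "\<dots> \<le> \<bar>D g h\<bar> * (N n / real (Suc n))" by (intro mult_left_mono small) simp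
    finally show ?thesis by (simp add: \<delta>_def)
  qed
  obtain C where C: "0 \<le> C" and correction: "\<And>H \<omega> f. \<lbrakk>subgroup H G; finite (rcosets H); \<omega> \<in> cochains G H (F 1)\<rbrakk> \<Longrightarrow>
    \<exists>\<omega>'\<in>cochains G H (F 1). coboundary \<omega>' = coboundary \<omega> \<and>
      ?n1 H \<omega>' \<le> total_weight *
          link_error H \<omega> f
        + C * ?n2 H \<omega>"
    using primitive_correction by blast
  define W where "W = total_weight"
  have W: "0 \<le> W" unfolding W_def by (intro sum_nonneg) simp
  \<comment> \<open>Each of the two error terms of the correction is to be at most a third of the norm of \<open>\<omega> n\<close>.\<close>
  define \<epsilon> where "\<epsilon> = 1 / (3 * (W + 1))"
  have \<epsilon>: "0 < \<epsilon>" using W by (simp add: \<epsilon>_def)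
  obtain n0 :: nat where n0: "3 * C < real n0" using reals_Archimedean2 by blast
  obtain n f where n: "n0 \<le> n" and f: "(\<Sum>g\<in>support. \<Sum>K\<in>rcosets (H n).
      real_of_int \<bar>c n g K - (f (K #> g) - f K)\<bar>) \<le> \<epsilon> * N n"
  proof -
    have "\<exists>n\<ge>n0. \<exists>f :: 'g set \<Rightarrow> int. (\<Sum>g\<in>support. \<Sum>K\<in>rcosets (H n).
      real_of_int \<bar>c n g K - (f (K #> g) - f K)\<bar>) \<le> \<epsilon> * N n"
    proof (rule property_T_almost_cocycle[where Y = "\<lambda>n. rcosets (H n)" and act = "\<lambda>_ g K. K #> g"
          and \<delta> = \<delta> and L = L, OF T fin _ N _ almost _ finite_support support_closed \<epsilon>])
      show "bij_betw (\<lambda>K. K #> g) (rcosets (H n)) (rcosets (H n))" if "g \<in> carrier G" for n g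
        by (rule rcosets_translation[OF H that])
      show "(\<Sum>K\<in>rcosets (H n). real_of_int \<bar>c n g K\<bar>) \<le> L g * N n" if "g \<in> carrier G" for n g
        unfolding c_def N_def by (rule L[OF that H fin \<omega>])
      show "(\<lambda>n. \<delta> n g h) \<longlonglongrightarrow> 0" for g h
        using tendsto_mult_left[OF LIMSEQ_inverse_real_of_nat, of "\<bar>D g h\<bar>"]
        by (simp add: \<delta>_def divide_inverse)
    qed
    then show ?thesis using that by blast
  qed
  obtain \<omega>' where \<omega>': "\<omega>' \<in> cochains G (H n) (F 1)" "coboundary \<omega>' = coboundary (\<omega> n)"
    and le: "?n1 (H n) \<omega>' \<le> W * link_error (H n) (\<omega> n) f + C * ?n2 (H n) (\<omega> n)"
    using correction[OF H fin \<omega>, of n f] unfolding W_def by blast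
  note le
  also have "W * link_error (H n) (\<omega> n) f + C * ?n2 (H n) (\<omega> n)
      \<le> W * (\<epsilon> * N n) + C * (N n / real (Suc n))"
    using f[unfolded c_def] by (intro add_mono mult_left_mono W C small)
  also have "\<dots> \<le> N n / 3 + N n / 3"
  proof (rule add_mono)
    have "W * \<epsilon> \<le> 1 / 3" using W by (simp add: \<epsilon>_def field_simps)
    then have "W * \<epsilon> * N n \<le> 1 / 3 * N n" using N[of n] by (intro mult_right_mono) simp_all
    then show "W * (\<epsilon> * N n) \<le> N n / 3" by (simp add: mult.assoc)
    have "3 * C \<le> real (Suc n)" using n0 n by simp
    then have "C / real (Suc n) \<le> 1 / 3" by (simp add: field_simps)
    then have "C / real (Suc n) * N n \<le> 1 / 3 * N n" using N[of n] by (intro mult_right_mono) simp_all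
    then show "C * (N n / real (Suc n)) \<le> N n / 3" by simp
  qed
  also have "\<dots> < N n" using N[of n] by simp
  finally show False using minimal[OF \<omega>'] by (simp add: N_def)
qed

end

theorem theorem3:
  fixes G :: "('g, 'x) monoid_scheme"
    and F :: "nat \<Rightarrow> ('g \<Rightarrow> int, 'm) module"
    and d :: "nat \<Rightarrow> 'm \<Rightarrow> 'm"
    and e :: "'m \<Rightarrow> int"
    and B :: "nat \<Rightarrow> 'm set"
  assumes "Group.group G"
    and "type_FP G 2"
    and "property_T G"
    and "partial_resolution G 2 F d e"
    and "\<And>i. i \<le> 2 \<Longrightarrow> finite_basis (group_ring G) (F i) (B i)"
  shows "\<exists>C::real. \<forall>H. H \<lhd> G \<and> finite (rcosets\<^bsub>G\<^esub> H) \<longrightarrow>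
    (\<forall>\<eta> \<in> coboundary_map F d 1 ` cochains G H (F 1).
      \<exists>\<omega> \<in> cochains G H (F 1).
        coboundary_map F d 1 \<omega> = \<eta> \<and>
        l1_norm G H (F 1) (B 1) \<omega> \<le> C * l1_norm G H (F 2) (B 2) \<eta>)"
proof -
  interpret free_two_step_resolution G F d e B
    using assms(1,4,5) by (intro free_two_step_resolution.intro free_two_step_resolution_axioms.intro)
  show ?thesis using assms(3) by (rule property_T_uniform_primitives)
qed

end
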